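(* Let $T$ be a tree as described in the context and let $p\in(1,\infty)$. With $\lambda_p$, the operators $I, I\!I, R,\widetilde R$ and the function sets defined in the context, the following hold. (1) Single summation forms: $$\sup_{f\in\mathscr{F}_{I}}\inf_{i\in V\setminus\{o\}}I_i(f)^{-1}\leqslant\lambda_p\leqslant\inf_{f\in\widetilde{\mathscr{F}}_{I}}\sup_{i\in V\setminus\{o\}}I_i(f)^{-1}.$$ (2) Double summation forms: $$\sup_{f\in S(\mathscr{F})}\inf_{i\in V\setminus\{o\}}I\!I_i(f)^{-1}\leqslant\lambda_p\leqslant\inf_{f\in S(\widetilde{\mathscr{F}})}\sup_{i\in V\setminus\{o\}}I\!I_i(f)^{-1},$$ where $S(\mathscr{F})$ may be either of $\mathscr{F}_{I\!I}$, $\mathscr{F}_{I}$, and $S(\widetilde{\mathscr{F}})$ may be any of $\widetilde{\mathscr{F}}_{I\!I}$, $\widetilde{\mathscr{F}}_{I}$, $\widetilde{\mathscr{F}}_{I\!I}'\cup\widetilde{\mathscr{F}}_{I\!I}$. (3) Difference forms: $$\sup_{w\in\mathscr{W}}\inf_{i\in V\setminus\{o\}}R_i(w)\leqslant\lambda_p\leqslant\inf_{w\in\widetilde{\mathscr{W}}}\sup_{i\in V\setminus\{o\}}\widetilde R_i(w).$$ Moreover, if $p\geqslant 2$, all the inequalities in (1), (2) and (3) are equalities.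
   Context: A tree $T$ is an undirected, connected, locally finite graph without cycles, with vertex set $V$ and a distinguished vertex $o$ (the root). The level $|i|$ of $i\in V$ is the number of edges on the unique simple path from $i$ to $o$; $N\leqslant\infty$ is the maximal level of $T$. $J(i)$ is the (finite) set of children of $i$ (neighbours at level $|i|+1$), and for $i\neq o$, $i^*$ is the parent of $i$ (neighbour at level $|i|-1$). $V_i$ is the vertex set of the subtree $T_i$ rooted at $i$ ($i$ and all its descendants). $\mathscr{P}(i)$ is the set of vertices on the simple path from $i\in V\setminus\{o\}$ to $o$, including $i$ but excluding $o$. Standing assumptions: the root $o$ has exactly one child; $\{\nu_i: i\in V\}$ and $\{\mu_i:i\in V\}$ are positive sequences with $\sum_{k\in V}\mu_k<\infty$. Conventions: empty sums are $0$, $1/0=\infty$, $1/\infty=0$. $\hat p$ is the conjugate exponent, $1/p+1/\hat p=1$, and $\hat\nu_j=\nu_j^{1-\hat p}$. For $f:V\to\mathbb{R}$ put $D_p(f)=\sum_{i\in V\setminus\{o\}}\nu_i|f_i-f_{i^*}|^p$, $\mu(|f|^p)=\sum_{k\in V}\mu_k|f_k|^p$, and $$\lambda_p=\inf\{D_p(f): \mu(|f|^p)=1,\ f_o=0\}.$$ Operators, for $i\in V\setminus\{o\}$: $$I_i(f)=\frac{1}{\nu_i(f_i-f_{i^*})^{p-1}}\sum_{j\in V_i}\mu_jf_j^{p-1},$$ $$I\!I_i(f)=\frac{1}{f_i^{p-1}}\Big[\sum_{k\in\mathscr{P}(i)}\hat\nu_k\Big(\sum_{j\in V_k}\mu_jf_j^{p-1}\Big)^{\hat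 p-1}\Big]^{p-1},$$ $$R_i(w)=\mu_i^{-1}\Big[\nu_i(1-w_i^{-1})^{p-1}-\sum_{j\in J(i)}\nu_j(w_j-1)^{p-1}\Big].$$ Function sets ($f$ real-valued on $V$; $w$ defined on $V\setminus\{o\}$, with the value $\infty$ at the unique child of $o$ and real values elsewhere): $\mathscr{F}_I=\{f: f_o=0,\ f_i>f_{i^*}\text{ for } i\in V\setminus\{o\}\}$. $\mathscr{F}_{I\!I}=\{f: f_o=0,\ f>0\text{ on }V\setminus\{o\}\}$. $\mathscr{W}=\{w: w>1,\ w=\infty \text{ at the child of } o\}$. $\widetilde{\mathscr{F}}_I=\{f\geqslant 0: f_o=0,\ \exists\,1\leqslant n<N+1\text{ such that } f_i>f_{i^*}\text{ for }1\leqslant |i|\leqslant n\text{ and }f_i=f_{i^*}\text{ for }|i|\geqslant n+1\}$. $\widetilde{\mathscr{F}}_{I\!I}=\{f\geqslant 0: f_o=0,\ f\neq 0,\ \exists\,1\leqslant n<N+1\text{ such that }f_i=f_{i^*}\text{ for }|i|\geqslant n+1\}$. $\widetilde{\mathscr{F}}_{I\!I}'=\{f\geqslant 0: f_o=0,\ f\neq 0,\ fI\!I(f)^{\hat p-1}\in L^p(\mu)\}$, where $fI\!I(f)^{\hat p-1}$ denotes the function $i\mapsto\sum_{k\in\mathscr{P}(i)}\hat\nu_k\big(\sum_{j\in V_k}\mu_jf_j^{p-1}\big)^{\hat p-1}$ on $V\setminus\{o\}$ (and $0$ at $o$). $\widetilde{\mathscr{W}}=\bigcup_{m:\,1\leqslant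 m<N+1}\widetilde{\mathscr{W}}_m$, where $\widetilde{\mathscr{W}}_m$ is the set of $w$ with $w=\infty$ at the child of $o$, with $w_i>1$ and $\sum_{j\in J(i)}\nu_j(w_j-1)^{p-1}<\nu_i(1-w_i^{-1})^{p-1}$ for $1\leqslant|i|\leqslant m$, and with $w_i=1$ for $|i|\geqslant m+1$. For $w\in\widetilde{\mathscr{W}}_m$, $\widetilde R_i(w)$ is defined by the same formula as $R_i(w)$ except that when $|i|=m$ the factor $\mu_i$ is replaced by $\tilde\mu_i=\sum_{j\in V_i}\mu_j$. *)

theory Defs
  imports "HOL-Analysis.Analysis" "Graph_Theory.Graph_Theory"
begin

text \<open>
  A simple undirected, possibly infinite graph is a symmetric, loop-free digraph without
  parallel arcs (locale \<open>pair_bidirected_digraph\<close>): every edge is a pair of opposite arcs.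
  Hence going back and forth along one edge is a cycle of length 2 in the sense of
  \<open>pre_digraph.cycle\<close>, and the cycles of the undirected graph are those of length at least 3.
\<close>

locale rooted_tree = pair_bidirected_digraph G
  for G :: "'v pair_pre_digraph" +
  fixes r :: 'v
  assumes root_in_verts: "r \<in> pverts G"
    and connected: "Digraph_Component.connected (with_proj G)"
    and no_cycles: "cycle c \<Longrightarrow> length c \<le> 2"
    and locally_finite: "i \<in> pverts G \<Longrightarrow> finite {j. (i, j) \<in> parcs G}"

definition path_to_root :: "'v pair_pre_digraph \<Rightarrow> 'v \<Rightarrow> 'v \<Rightarrow> ('v \<times> 'v) list" where
  "path_to_root G r i = (THE c. pre_digraph.apath (with_proj G) i c r)"

definition level :: "'v pair_pre_digraph \<Rightarrow> 'v \<Rightarrow> 'v \<Rightarrow> nat" where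
  "level G r i = length (path_to_root G r i)"

definition max_level :: "'v pair_pre_digraph \<Rightarrow> 'v \<Rightarrow> enat" where
  "max_level G r = (SUP i\<in>pverts G. enat (level G r i))"

definition children :: "'v pair_pre_digraph \<Rightarrow> 'v \<Rightarrow> 'v \<Rightarrow> 'v set" where
  "children G r i = {j. (i, j) \<in> parcs G \<and> level G r j = level G r i + 1}"

definition parent :: "'v pair_pre_digraph \<Rightarrow> 'v \<Rightarrow> 'v \<Rightarrow> 'v" where
  "parent G r i = (THE j. (i, j) \<in> parcs G \<and> level G r j + 1 = level G r i)"

definition subtree_verts :: "'v pair_pre_digraph \<Rightarrow> 'v \<Rightarrow> 'v \<Rightarrow> 'v set" where
  "subtree_verts G r i = {j. (i, j) \<in> {(a, b). b \<in> children G r a}\<^sup>*}"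

definition path_verts :: "'v pair_pre_digraph \<Rightarrow> 'v \<Rightarrow> 'v \<Rightarrow> 'v set" where
  "path_verts G r i = set (pawalk_verts i (path_to_root G r i)) - {r}"

definition conj_exp :: "real \<Rightarrow> real" where
  "conj_exp p = p / (p - 1)"

lemma conj_exp: "1 / p + 1 / conj_exp p = 1" if "1 < p"
  using that by (simp add: conj_exp_def field_simps)

text \<open>Real powers on \<open>[0, \<infinity>]\<close>; only used with exponent \<open>a > 0\<close>, where \<open>\<infinity>\<close> to the power \<open>a\<close> is \<open>\<infinity>\<close>.\<close>

definition ennpowr :: "ennreal \<Rightarrow> real \<Rightarrow> ennreal" where
  "ennpowr x a = (if x = \<infinity> then \<infinity> else ennreal (enn2real x powr a))"

text \<open>
  Functions on the vertex set are total functions on \<open>'v\<close> of which only the values on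
  \<open>pverts G\<close> matter. Sums over vertices of nonnegative terms, which may diverge, are taken in
  \<^typ>\<open>ennreal\<close>, where \<open>inverse 0 = \<infinity>\<close> and \<open>inverse \<infinity> = 0\<close>.
\<close>

definition D_p :: "'v pair_pre_digraph \<Rightarrow> 'v \<Rightarrow> real \<Rightarrow> ('v \<Rightarrow> real) \<Rightarrow> ('v \<Rightarrow> real) \<Rightarrow> ennreal" where
  "D_p G r p \<nu> f =
    (\<Sum>\<^sub>\<infinity>i\<in>pverts G - {r}. ennreal (\<nu> i * \<bar>f i - f (parent G r i)\<bar> powr p))"

definition mu_p :: "'v pair_pre_digraph \<Rightarrow> real \<Rightarrow> ('v \<Rightarrow> real) \<Rightarrow> ('v \<Rightarrow> real) \<Rightarrow> ennreal" where
  "mu_p G p \<mu> f = (\<Sum>\<^sub>\<infinity>k\<in>pverts G. ennreal (\<mu> k * \<bar>f k\<bar> powr p))"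

definition lambda_p ::
  "'v pair_pre_digraph \<Rightarrow> 'v \<Rightarrow> real \<Rightarrow> ('v \<Rightarrow> real) \<Rightarrow> ('v \<Rightarrow> real) \<Rightarrow> ennreal" where
  "lambda_p G r p \<nu> \<mu> = Inf {D_p G r p \<nu> f | f. mu_p G p \<mu> f = 1 \<and> f r = 0}"


text \<open>
  The operators below are only applied to functions that are nonnegative on \<open>pverts G\<close>, and
  \<open>I_op\<close> only to those with \<open>f i \<ge> f (parent G r i)\<close>, so \<open>powr\<close> never sees a negative base.
\<close>

definition subtree_sum ::
  "'v pair_pre_digraph \<Rightarrow> 'v \<Rightarrow> real \<Rightarrow> ('v \<Rightarrow> real) \<Rightarrow> ('v \<Rightarrow> real) \<Rightarrow> 'v \<Rightarrow> ennreal" where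
  "subtree_sum G r p \<mu> f i = (\<Sum>\<^sub>\<infinity>j\<in>subtree_verts G r i. ennreal (\<mu> j * f j powr (p - 1)))"

definition I_op ::
  "'v pair_pre_digraph \<Rightarrow> 'v \<Rightarrow> real \<Rightarrow> ('v \<Rightarrow> real) \<Rightarrow> ('v \<Rightarrow> real) \<Rightarrow> ('v \<Rightarrow> real) \<Rightarrow> 'v \<Rightarrow> ennreal" where
  "I_op G r p \<nu> \<mu> f i =
    inverse (ennreal (\<nu> i * (f i - f (parent G r i)) powr (p - 1))) * subtree_sum G r p \<mu> f i"

text \<open>
  The function \<open>f II(f)\<close> to the power \<open>conj_exp p - 1\<close>, in its explicit form. At the root it is an
  empty sum, hence \<open>0\<close>.
\<close>

definition II_sum ::
  "'v pair_pre_digraph \<Rightarrow> 'v \<Rightarrow> real \<Rightarrow> ('v \<Rightarrow> real) \<Rightarrow> ('v \<Rightarrow> real) \<Rightarrow> ('v \<Rightarrow> real) \<Rightarrow> 'v \<Rightarrow> ennreal" where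
  "II_sum G r p \<nu> \<mu> f i =
    (\<Sum>k\<in>path_verts G r i.
       ennreal (\<nu> k powr (1 - conj_exp p)) * ennpowr (subtree_sum G r p \<mu> f k) (conj_exp p - 1))"

definition II_op ::
  "'v pair_pre_digraph \<Rightarrow> 'v \<Rightarrow> real \<Rightarrow> ('v \<Rightarrow> real) \<Rightarrow> ('v \<Rightarrow> real) \<Rightarrow> ('v \<Rightarrow> real) \<Rightarrow> 'v \<Rightarrow> ennreal" where
  "II_op G r p \<nu> \<mu> f i =
    inverse (ennreal (f i powr (p - 1))) * ennpowr (II_sum G r p \<nu> \<mu> f i) (p - 1)"

text \<open>
  The two terms of the bracket in \<open>R_op\<close>. \<open>w\<close> takes the value \<open>\<infinity>\<close> exactly at the child of the
  root, where \<open>inverse \<infinity> = 0\<close>; at all \<open>j\<close> in the sum \<open>w j\<close> is finite if \<open>i \<noteq> r\<close>.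
\<close>

definition child_term ::
  "'v pair_pre_digraph \<Rightarrow> 'v \<Rightarrow> real \<Rightarrow> ('v \<Rightarrow> real) \<Rightarrow> ('v \<Rightarrow> ereal) \<Rightarrow> 'v \<Rightarrow> real" where
  "child_term G r p \<nu> w i =
    (\<Sum>j\<in>children G r i. \<nu> j * (real_of_ereal (w j) - 1) powr (p - 1))"

definition own_term :: "real \<Rightarrow> ('v \<Rightarrow> real) \<Rightarrow> ('v \<Rightarrow> ereal) \<Rightarrow> 'v \<Rightarrow> real" where
  "own_term p \<nu> w i = \<nu> i * (1 - real_of_ereal (inverse (w i))) powr (p - 1)"

definition R_op ::
  "'v pair_pre_digraph \<Rightarrow> 'v \<Rightarrow> real \<Rightarrow> ('v \<Rightarrow> real) \<Rightarrow> ('v \<Rightarrow> real) \<Rightarrow> ('v \<Rightarrow> ereal) \<Rightarrow> 'v \<Rightarrow> real" where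
  "R_op G r p \<nu> \<mu> w i = inverse (\<mu> i) * (own_term p \<nu> w i - child_term G r p \<nu> w i)"

definition R_tilde ::
  "'v pair_pre_digraph \<Rightarrow> 'v \<Rightarrow> real \<Rightarrow> ('v \<Rightarrow> real) \<Rightarrow> ('v \<Rightarrow> real) \<Rightarrow> nat \<Rightarrow> ('v \<Rightarrow> ereal) \<Rightarrow> 'v \<Rightarrow> real" where
  "R_tilde G r p \<nu> \<mu> m w i =
    inverse (if level G r i = m then \<Sum>\<^sub>\<infinity>j\<in>subtree_verts G r i. \<mu> j else \<mu> i)
      * (own_term p \<nu> w i - child_term G r p \<nu> w i)"

definition F_I :: "'v pair_pre_digraph \<Rightarrow> 'v \<Rightarrow> ('v \<Rightarrow> real) set" where
  "F_I G r = {f. f r = 0 \<and> (\<forall>i\<in>pverts G - {r}. f i > f (parent G r i))}"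

definition F_II :: "'v pair_pre_digraph \<Rightarrow> 'v \<Rightarrow> ('v \<Rightarrow> real) set" where
  "F_II G r = {f. f r = 0 \<and> (\<forall>i\<in>pverts G - {r}. f i > 0)}"

definition F_I_tilde :: "'v pair_pre_digraph \<Rightarrow> 'v \<Rightarrow> ('v \<Rightarrow> real) set" where
  "F_I_tilde G r = {f. (\<forall>i\<in>pverts G. f i \<ge> 0) \<and> f r = 0 \<and>
    (\<exists>n\<ge>1. enat n < max_level G r + 1 \<and>
      (\<forall>i\<in>pverts G. 1 \<le> level G r i \<and> level G r i \<le> n \<longrightarrow> f i > f (parent G r i)) \<and>
      (\<forall>i\<in>pverts G. level G r i \<ge> n + 1 \<longrightarrow> f i = f (parent G r i)))}"

definition F_II_tilde :: "'v pair_pre_digraph \<Rightarrow> 'v \<Rightarrow> ('v \<Rightarrow> real) set" where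
  "F_II_tilde G r = {f. (\<forall>i\<in>pverts G. f i \<ge> 0) \<and> f r = 0 \<and> (\<exists>i\<in>pverts G. f i \<noteq> 0) \<and>
    (\<exists>n\<ge>1. enat n < max_level G r + 1 \<and>
      (\<forall>i\<in>pverts G. level G r i \<ge> n + 1 \<longrightarrow> f i = f (parent G r i)))}"

definition F_II_tilde' ::
  "'v pair_pre_digraph \<Rightarrow> 'v \<Rightarrow> real \<Rightarrow> ('v \<Rightarrow> real) \<Rightarrow> ('v \<Rightarrow> real) \<Rightarrow> ('v \<Rightarrow> real) set" where
  "F_II_tilde' G r p \<nu> \<mu> =
    {f. (\<forall>i\<in>pverts G. f i \<ge> 0) \<and> f r = 0 \<and> (\<exists>i\<in>pverts G. f i \<noteq> 0) \<and>
      (\<Sum>\<^sub>\<infinity>i\<in>pverts G. ennreal (\<mu> i) * ennpowr (II_sum G r p \<nu> \<mu> f i) p) < \<infinity>}"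

definition W_base :: "'v pair_pre_digraph \<Rightarrow> 'v \<Rightarrow> ('v \<Rightarrow> ereal) set" where
  "W_base G r = {w. (\<forall>i\<in>children G r r. w i = \<infinity>) \<and>
    (\<forall>i\<in>pverts G - {r} - children G r r. \<bar>w i\<bar> \<noteq> \<infinity>)}"

definition W_set :: "'v pair_pre_digraph \<Rightarrow> 'v \<Rightarrow> ('v \<Rightarrow> ereal) set" where
  "W_set G r = {w \<in> W_base G r. \<forall>i\<in>pverts G - {r}. w i > 1}"

definition W_tilde ::
  "'v pair_pre_digraph \<Rightarrow> 'v \<Rightarrow> real \<Rightarrow> ('v \<Rightarrow> real) \<Rightarrow> nat \<Rightarrow> ('v \<Rightarrow> ereal) set" where
  "W_tilde G r p \<nu> m = {w \<in> W_base G r.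
    (\<forall>i\<in>pverts G. 1 \<le> level G r i \<and> level G r i \<le> m \<longrightarrow>
       w i > 1 \<and> child_term G r p \<nu> w i < own_term p \<nu> w i) \<and>
    (\<forall>i\<in>pverts G. level G r i \<ge> m + 1 \<longrightarrow> w i = 1)}"

text \<open>
  The union of the sets \<open>W_tilde G r p \<nu> m\<close> over \<open>1 \<le> m < N + 1\<close>, each \<open>w\<close> being paired with its
  \<open>m\<close>, on which \<open>R_tilde\<close> depends. The union is disjoint, as \<open>m\<close> is the largest level
  on which \<open>w > 1\<close>.
\<close>

definition W_tilde_pairs ::
  "'v pair_pre_digraph \<Rightarrow> 'v \<Rightarrow> real \<Rightarrow> ('v \<Rightarrow> real) \<Rightarrow> (nat \<times> ('v \<Rightarrow> ereal)) set" where
  "W_tilde_pairs G r p \<nu> = (SIGMA m:{m. 1 \<le> m \<and> enat m < max_level G r + 1}. W_tilde G r p \<nu> m)"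

end

theory Submission
  imports Defs
begin

text \<open>
  Call \<open>\<nu> i * (f i - f (parent i)) powr (p - 1)\<close> the flow of \<open>f\<close> through the edge above \<open>i\<close>, and the sum of
  \<open>\<mu> * f powr (p - 1)\<close> over the subtree of \<open>i\<close> the subtree sum of \<open>f\<close>. For an eigenfunction with eigenvalue \<open>l\<close>,
  the flow is \<open>l\<close> times the subtree sum. The three operators measure the deviation from this equation:
  \<open>1 / I\<close> is the quotient of the two; \<open>1 / II\<close> compares \<open>f\<close> with the potential \<open>pot f\<close>, the function whose
  flow is the subtree sum of \<open>f\<close>; and \<open>R\<close>, for \<open>w i = f i / f (parent i)\<close>, compares the defect of the flow at
  \<open>i\<close> (what enters from above minus what leaves below) with \<open>\<mu> i * f i powr (p - 1)\<close>.

  Summing defects over a subtree leads from \<open>R\<close> to \<open>I\<close>; taking roots and summing increments along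
  the path to the root leads from \<open>I\<close> to \<open>II\<close>. Both steps preserve one-sided bounds, so the lower
  bounds increase along \<open>R\<close>, \<open>I\<close>, \<open>II\<close> on \<open>F_I\<close>, \<open>II\<close> on \<open>F_II\<close>, and the upper bounds decrease in the
  same order (\<open>lower_R_le_I\<close>, \<open>lower_I_le_II\<close>, \<open>upper_I_le_R_tilde\<close>, \<open>upper_II_le_I\<close>). At the far end of each
  chain stands \<open>lambda_p\<close>: Jensen's inequality with the increments of \<open>pot f\<close> as weights bounds the
  energy of every competitor from below (\<open>lower_bound_II\<close>), and \<open>pot f\<close>, truncated if necessary, is itself
  a competitor (\<open>upper_bound_II\<close>).

  The chains close up. Truncate the tree at level \<open>n\<close> and let the vertices at level \<open>n\<close> carry the mass of
  their subtrees: this is a finite-dimensional problem with a positive minimiser, which satisfies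
  the eigenvalue equation (\<open>finite_eigenfunction\<close>, \<open>truncated_eigenpair_exists\<close>) and whose quotients \<open>w\<close>
  make the difference form constant on the truncated tree. Truncating a competitor does not raise
  its energy and, at a deep level, costs it little mass, so the truncated eigenvalues have infimum
  \<open>lambda_p\<close> (\<open>upper_bounds_sharp\<close>). On the other side, if \<open>lambda_p\<close> is positive, the truncated
  eigenfunctions have a pointwise limit point \<open>f\<close> whose flow is at least \<open>lambda_p\<close> times its subtree
  sums (\<open>limit_of_eigenfunctions\<close>); if it is \<open>0\<close>, let \<open>f\<close> be \<open>1\<close> off the root. The quotients of
  \<open>pot f\<close> then have \<open>R\<close> at least \<open>lambda_p\<close> (\<open>lower_bounds_sharp\<close>). Hence every term of each chain
  equals \<open>lambda_p\<close>.
\<close>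

section \<open>Sums and powers\<close>

subsection \<open>Unconditional sums of extended nonnegative reals\<close>

lemma summable_ennreal [simp]: "(f :: 'a \<Rightarrow> ennreal) summable_on A"
  by (rule nonneg_summable_on_complete) simp

lemma sum_le_infsum_ennreal:
  fixes f :: "'a \<Rightarrow> ennreal"
  assumes "finite F" "F \<subseteq> A"
  shows "sum f F \<le> infsum f A"
  unfolding nonneg_infsum_complete[of A f, OF zero_le] using assms by (intro SUP_upper) auto

lemma infsum_le_ennreal:
  fixes f :: "'a \<Rightarrow> ennreal"
  assumes "\<And>F. finite F \<Longrightarrow> F \<subseteq> A \<Longrightarrow> sum f F \<le> b"
  shows "infsum f A \<le> b"
  unfolding nonneg_infsum_complete[of A f, OF zero_le] using assms by (intro SUP_least) auto

lemma infsum_mono_ennreal: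
  fixes f g :: "'a \<Rightarrow> ennreal"
  assumes "\<And>x. x \<in> A \<Longrightarrow> f x \<le> g x"
  shows "infsum f A \<le> infsum g A"
  using assms by (intro infsum_mono) auto

lemma infsum_subset_ennreal:
  fixes f :: "'a \<Rightarrow> ennreal"
  assumes "A \<subseteq> B"
  shows "infsum f A \<le> infsum f B"
  using assms by (intro infsum_le_ennreal sum_le_infsum_ennreal) auto

lemma infsum_cmult_ennreal:
  fixes f :: "'a \<Rightarrow> ennreal"
  shows "infsum (\<lambda>x. c * f x) A = c * infsum f A"
  unfolding nonneg_infsum_complete[of A, OF zero_le]
  by (subst SUP_mult_left_ennreal) (simp add: sum_distrib_left)

lemma infsum_sum_ennreal:
  fixes f :: "'a \<Rightarrow> 'b \<Rightarrow> ennreal"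
  assumes "finite F"
  shows "infsum (\<lambda>y. \<Sum>x\<in>F. f x y) B = (\<Sum>x\<in>F. infsum (f x) B)"
  using assms by (induction rule: finite_induct) (simp_all add: infsum_add)

lemma infsum_swap_ennreal:
  fixes f :: "'a \<Rightarrow> 'b \<Rightarrow> ennreal"
  shows "infsum (\<lambda>x. infsum (f x) B) A = infsum (\<lambda>y. infsum (\<lambda>x. f x y) A) B"
proof -
  have le: "infsum (\<lambda>x. infsum (f x) B) A \<le> infsum (\<lambda>y. infsum (\<lambda>x. f x y) A) B"
    for f :: "'c \<Rightarrow> 'd \<Rightarrow> ennreal" and A B
  proof (rule infsum_le_ennreal)
    fix F assume F: "finite F" "F \<subseteq> A"
    have "(\<Sum>x\<in>F. infsum (f x) B) = infsum (\<lambda>y. \<Sum>x\<in>F. f x y) B"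
      using F by (simp add: infsum_sum_ennreal)
    also have "\<dots> \<le> infsum (\<lambda>y. infsum (\<lambda>x. f x y) A) B"
      using F by (intro infsum_mono_ennreal sum_le_infsum_ennreal)
    finally show "(\<Sum>x\<in>F. infsum (f x) B) \<le> infsum (\<lambda>y. infsum (\<lambda>x. f x y) A) B" .
  qed
  show ?thesis by (intro antisym le)
qed

lemma infsum_UN_disjoint_ennreal:
  fixes f :: "'a \<Rightarrow> ennreal"
  assumes "finite I" "disjoint_family_on A I"
  shows "infsum f (\<Union>i\<in>I. A i) = (\<Sum>i\<in>I. infsum f (A i))"
  using assms
proof (induction rule: finite_induct)
  case (insert i I)
  then have "A i \<inter> (\<Union>j\<in>I. A j) = {}" by (auto simp: disjoint_family_on_def)
  moreover have "disjoint_family_on A I" using insert by (auto simp: disjoint_family_on_def)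
  ultimately show ?case using insert by (simp add: infsum_Un_disjoint)
qed simp

lemma infsum_ennreal_of_real:
  fixes f :: "'a \<Rightarrow> real"
  assumes "f summable_on A" "\<And>x. x \<in> A \<Longrightarrow> 0 \<le> f x"
  shows "infsum (\<lambda>x. ennreal (f x)) A = ennreal (infsum f A)"
proof -
  have "(\<Sum>x\<in>F. ennreal (f x)) = ennreal (sum f F)" if "F \<subseteq> A" for F
    using that assms(2) by (intro sum_ennreal) auto
  then show ?thesis
    using infsum_nonneg_is_SUPREMUM_ennreal[OF assms]
    by (subst nonneg_infsum_complete) (auto intro!: SUP_cong)
qed

text \<open>
  Both \<open>I_op\<close> and \<open>II_op\<close> have the form \<open>inverse a * b\<close>. The identity covers \<open>a = 0\<close> and \<open>b = \<infinity>\<close>, where both sides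
  are \<open>0\<close>.
\<close>

lemma inverse_inverse_mult_ennreal:
  fixes b :: ennreal
  assumes "b \<noteq> 0"
  shows "inverse (inverse (ennreal a) * b) = ennreal a / b"
proof (cases "a \<le> 0")
  case True
  then show ?thesis using assms by (simp add: ennreal_neg ennreal_top_mult)
next
  case False
  then show ?thesis
    using assms by (subst ennreal_inverse_mult') (auto simp: inverse_ennreal divide_ennreal_def less_top[symmetric])
qed

lemma le_divide_imp_mult_le_ennreal:
  fixes a b c :: ennreal
  assumes "c \<le> a / b"
  shows "c * b \<le> a"
proof (cases "b = 0 \<or> b = top")
  case True
  then show ?thesis using assms by (auto simp: ennreal_divide_top)
next
  case False
  have "c * b \<le> a / b * b" using assms by (rule mult_right_mono) simp
  also have "\<dots> = a" using False by (simp add: ennreal_divide_times less_top[symmetric])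
  finally show ?thesis .
qed

lemma mult_le_imp_le_divide_ennreal:
  fixes a b c :: ennreal
  assumes "c * b \<le> a" "b \<noteq> 0" "b \<noteq> top"
  shows "c \<le> a / b"
proof -
  have "c = c * b / b" using assms(2,3) by (simp add: ennreal_mult_divide_eq)
  also have "\<dots> \<le> a / b" using assms(1) by (rule divide_right_mono_ennreal)
  finally show ?thesis .
qed

subsection \<open>Real powers\<close>

lemma ennpowr_ennreal: "0 \<le> x \<Longrightarrow> ennpowr (ennreal x) a = ennreal (x powr a)"
  by (simp add: ennpowr_def)

lemma powr_inverse_exponent:
  fixes x :: real
  assumes "0 \<le> x" "a \<noteq> 0"
  shows "(x powr a) powr (1 / a) = x" "(x powr (1 / a)) powr a = x"
  using assms by (simp_all add: powr_powr)

lemma conj_exp_minus_1: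
  assumes "1 < p"
  shows "conj_exp p - 1 = 1 / (p - 1)" "1 - conj_exp p = - (1 / (p - 1))"
  using assms by (simp_all add: conj_exp_def field_simps)

lemma powr_mult_powr_minus_1:
  fixes x :: real
  assumes "0 \<le> x"
  shows "x * x powr (p - 1) = x powr p"
  using assms by (cases "x = 0") (auto simp: powr_diff)

text \<open>
  This is Jensen's inequality for \<open>x powr p\<close>, with weights \<open>h k\<close>, at the points \<open>\<bar>x k\<bar> / h k\<close>.
\<close>

lemma weighted_power_mean:
  fixes x h :: "'a \<Rightarrow> real"
  assumes S: "finite S" and h: "\<And>k. k \<in> S \<Longrightarrow> 0 < h k" and p: "1 < p"
  shows "\<bar>\<Sum>k\<in>S. x k\<bar> powr p \<le> (\<Sum>k\<in>S. h k) powr (p - 1) * (\<Sum>k\<in>S. \<bar>x k\<bar> powr p * h k powr (1 - p))"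
proof -
  \<comment> \<open>Convexity of the power is applied on the open half line, so vanishing terms are set aside.\<close>
  define T where "T = {k \<in> S. x k \<noteq> 0}"
  have T: "finite T" "T \<subseteq> S" using S by (auto simp: T_def)
  have hT: "0 < h k" if "k \<in> T" for k using h T that by auto
  show ?thesis
  proof (cases "T = {}")
    case True
    then have "(\<Sum>k\<in>S. x k) = 0" by (intro sum.neutral) (auto simp: T_def)
    then show ?thesis by (simp add: sum_nonneg)
  next
    case False
    define H where "H = (\<Sum>k\<in>T. h k)"
    have H: "0 < H" unfolding H_def using False T hT by (intro sum_pos) auto
    have "(\<Sum>k\<in>T. (h k / H) *\<^sub>R (\<bar>x k\<bar> / h k)) powr p \<le> (\<Sum>k\<in>T. (h k / H) * (\<bar>x k\<bar> / h k) powr p)"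
    proof (rule convex_on_sum[where f = "\<lambda>x. x powr p" and C = "{0<..}"])
      show "(\<Sum>k\<in>T. h k / H) = 1"
        using H by (simp add: sum_divide_distrib[symmetric] H_def)
      show "\<bar>x k\<bar> / h k \<in> {0<..}" if "k \<in> T" for k using that hT by (auto simp: T_def)
      show "0 \<le> h k / H" if "k \<in> T" for k using that hT[of k] H by simp
    qed (use T False p powr_convex in auto)
    also have "(\<Sum>k\<in>T. (h k / H) *\<^sub>R (\<bar>x k\<bar> / h k)) = (\<Sum>k\<in>T. \<bar>x k\<bar>) / H"
      unfolding sum_divide_distrib by (intro sum.cong) (use hT in \<open>auto simp: less_imp_neq[symmetric]\<close>)
    also have "(\<Sum>k\<in>T. (h k / H) * (\<bar>x k\<bar> / h k) powr p) = (\<Sum>k\<in>T. \<bar>x k\<bar> powr p * h k powr (1 - p)) / H"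
      unfolding sum_divide_distrib using hT less_imp_le[OF hT]
      by (intro sum.cong) (auto simp: powr_divide powr_diff mult.commute)
    finally have "(\<Sum>k\<in>T. \<bar>x k\<bar>) powr p \<le> H powr (p - 1) * (\<Sum>k\<in>T. \<bar>x k\<bar> powr p * h k powr (1 - p))"
      using H by (simp add: powr_divide sum_nonneg powr_diff field_simps)
    also have "\<dots> \<le> (\<Sum>k\<in>S. h k) powr (p - 1) * (\<Sum>k\<in>S. \<bar>x k\<bar> powr p * h k powr (1 - p))"
    proof (rule mult_mono)
      show "H powr (p - 1) \<le> (\<Sum>k\<in>S. h k) powr (p - 1)"
        unfolding H_def using H p T h less_imp_le[OF h]
        by (intro powr_mono2 sum_mono2 S sum_nonneg) (auto simp: H_def)
      show "(\<Sum>k\<in>T. \<bar>x k\<bar> powr p * h k powr (1 - p)) \<le> (\<Sum>k\<in>S. \<bar>x k\<bar> powr p * h k powr (1 - p))"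
        using T S by (intro sum_mono2) auto
    qed (auto intro: sum_nonneg)
    finally have *: "(\<Sum>k\<in>T. \<bar>x k\<bar>) powr p \<le> (\<Sum>k\<in>S. h k) powr (p - 1) * (\<Sum>k\<in>S. \<bar>x k\<bar> powr p * h k powr (1 - p))" .
    have "(\<Sum>k\<in>S. x k) = (\<Sum>k\<in>T. x k)" using S by (intro sum.mono_neutral_right) (auto simp: T_def)
    then have "\<bar>\<Sum>k\<in>S. x k\<bar> powr p \<le> (\<Sum>k\<in>T. \<bar>x k\<bar>) powr p"
      using p by (intro powr_mono2) (auto intro: sum_abs)
    then show ?thesis using * by linarith
  qed
qed

lemma DERIV_abs_powr:
  fixes p x :: real
  assumes p: "1 < p"
  shows "((\<lambda>t. \<bar>x + t\<bar> powr p) has_real_derivative p * \<bar>x\<bar> powr (p - 1) * sgn x) (at 0)"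
proof (cases x "0::real" rule: linorder_cases)
  case less
  have *: "((\<lambda>t. (- (x + t)) powr p) has_real_derivative p * \<bar>x\<bar> powr (p - 1) * sgn x) (at 0)"
    using less by (auto intro!: derivative_eq_intros simp: powr_diff)
  have "eventually (\<lambda>t. t < - x) (nhds 0)"
    using less eventually_nhds_in_open[of "{..< - x}" 0] by simp
  then have "eventually (\<lambda>t. (- (x + t)) powr p = \<bar>x + t\<bar> powr p) (nhds 0)"
    by eventually_elim simp
  then show ?thesis using * by (rule DERIV_cong_ev[OF refl _ refl, THEN iffD1])
next
  case equal
  have "((\<lambda>t. \<bar>t\<bar> powr (p - 1)) \<longlongrightarrow> 0) (at (0::real))"
    by (rule tendsto_eq_rhs[OF tendsto_zero_powrI[of _ _ "\<lambda>_. p - 1" "p - 1"]])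
       (use p in \<open>auto intro!: tendsto_eq_intros\<close>)
  then have "((\<lambda>t. sgn t * \<bar>t\<bar> powr (p - 1)) \<longlongrightarrow> 0) (at (0::real))"
    by (rule Lim_null_comparison[rotated]) (auto intro!: always_eventually simp: abs_mult sgn_if)
  moreover have "\<bar>t\<bar> powr p / t = sgn t * \<bar>t\<bar> powr (p - 1)" if "t \<noteq> 0" for t :: real
    using that by (auto simp: powr_diff sgn_if field_simps)
  ultimately have "((\<lambda>t. \<bar>t\<bar> powr p / t) \<longlongrightarrow> 0) (at (0::real))"
    by (subst filterlim_cong[OF refl refl, where g = "\<lambda>t. sgn t * \<bar>t\<bar> powr (p - 1)"])
       (auto simp: eventually_at_filter)
  then show ?thesis using equal by (simp add: DERIV_def)
next
  case greater
  have *: "((\<lambda>t. (x + t) powr p) has_real_derivative p * \<bar>x\<bar> powr (p - 1) * sgn x) (at 0)"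
    using greater by (auto intro!: derivative_eq_intros simp: powr_diff)
  have "eventually (\<lambda>t. - x < t) (nhds 0)" 
    using greater eventually_nhds_in_open[of "{- x<..}" 0] by simp
  then have "eventually (\<lambda>t. (x + t) powr p = \<bar>x + t\<bar> powr p) (nhds 0)"
    by eventually_elim simp
  then show ?thesis using * by (rule DERIV_cong_ev[OF refl _ refl, THEN iffD1])
qed

section \<open>The eigenvalue problem on a finite tree\<close>

lemma compact_box:
  fixes S :: "'a \<Rightarrow> real set"
  assumes "\<And>i. compact (S i)"
  shows "compact {f. \<forall>i. f i \<in> S i}"
proof -
  have "{f. \<forall>i. f i \<in> S i} = PiE UNIV S" by (auto simp: PiE_def Pi_def)
  then show ?thesis
    using assms compactin_PiE[of "\<lambda>i. euclidean" UNIV S]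
    by (simp add: euclidean_product_topology flip: compactin_euclidean_iff)
qed

lemma continuous_on_coordinate [continuous_intros]:
  "continuous_on S (\<lambda>f. f i :: real)"
  by (rule continuous_on_subset[OF continuous_on_product_coordinates]) simp

text \<open>
  A minimiser of the Rayleigh quotient exists by compactness, and may be taken nonnegative because
  \<open>\<bar>g\<bar>\<close> has no larger energy than \<open>g\<close>. The Euler-Lagrange equation is tested against the
  indicator of the subtree \<open>B i\<close>: shifting a function by a constant on \<open>B i\<close> changes its energy
  only in the edge above \<open>i\<close>, so the derivative at the minimiser is the summed form of the
  eigenvalue equation directly.
\<close>

lemma finite_eigenfunction:
  fixes \<nu> m :: "'v \<Rightarrow> real" and q :: "'v \<Rightarrow> 'v" and B :: "'v \<Rightarrow> 'v set"
  assumes A: "finite A" "A \<noteq> {}" and p: "1 < p"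
    and pos: "\<And>i. i \<in> A \<Longrightarrow> 0 < \<nu> i" "\<And>i. i \<in> A \<Longrightarrow> 0 < m i"
    and B: "\<And>i. i \<in> A \<Longrightarrow> B i \<subseteq> A" "\<And>i. i \<in> A \<Longrightarrow> i \<in> B i" "\<And>i. i \<in> A \<Longrightarrow> q i \<notin> B i"
      "\<And>i j. i \<in> A \<Longrightarrow> j \<in> A \<Longrightarrow> j \<noteq> i \<Longrightarrow> j \<in> B i \<longleftrightarrow> q j \<in> B i"
  obtains f l where "\<And>i. 0 \<le> f i" "\<And>i. i \<notin> A \<Longrightarrow> f i = 0" "0 \<le> l"
    "(\<Sum>k\<in>A. m k * f k powr p) = 1"
    "\<And>g. \<forall>i. i \<notin> A \<longrightarrow> g i = 0 \<Longrightarrow>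
       l * (\<Sum>k\<in>A. m k * \<bar>g k\<bar> powr p) \<le> (\<Sum>k\<in>A. \<nu> k * \<bar>g k - g (q k)\<bar> powr p)"
    "\<And>i. i \<in> A \<Longrightarrow> f (q i) \<le> f i"
    "\<And>i. i \<in> A \<Longrightarrow> \<nu> i * (f i - f (q i)) powr (p - 1) = l * (\<Sum>k\<in>B i. m k * f k powr (p - 1))"
proof -
  define D where "D f = (\<Sum>k\<in>A. \<nu> k * \<bar>f k - f (q k)\<bar> powr p)" for f :: "'v \<Rightarrow> real"
  define M where "M f = (\<Sum>k\<in>A. m k * \<bar>f k\<bar> powr p)" for f :: "'v \<Rightarrow> real"
  define S where "S i = (if i \<in> A then {0..(1 / m i) powr (1 / p)} else {0 :: real})" for i
  define K where "K = {f. \<forall>i. f i \<in> S i} \<inter> {f. M f = 1}"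
  have D0: "0 \<le> D f" for f
    unfolding D_def using pos(1) by (intro sum_nonneg) (auto simp: less_imp_le)
  have M0: "0 \<le> M f" for f
    unfolding M_def using pos(2) by (intro sum_nonneg) (auto simp: less_imp_le)
  have term_le: "m i * \<bar>h i\<bar> powr p \<le> M h" if "i \<in> A" for i h
    unfolding M_def using member_le_sum[of i A "\<lambda>k. m k * \<bar>h k\<bar> powr p"] that A pos(2)
    by (simp add: less_imp_le)
  have "compact {f. \<forall>i. f i \<in> S i}" by (rule compact_box) (simp add: S_def)
  moreover have "continuous_on UNIV M"
    unfolding M_def using p by (intro continuous_on_sum continuous_on_mult continuous_on_powr' continuous_intros) auto
  then have "closed {f. M f = 1}" by (intro closed_Collect_eq continuous_intros)
  ultimately have "compact K" unfolding K_def by (rule compact_Int_closed)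
  have cD: "continuous_on K D"
    unfolding D_def using p by (intro continuous_on_sum continuous_on_mult continuous_on_powr' continuous_intros) auto
  \<comment> \<open>Normalised functions vanishing off \<open>A\<close> lie in \<open>K\<close> after taking absolute values.\<close>
  have scale: "(\<lambda>i. \<bar>g i\<bar> / M g powr (1 / p)) \<in> K" if g: "\<forall>i. i \<notin> A \<longrightarrow> g i = 0" and Mg: "0 < M g" for g
  proof -
    let ?c = "M g powr (1 / p)"
    have c: "0 < ?c" "?c powr p = M g" using Mg p by (auto simp: powr_powr)
    have "M (\<lambda>i. \<bar>g i\<bar> / c) = M g / c powr p" if "0 < c" for c
      using that unfolding M_def sum_divide_distrib by (simp add: powr_divide)
    from this[OF c(1)] have "M (\<lambda>i. \<bar>g i\<bar> / ?c) = M g / M g" unfolding c(2) .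
    then have M1: "M (\<lambda>i. \<bar>g i\<bar> / ?c) = 1" using Mg by simp
    have "\<bar>g i\<bar> / ?c \<in> S i" for i
    proof (cases "i \<in> A")
      case True
      have "m i * (\<bar>g i\<bar> / ?c) powr p \<le> M (\<lambda>i. \<bar>g i\<bar> / ?c)"
        using term_le[OF True, of "\<lambda>i. \<bar>g i\<bar> / ?c"] c(1) by simp
      then have "(\<bar>g i\<bar> / ?c) powr p \<le> 1 / m i" using M1 pos(2)[OF True] by (simp add: field_simps)
      then have "((\<bar>g i\<bar> / ?c) powr p) powr (1 / p) \<le> (1 / m i) powr (1 / p)"
        using p by (intro powr_mono2) auto
      then show ?thesis using True p c by (simp add: S_def powr_powr)
    qed (simp add: S_def g)
    then show ?thesis using M1 by (simp add: K_def)
  qed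
  obtain a where a: "a \<in> A" using A by auto
  have "M (\<lambda>i. if i = a then 1 else 0) = m a"
    unfolding M_def using a A by (subst sum.remove[of _ a]) auto
  then have "K \<noteq> {}" using scale[of "\<lambda>i. if i = a then 1 else 0"] a pos(2) by fastforce
  then obtain f where f: "f \<in> K" "\<And>g. g \<in> K \<Longrightarrow> D f \<le> D g"
    using continuous_attains_inf[OF \<open>compact K\<close> _ cD] by blast
  have fS: "f i \<in> S i" for i using f by (simp add: K_def)
  have Mf: "M f = 1" using f by (simp add: K_def)
  have f_nonneg: "0 \<le> f i" for i using fS[of i] by (auto simp: S_def split: if_splits)
  have f0: "f i = 0" if "i \<notin> A" for i using fS[of i] that by (simp add: S_def)
  define l where "l = D f"
  have min: "l * M g \<le> D g" if g: "\<forall>i. i \<notin> A \<longrightarrow> g i = 0" for g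
  proof (cases "M g = 0")
    case False
    then have Mg: "0 < M g" using M0[of g] by simp
    let ?c = "M g powr (1 / p)"
    have c: "0 < ?c" "?c powr p = M g" using Mg p by (auto simp: powr_powr)
    have "l \<le> D (\<lambda>i. \<bar>g i\<bar> / ?c)" unfolding l_def by (rule f(2)[OF scale[OF g Mg]])
    also have "\<dots> \<le> (\<Sum>k\<in>A. \<nu> k * (\<bar>g k - g (q k)\<bar> / ?c) powr p)"
      unfolding D_def
    proof (intro sum_mono mult_left_mono powr_mono2)
      fix k
      show "\<bar>\<bar>g k\<bar> / ?c - \<bar>g (q k)\<bar> / ?c\<bar> \<le> \<bar>g k - g (q k)\<bar> / ?c"
        using c(1) by (simp add: abs_divide divide_right_mono flip: diff_divide_distrib)
    qed (use p pos(1) in \<open>auto simp: less_imp_le\<close>)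
    also have "\<dots> = D g / M g"
      unfolding D_def sum_divide_distrib using c less_imp_le[OF c(1)] by (simp add: powr_divide)
    finally show ?thesis using Mg by (simp add: field_simps)
  qed (simp add: D0)
  have EL: "\<nu> i * (\<bar>f i - f (q i)\<bar> powr (p - 1) * sgn (f i - f (q i)))
      = l * (\<Sum>k\<in>B i. m k * f k powr (p - 1))" if i: "i \<in> A" for i
  proof -
    define \<psi> where "\<psi> t = \<nu> i * \<bar>f i - f (q i) + t\<bar> powr p - l * (\<Sum>k\<in>B i. m k * \<bar>f k + t\<bar> powr p)" for t
    have fB: "finite (B i)" using A B(1)[OF i] finite_subset by blast
    have le: "\<psi> 0 \<le> \<psi> t" for t
    proof -
      define g where "g k = f k + (if k \<in> B i then t else 0)" for k
      have "D g = D f - \<nu> i * \<bar>f i - f (q i)\<bar> powr p + \<nu> i * \<bar>f i - f (q i) + t\<bar> powr p"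
      proof -
        have "g k - g (q k) = f k - f (q k)" if "k \<in> A - {i}" for k
          using B(4)[OF i, of k] that by (simp add: g_def)
        moreover have "g i - g (q i) = f i - f (q i) + t" using B(2,3)[OF i] by (simp add: g_def)
        ultimately show ?thesis
          unfolding D_def by (subst (1 2) sum.remove[OF A(1) i]) simp
      qed
      moreover have Mg: "M g = M f - (\<Sum>k\<in>B i. m k * \<bar>f k\<bar> powr p) + (\<Sum>k\<in>B i. m k * \<bar>f k + t\<bar> powr p)"
      proof -
        have s: "M h = (\<Sum>k\<in>B i. m k * \<bar>h k\<bar> powr p) + (\<Sum>k\<in>A - B i. m k * \<bar>h k\<bar> powr p)" for h
          unfolding M_def using sum.subset_diff[OF B(1)[OF i] A(1)] by (simp add: add.commute)
        show ?thesis unfolding s by (simp add: g_def)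
      qed
      moreover have "l * M g = l * M f - l * (\<Sum>k\<in>B i. m k * \<bar>f k\<bar> powr p) + l * (\<Sum>k\<in>B i. m k * \<bar>f k + t\<bar> powr p)"
        unfolding Mg by (simp only: distrib_left right_diff_distrib)
      moreover have "l * M g \<le> D g"
        using B(1)[OF i] f0 by (intro min) (auto simp: g_def)
      moreover have "l * M f = D f" by (simp add: Mf l_def)
      ultimately show ?thesis unfolding \<psi>_def add_0_right by linarith
    qed
    have "(\<psi> has_real_derivative \<nu> i * (p * \<bar>f i - f (q i)\<bar> powr (p - 1) * sgn (f i - f (q i)))
        - l * (\<Sum>k\<in>B i. m k * (p * \<bar>f k\<bar> powr (p - 1) * sgn (f k)))) (at 0)"
      unfolding \<psi>_def using p
      by (intro DERIV_diff DERIV_cmult DERIV_sum DERIV_abs_powr) auto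
    then have "\<nu> i * (p * \<bar>f i - f (q i)\<bar> powr (p - 1) * sgn (f i - f (q i)))
        - l * (\<Sum>k\<in>B i. m k * (p * \<bar>f k\<bar> powr (p - 1) * sgn (f k))) = 0"
      by (rule DERIV_local_min[of _ _ _ 1]) (auto simp: le)
    moreover have "m k * (p * \<bar>f k\<bar> powr (p - 1) * sgn (f k)) = p * (m k * f k powr (p - 1))" for k
      using f_nonneg[of k] by (cases "f k = 0") (auto simp: sgn_if)
    then have "(\<Sum>k\<in>B i. m k * (p * \<bar>f k\<bar> powr (p - 1) * sgn (f k))) = p * (\<Sum>k\<in>B i. m k * f k powr (p - 1))"
      by (simp only: sum_distrib_left)
    ultimately have "p * (\<nu> i * (\<bar>f i - f (q i)\<bar> powr (p - 1) * sgn (f i - f (q i))))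
        = p * (l * (\<Sum>k\<in>B i. m k * f k powr (p - 1)))"
      by (simp only: mult_ac)
    then show ?thesis using p by simp
  qed
  have l0: "0 \<le> l" by (simp add: l_def D0)
  have mono: "f (q i) \<le> f i" if i: "i \<in> A" for i
  proof (rule ccontr)
    assume "\<not> ?thesis"
    then have "\<nu> i * (\<bar>f i - f (q i)\<bar> powr (p - 1) * sgn (f i - f (q i))) < 0"
      using pos(1)[OF i] by (simp add: mult_pos_neg)
    moreover have "0 \<le> l * (\<Sum>k\<in>B i. m k * f k powr (p - 1))"
      using l0 B(1)[OF i] pos(2) by (intro mult_nonneg_nonneg sum_nonneg) (auto simp: less_imp_le subset_eq)
    ultimately show False using EL[OF i] by simp
  qed
  show ?thesis
  proof (rule that[of f l])
    show "(\<Sum>k\<in>A. m k * f k powr p) = 1" using Mf f_nonneg by (simp add: M_def)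
    show "\<nu> i * (f i - f (q i)) powr (p - 1) = l * (\<Sum>k\<in>B i. m k * f k powr (p - 1))" if "i \<in> A" for i
      using EL[OF that] mono[OF that] by (cases "f (q i) = f i") auto
  qed (use f_nonneg f0 l0 min mono in \<open>auto simp: D_def M_def\<close>)
qed

section \<open>Rooted trees\<close>

context rooted_tree
begin

abbreviation V :: "'v set" where "V \<equiv> pverts G - {r}"
abbreviation par :: "'v \<Rightarrow> 'v" where "par \<equiv> parent G r"
abbreviation lev :: "'v \<Rightarrow> nat" where "lev \<equiv> level G r"
abbreviation rpath :: "'v \<Rightarrow> 'v set" where "rpath \<equiv> path_verts G r"
abbreviation desc :: "'v \<Rightarrow> 'v set" where "desc \<equiv> subtree_verts G r"

text \<open>
  A walk from \<open>a\<close> to \<open>b\<close> that avoids their common neighbour \<open>u\<close> contains a path with this property, and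
  that path closes up through \<open>u\<close> to a cycle of length at least 3.
\<close>

lemma apath_cycle_free:
  assumes "(u, a) \<in> parcs G" "(u, b) \<in> parcs G" "a \<noteq> b"
    and p: "awalk a p b" and u: "u \<notin> set (pawalk_verts a p)"
  shows False
proof -
  define s where "s = awalk_to_apath p"
  have s: "apath a s b"
    unfolding s_def by (rule apath_awalk_to_apath[OF p])
  then have ws: "awalk a s b" by (rule awalkI_apath)
  have "set s \<subseteq> set p"
    unfolding s_def by (rule awalk_to_apath_subset[OF p])
  then have us: "u \<notin> set (pawalk_verts a s)"
    using u set_awalk_verts[OF p] set_awalk_verts[OF ws] by auto
  have "s \<noteq> []" using s \<open>a \<noteq> b\<close> by (auto simp: apath_Nil_iff)
  have bu: "(b, u) \<in> parcs G" using assms(2) by (rule arcs_symmetric)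
  have w1: "awalk a (s @ [(b, u)]) u"
    using ws bu by (auto simp: awalk_simps in_arcsD1 in_arcsD2)
  have "awalk u ((u, a) # s @ [(b, u)]) u"
    using w1 assms(1) by (simp add: awalk_Cons_iff del: awalk_append_iff)
  moreover have "pawalk_verts a (s @ [(b, u)]) = pawalk_verts a s @ [u]"
    using awalk_verts_append[OF w1] by simp
  ultimately have "cycle ((u, a) # s @ [(b, u)])"
    unfolding cycle_def using s us by (intro exI[of _ u]) (auto simp: apath_def)
  then show False using no_cycles[of "(u, a) # s @ [(b, u)]"] \<open>s \<noteq> []\<close>
    by (cases s) auto
qed

text \<open>
  If two paths from \<open>u\<close> to \<open>v\<close> start with different neighbours of \<open>u\<close>, then following the first to \<open>v\<close> and
  the second backwards connects these neighbours without passing through \<open>u\<close>.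
\<close>

lemma apath_unique:
  assumes "apath u p v" "apath u q v"
  shows "p = q"
  using assms
proof (induction p arbitrary: u q)
  case Nil
  then show ?case using apath_nonempty_ends[of u q v] by (auto simp: apath_Nil_iff)
next
  case (Cons e p)
  obtain a where e: "e = (u, a)" and a: "(u, a) \<in> parcs G" "apath a p v" "u \<notin> set (pawalk_verts a p)"
    using Cons.prems(1) by (cases e) (auto simp: apath_Cons_iff)
  obtain f q' where q: "q = f # q'"
    using Cons.prems apath_nonempty_ends[of u "e # p" v] by (cases q) (auto simp: apath_Nil_iff)
  obtain b where f: "f = (u, b)" and b: "(u, b) \<in> parcs G" "apath b q' v" "u \<notin> set (pawalk_verts b q')"
    using Cons.prems(2) unfolding q by (cases f) (auto simp: apath_Cons_iff)
  have "a = b"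
  proof (rule ccontr)
    assume "a \<noteq> b"
    have pa: "awalk a p v" and qb: "awalk b q' v" using a b by (auto intro: awalkI_apath)
    then have rq: "awalk v (rev_path q') b" by simp
    have w: "awalk a (p @ rev_path q') b" by (rule awalk_appendI[OF pa rq])
    have "set (pawalk_verts a (p @ rev_path q')) = set (pawalk_verts a p) \<union> set (pawalk_verts v (rev_path q'))"
      by (rule set_awalk_verts_append[OF pa rq])
    also have "pawalk_verts v (rev_path q') = rev (pawalk_verts b q')"
      by (rule awalk_verts_rev_path[OF qb])
    finally show False
      using apath_cycle_free[OF a(1) b(1) \<open>a \<noteq> b\<close> w] a(3) b(3) by auto
  qed
  then show ?case using Cons.IH[OF a(2)] b q e f by simp
qed

lemma ex1_apath_root:
  assumes "i \<in> pverts G"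
  shows "\<exists>!c. apath i c r"
proof -
  have "symmetric (with_proj G)" by (rule sym_arcs)
  then have "strongly_connected (with_proj G)"
    using connected by (rule symmetric_connected_imp_strongly_connected)
  then have "i \<rightarrow>\<^sup>*\<^bsub>with_proj G\<^esub> r"
    using assms root_in_verts unfolding strongly_connected_def with_proj_simps by blast
  then obtain c where "apath i c r" using reachable_apath by blast
  then show ?thesis using apath_unique by blast
qed

lemma apath_path_to_root: "i \<in> pverts G \<Longrightarrow> apath i (path_to_root G r i) r"
  unfolding path_to_root_def by (rule theI'[OF ex1_apath_root])

lemma path_to_root_eq: "apath i c r \<Longrightarrow> path_to_root G r i = c"
  using apath_unique apath_path_to_root awalkI_apath awalk_hd_in_verts by metis

lemma path_to_root_root: "path_to_root G r r = []"
  by (rule path_to_root_eq) (simp add: apath_Nil_iff root_in_verts)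

text \<open>
  A neighbour \<open>k\<close> of \<open>i\<close> at the next lower level cannot have \<open>i\<close> on its own path to the root, because the
  rest of that path would be the path of \<open>i\<close>, which is longer. So the path of \<open>i\<close> passes through \<open>k\<close>, which
  determines \<open>k\<close>.
\<close>

lemma path_to_root_step:
  assumes i: "i \<in> V"
  shows "(i, par i) \<in> parcs G \<and> path_to_root G r i = (i, par i) # path_to_root G r (par i)
    \<and> i \<notin> set (pawalk_verts (par i) (path_to_root G r (par i)))
    \<and> (\<forall>j. (i, j) \<in> parcs G \<longrightarrow> lev j + 1 = lev i \<longrightarrow> j = par i)"
proof -
  have c: "apath i (path_to_root G r i) r" using i by (simp add: apath_path_to_root)
  then have "path_to_root G r i \<noteq> []" using i by (auto simp: apath_Nil_iff)
  then obtain j d where d: "path_to_root G r i = (i, j) # d" "(i, j) \<in> parcs G" "apath j d r"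
      "i \<notin> set (pawalk_verts j d)"
    using c by (cases "path_to_root G r i") (auto simp: apath_Cons_iff)
  have dj: "path_to_root G r j = d" using d by (simp add: path_to_root_eq)
  have lev: "lev j + 1 = lev i" using d dj by (simp add: level_def)
  have uniq: "k = j" if k: "(i, k) \<in> parcs G" "lev k + 1 = lev i" for k
  proof -
    have ck: "apath k (path_to_root G r k) r"
      using k in_arcsD2 by (auto simp: apath_path_to_root)
    have "i \<notin> set (pawalk_verts k (path_to_root G r k))"
    proof
      assume "i \<in> set (pawalk_verts k (path_to_root G r k))"
      then obtain q t where qt: "path_to_root G r k = q @ t" "awalk k q i"
        using awalk_decomp[OF awalkI_apath[OF ck]] by blast
      then have "apath i t r" using ck awlast_of_awalk[of k q i] by (simp add: apath_append_iff)
      then have "path_to_root G r i = t" by (rule path_to_root_eq)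
      then show False using k qt by (simp add: level_def)
    qed
    then have "apath i ((i, k) # path_to_root G r k) r"
      using k ck by (simp add: apath_Cons_iff)
    then have "path_to_root G r i = (i, k) # path_to_root G r k" by (rule path_to_root_eq)
    then show ?thesis using d by simp
  qed
  have "par i = j"
    unfolding parent_def by (rule the_equality) (use lev d(2) uniq in blast)+
  moreover have "\<forall>k. (i, k) \<in> parcs G \<longrightarrow> lev k + 1 = lev i \<longrightarrow> k = j" using uniq by blast
  ultimately show ?thesis using d dj by simp
qed

lemma parent_arc: "i \<in> V \<Longrightarrow> (i, par i) \<in> parcs G"
  and parentI: "i \<in> V \<Longrightarrow> (i, j) \<in> parcs G \<Longrightarrow> lev j + 1 = lev i \<Longrightarrow> j = par i"
  using path_to_root_step by auto

lemma parent_in: "i \<in> V \<Longrightarrow> par i \<in> pverts G"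
  using parent_arc in_arcsD2 by blast

lemma level_root [simp]: "lev r = 0"
  by (simp add: level_def path_to_root_root)

lemma level_parent: "i \<in> V \<Longrightarrow> lev i = Suc (lev (par i))"
  using path_to_root_step[of i] by (simp add: level_def)

lemma level_eq_0: "i \<in> pverts G \<Longrightarrow> lev i = 0 \<longleftrightarrow> i = r"
  using level_parent[of i] by (cases "i = r") auto

lemma level_ge_1: "i \<in> V \<Longrightarrow> 1 \<le> lev i"
  using level_parent[of i] by auto

lemma tree_induct [consumes 1, case_names root parent]:
  assumes "i \<in> pverts G" "P r" "\<And>i. i \<in> V \<Longrightarrow> P (par i) \<Longrightarrow> P i"
  shows "P i"
  using assms(1)
proof (induction "lev i" arbitrary: i)
  case 0
  then show ?case using level_eq_0[of i] assms(2) by simp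
next
  case (Suc n)
  then have i: "i \<in> V" using level_root by fastforce
  then show ?case using Suc level_parent[of i] parent_in[of i] assms(3) by simp
qed

lemma children_eq: "i \<in> pverts G \<Longrightarrow> children G r i = {j \<in> V. par j = i}"
proof (intro set_eqI iffI)
  fix j assume "i \<in> pverts G" and j: "j \<in> children G r i"
  then have a: "(i, j) \<in> parcs G" "lev j = lev i + 1" by (auto simp: children_def)
  then have "j \<in> V" using in_arcsD2 by auto
  then show "j \<in> {j \<in> V. par j = i}" using parentI[of j i] a arcs_symmetric by auto
next
  fix j assume "j \<in> {j \<in> V. par j = i}"
  then show "j \<in> children G r i"
    using parent_arc[of j] level_parent[of j] arcs_symmetric by (auto simp: children_def)
qed

lemma children_subset: "children G r i \<subseteq> V"
  using in_arcsD2 by (auto simp: children_def)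

lemma finite_children: "i \<in> pverts G \<Longrightarrow> finite (children G r i)"
  using locally_finite[of i] by (rule rev_finite_subset) (auto simp: children_def)

lemma finite_level_le: "finite {i \<in> pverts G. lev i \<le> n}"
proof (induction n)
  case 0
  have "{i \<in> pverts G. lev i \<le> 0} \<subseteq> {r}" using level_eq_0 by auto
  then show ?case by (rule finite_subset) simp
next
  case (Suc n)
  have "{i \<in> pverts G. lev i \<le> Suc n} \<subseteq> {r} \<union> (\<Union>i\<in>{i \<in> pverts G. lev i \<le> n}. children G r i)"
    using level_parent parent_in by (fastforce simp: children_eq)
  then show ?case
    by (rule finite_subset) (use Suc finite_children in auto)
qed

subsection \<open>Paths and subtrees\<close>

lemma path_root: "rpath r = {}"
  by (simp add: path_verts_def path_to_root_root)

lemma path_step: "i \<in> V \<Longrightarrow> rpath i = insert i (rpath (par i))"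
  using path_to_root_step[of i] by (auto simp: path_verts_def)

lemma notin_path_parent: "i \<in> V \<Longrightarrow> i \<notin> rpath (par i)"
  using path_to_root_step[of i] by (auto simp: path_verts_def)

lemma self_in_path: "i \<in> V \<Longrightarrow> i \<in> rpath i"
  by (simp add: path_step)

lemma finite_path: "finite (rpath i)"
  by (simp add: path_verts_def)

lemma path_subset: "i \<in> pverts G \<Longrightarrow> rpath i \<subseteq> V"
  by (induction rule: tree_induct) (auto simp: path_root path_step)

lemma level_in_path: "i \<in> pverts G \<Longrightarrow> k \<in> rpath i \<Longrightarrow> lev k \<le> lev i"
  by (induction rule: tree_induct) (auto simp: path_root path_step level_parent)

lemma path_telescope:
  fixes f :: "'v \<Rightarrow> real"
  shows "i \<in> pverts G \<Longrightarrow> (\<Sum>k\<in>rpath i. f k - f (par k)) = f i - f r"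
  by (induction rule: tree_induct) (simp_all add: path_root path_step notin_path_parent finite_path)

lemma sub_eq: 
  assumes i: "i \<in> V"
  shows "desc i = {j \<in> V. i \<in> rpath j}"
proof (intro set_eqI iffI)
  fix j assume "j \<in> desc i"
  then have "(i, j) \<in> {(a, b). b \<in> children G r a}\<^sup>*" by (simp add: subtree_verts_def)
  then show "j \<in> {j \<in> V. i \<in> rpath j}"
  proof (induction rule: rtrancl_induct)
    case base
    then show ?case using i by (simp add: self_in_path)
  next
    case (step a b)
    then have "b \<in> V" "par b = a" by (auto simp: children_eq)
    then show ?case using step by (auto simp: path_step)
  qed
next
  fix j assume j: "j \<in> {j \<in> V. i \<in> rpath j}"
  then have "j \<in> pverts G" "i \<in> rpath j" by auto
  then show "j \<in> desc i"
  proof (induction rule: tree_induct)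
    case root
    then show ?case by (simp add: path_root)
  next
    case (parent k)
    show ?case
    proof (cases "i = k")
      case True
      then show ?thesis by (simp add: subtree_verts_def)
    next
      case False
      then have "(i, par k) \<in> {(a, b). b \<in> children G r a}\<^sup>*"
        using parent by (auto simp: path_step subtree_verts_def)
      moreover have "k \<in> children G r (par k)"
        using parent(1) parent_in by (auto simp: children_eq)
      ultimately have "(i, k) \<in> {(a, b). b \<in> children G r a}\<^sup>*"
        using rtrancl_into_rtrancl[of i "par k" _ k] by simp
      then show ?thesis by (simp add: subtree_verts_def)
    qed
  qed
qed

lemma sub_step:
  assumes i: "i \<in> V"
  shows "desc i = insert i (\<Union>j\<in>children G r i. desc j)"
proof -
  have ig: "i \<in> pverts G" using i by simp
  have "i \<in> rpath j \<longleftrightarrow> j = i \<or> (\<exists>k\<in>children G r i. k \<in> rpath j)" if "j \<in> V" for j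
  proof -
    have "j \<in> pverts G" using that by simp
    then show ?thesis
    proof (induction rule: tree_induct)
      case root
      then show ?case using i by (auto simp: path_root)
    next
      case (parent j)
      then show ?case using ig by (auto simp: path_step children_eq)
    qed
  qed
  then show ?thesis
    using i ig by (auto simp: sub_eq children_eq)
qed

text \<open>
  Siblings have disjoint subtrees: a path to the root meets each level only once.
\<close>

lemma path_children_unique:
  assumes "j \<in> pverts G" "k \<in> rpath j" "l \<in> rpath j" "k \<in> V" "l \<in> V" "par k = par l"
  shows "k = l"
proof -
  have "k = l" if "lev k = lev l" 
    using assms(1-3) that
  proof (induction rule: tree_induct)
    case root
    then show ?case by (simp add: path_root)
  next
    case (parent i)
    then have "k = i \<or> k \<in> rpath (par i)" "l = i \<or> l \<in> rpath (par i)"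
      by (auto simp: path_step)
    moreover have "lev m < lev i" if "m \<in> rpath (par i)" for m
      using level_in_path[OF parent_in[OF parent(1)] that] level_parent[OF parent(1)] by simp
    ultimately show ?case using parent by (metis less_irrefl)
  qed
  then show ?thesis using level_parent assms by simp
qed

end

section \<open>Weighted trees\<close>

locale weighted_tree = rooted_tree G r
  for G :: "'v pair_pre_digraph" and r :: 'v +
  fixes p :: real and \<nu> \<mu> :: "'v \<Rightarrow> real"
  assumes one_child: "card (children G r r) = 1"
    and nu_pos: "i \<in> pverts G \<Longrightarrow> 0 < \<nu> i"
    and mu_pos: "i \<in> pverts G \<Longrightarrow> 0 < \<mu> i"
    and mu_summable: "\<mu> summable_on pverts G"
    and p_gt_1: "1 < p"
begin

abbreviation SS :: "('v \<Rightarrow> real) \<Rightarrow> 'v \<Rightarrow> ennreal" where "SS \<equiv> subtree_sum G r p \<mu>"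
abbreviation PS :: "('v \<Rightarrow> real) \<Rightarrow> 'v \<Rightarrow> ennreal" where "PS \<equiv> II_sum G r p \<nu> \<mu>"
abbreviation lam :: ennreal where "lam \<equiv> lambda_p G r p \<nu> \<mu>"

text \<open>
  The child of the root: the path from any other vertex to the root ends with the edge above it.
\<close>

definition stem :: 'v where "stem = the_elem (children G r r)"

lemma children_root: "children G r r = {stem}"
proof -
  obtain c where "children G r r = {c}" using one_child by (rule card_1_singletonE)
  then show ?thesis by (simp add: stem_def)
qed

lemma stem_in: "stem \<in> V" and parent_stem: "par stem = r"
  using children_root children_eq[OF root_in_verts] by auto

lemma parent_eq_root: "i \<in> V \<Longrightarrow> par i = r \<longleftrightarrow> i = stem"
  using children_root children_eq[OF root_in_verts] by auto

lemma stem_in_path: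
  assumes "i \<in> V"
  shows "stem \<in> rpath i"
proof -
  have "i \<in> pverts G" using assms by simp
  then have "i \<noteq> r \<longrightarrow> stem \<in> rpath i"
  proof (induction rule: tree_induct)
    case (parent i)
    then show ?case using parent_eq_root[of i] by (auto simp: path_step)
  qed simp
  then show ?thesis using assms by simp
qed

lemma sub_stem: "desc stem = V"
  using stem_in_path by (auto simp: sub_eq[OF stem_in])

lemma level_stem: "lev stem = 1"
  using level_parent[OF stem_in] parent_stem by simp

lemma sub_subset: "i \<in> V \<Longrightarrow> desc i \<subseteq> V" and self_in_sub: "i \<in> V \<Longrightarrow> i \<in> desc i"
  by (auto simp: sub_eq self_in_path)

lemma finite_V_level: "finite {i \<in> V. lev i \<le> n}"
  using finite_level_le by (rule finite_subset[rotated]) auto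

lemma disjoint_children_subs:
  assumes "i \<in> pverts G"
  shows "disjoint_family_on desc (children G r i)"
  using assms path_children_unique
  by (force simp: disjoint_family_on_def children_eq sub_eq)

text \<open>
  Summation by parts: if \<open>b\<close> consists of the increments of a function that vanishes at the root, the
  inner sum on the left is its value at \<open>j\<close>.
\<close>

lemma path_sub_swap:
  fixes a b :: "'v \<Rightarrow> ennreal"
  shows "(\<Sum>\<^sub>\<infinity>j\<in>V. a j * (\<Sum>k\<in>rpath j. b k)) = (\<Sum>\<^sub>\<infinity>k\<in>V. b k * (\<Sum>\<^sub>\<infinity>j\<in>desc k. a j))"
proof -
  have "(\<Sum>\<^sub>\<infinity>j\<in>V. a j * (\<Sum>k\<in>rpath j. b k)) = (\<Sum>\<^sub>\<infinity>j\<in>V. \<Sum>\<^sub>\<infinity>k\<in>V. if k \<in> rpath j then b k * a j else 0)"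
  proof (rule infsum_cong)
    fix j assume j: "j \<in> V"
    have "a j * (\<Sum>k\<in>rpath j. b k) = (\<Sum>\<^sub>\<infinity>k\<in>rpath j. b k * a j)"
      by (simp add: finite_path sum_distrib_left mult.commute)
    also have "\<dots> = (\<Sum>\<^sub>\<infinity>k\<in>V. if k \<in> rpath j then b k * a j else 0)"
      using path_subset[of j] j by (intro infsum_cong_neutral) auto
    finally show "a j * (\<Sum>k\<in>rpath j. b k) = (\<Sum>\<^sub>\<infinity>k\<in>V. if k \<in> rpath j then b k * a j else 0)" .
  qed
  also have "\<dots> = (\<Sum>\<^sub>\<infinity>k\<in>V. \<Sum>\<^sub>\<infinity>j\<in>V. if k \<in> rpath j then b k * a j else 0)"
    by (rule infsum_swap_ennreal)
  also have "\<dots> = (\<Sum>\<^sub>\<infinity>k\<in>V. b k * (\<Sum>\<^sub>\<infinity>j\<in>desc k. a j))"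
  proof (rule infsum_cong)
    fix k assume k: "k \<in> V"
    have "(\<Sum>\<^sub>\<infinity>j\<in>V. if k \<in> rpath j then b k * a j else 0) = (\<Sum>\<^sub>\<infinity>j\<in>desc k. b k * a j)"
      by (intro infsum_cong_neutral) (auto simp: sub_eq[OF k])
    then show "(\<Sum>\<^sub>\<infinity>j\<in>V. if k \<in> rpath j then b k * a j else 0) = b k * (\<Sum>\<^sub>\<infinity>j\<in>desc k. a j)"
      by (simp add: infsum_cmult_ennreal)
  qed
  finally show ?thesis .
qed

subsection \<open>Subtree sums\<close>

lemma SS_pos:
  assumes "i \<in> V" "j \<in> desc i" "0 < f j"
  shows "0 < SS f i"
proof -
  have "0 < \<mu> j" using assms sub_subset mu_pos by auto
  then have "0 < ennreal (\<mu> j * f j powr (p - 1))" using assms by simp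
  also have "\<dots> \<le> SS f i"
    unfolding subtree_sum_def using sum_le_infsum_ennreal[of "{j}" "desc i"] assms by simp
  finally show ?thesis .
qed

lemma SS_pos_self: "i \<in> V \<Longrightarrow> 0 < f i \<Longrightarrow> 0 < SS f i"
  using SS_pos self_in_sub by blast

lemma SS_le_stem: "i \<in> V \<Longrightarrow> SS f i \<le> SS f stem"
  unfolding subtree_sum_def sub_stem by (intro infsum_subset_ennreal sub_subset)

lemma SS_step:
  assumes i: "i \<in> V"
  shows "SS f i = ennreal (\<mu> i * f i powr (p - 1)) + (\<Sum>j\<in>children G r i. SS f j)"
proof -
  have ig: "i \<in> pverts G" using i by simp
  have "i \<notin> desc j" if "j \<in> children G r i" for j
    using that i ig notin_path_parent[of j] by (auto simp: children_eq sub_eq)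
  then have "{i} \<inter> (\<Union>j\<in>children G r i. desc j) = {}" by auto
  moreover have "desc i = {i} \<union> (\<Union>j\<in>children G r i. desc j)" using sub_step[OF i] by simp
  ultimately show ?thesis
    unfolding subtree_sum_def
    by (simp add: infsum_Un_disjoint infsum_UN_disjoint_ennreal finite_children[OF ig]
        disjoint_children_subs[OF ig] del: Un_insert_left)
qed

lemma SS_cong: "i \<in> V \<Longrightarrow> (\<And>j. j \<in> V \<Longrightarrow> f j = g j) \<Longrightarrow> SS f i = SS g i"
  unfolding subtree_sum_def by (intro infsum_cong) (use sub_subset[of i] in \<open>auto simp: subset_eq\<close>)

lemma mu_sub_summable: "i \<in> V \<Longrightarrow> \<mu> summable_on desc i"
  by (rule summable_on_subset_banach[OF mu_summable]) (use sub_subset in auto)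

lemma SS_finite:
  assumes "\<And>j. j \<in> V \<Longrightarrow> 0 \<le> f j" "\<And>j. j \<in> V \<Longrightarrow> f j \<le> C"
  shows "SS f stem < \<infinity>"
proof -
  have "SS f stem \<le> (\<Sum>\<^sub>\<infinity>j\<in>desc stem. ennreal (C powr (p - 1)) * ennreal (\<mu> j))"
    unfolding subtree_sum_def
  proof (rule infsum_mono_ennreal)
    fix j assume "j \<in> desc stem"
    then have j: "j \<in> V" by (simp add: sub_stem)
    have "f j powr (p - 1) \<le> C powr (p - 1)" using assms[OF j] p_gt_1 by (intro powr_mono2) auto
    then have "\<mu> j * f j powr (p - 1) \<le> C powr (p - 1) * \<mu> j"
      using mu_pos[of j] j by (simp add: mult.commute)
    then show "ennreal (\<mu> j * f j powr (p - 1)) \<le> ennreal (C powr (p - 1)) * ennreal (\<mu> j)"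
      using mu_pos[of j] j by (simp add: ennreal_leI flip: ennreal_mult)
  qed
  also have "\<dots> = ennreal (C powr (p - 1)) * ennreal (\<Sum>\<^sub>\<infinity>j\<in>desc stem. \<mu> j)"
    unfolding infsum_cmult_ennreal using mu_sub_summable[OF stem_in] mu_pos
    by (subst infsum_ennreal_of_real) (auto simp: sub_stem less_imp_le)
  also have "\<dots> < \<infinity>" by (simp add: ennreal_mult_less_top)
  finally show ?thesis .
qed

subsection \<open>The test function with prescribed flow\<close>

text \<open>
  Real-valued versions of \<open>subtree_sum\<close> and \<open>II_sum\<close>, for functions whose subtree sums are finite. By
  monotonicity it suffices that the sum over the whole tree is.
\<close>

definition ss :: "('v \<Rightarrow> real) \<Rightarrow> 'v \<Rightarrow> real" where "ss f i = enn2real (SS f i)"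

definition pot :: "('v \<Rightarrow> real) \<Rightarrow> 'v \<Rightarrow> real" where "pot f i = enn2real (PS f i)"

lemma SS_ss: "SS f stem < \<infinity> \<Longrightarrow> i \<in> V \<Longrightarrow> SS f i = ennreal (ss f i)"
  using order_le_less_trans[OF SS_le_stem[of i f], of \<infinity>] by (simp add: ss_def)

lemma ss_nonneg: "0 \<le> ss f i"
  by (simp add: ss_def)

lemma PS_root: "PS f r = 0"
  by (simp add: II_sum_def path_root)

lemma PS_step:
  "i \<in> V \<Longrightarrow> PS f i = ennreal (\<nu> i powr (1 - conj_exp p)) * ennpowr (SS f i) (conj_exp p - 1) + PS f (par i)"
  by (simp add: II_sum_def path_step notin_path_parent finite_path)

lemma pot_root: "pot f r = 0"
  by (simp add: pot_def PS_root)

lemma PS_finite_imp: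
  assumes "i \<in> V" "PS f i < \<infinity>"
  shows "SS f stem < \<infinity>"
proof (rule ccontr)
  assume "\<not> ?thesis"
  then have "SS f stem = \<infinity>" by (simp add: less_top[symmetric])
  then have "ennreal (\<nu> stem powr (1 - conj_exp p)) * ennpowr (SS f stem) (conj_exp p - 1) = \<infinity>"
    using nu_pos[of stem] stem_in by (simp add: ennpowr_def ennreal_mult_eq_top_iff)
  moreover have "ennreal (\<nu> stem powr (1 - conj_exp p)) * ennpowr (SS f stem) (conj_exp p - 1) \<le> PS f i"
    unfolding II_sum_def
    by (rule member_le_sum[OF stem_in_path[OF assms(1)], of "\<lambda>k. ennreal (\<nu> k powr (1 - conj_exp p)) * ennpowr (SS f k) (conj_exp p - 1)"])
       (auto simp: finite_path)
  ultimately show False using assms(2) by (simp add: top_unique)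
qed

text \<open>
  The potential \<open>pot f\<close> is the function vanishing at the root whose flow \<open>\<nu> i * (pot f i - pot f (par i)) powr (p - 1)\<close>
  through the edge above \<open>i\<close> is the subtree sum of \<open>f\<close>; equivalently, it solves the Poisson equation
  with right hand side \<open>\<mu> * f powr (p - 1)\<close>.
\<close>

context
  fixes f :: "'v \<Rightarrow> real"
  assumes fin: "SS f stem < \<infinity>"
begin

lemma PS_increment:
  assumes i: "i \<in> V"
  shows "ennreal (\<nu> i powr (1 - conj_exp p)) * ennpowr (SS f i) (conj_exp p - 1) = ennreal ((ss f i / \<nu> i) powr (1 / (p - 1)))"
  using nu_pos[of i] i
  by (simp add: SS_ss[OF fin i] ennpowr_ennreal ss_nonneg conj_exp_minus_1[OF p_gt_1] powr_minus
      powr_divide field_simps flip: ennreal_mult)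

lemma PS_pot: "i \<in> pverts G \<Longrightarrow> PS f i = ennreal (pot f i)"
  and pot_nonneg: "0 \<le> pot f i"
proof -
  assume "i \<in> pverts G"
  then have "PS f i < \<infinity>"
    by (induction rule: tree_induct) (simp_all add: PS_root PS_step PS_increment)
  then show "PS f i = ennreal (pot f i)" by (simp add: pot_def less_top[symmetric])
qed (simp add: pot_def)

lemma pot_diff: 
  assumes i: "i \<in> V"
  shows "pot f i - pot f (par i) = (ss f i / \<nu> i) powr (1 / (p - 1))"
proof -
  have "ennreal (pot f i) = ennreal ((ss f i / \<nu> i) powr (1 / (p - 1)) + pot f (par i))"
    using PS_step[OF i, of f] PS_increment[OF i] PS_pot[of i] PS_pot[OF parent_in[OF i]] i
    by (simp add: pot_nonneg)
  then have "pot f i = (ss f i / \<nu> i) powr (1 / (p - 1)) + pot f (par i)"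
    using pot_nonneg by (subst (asm) ennreal_inj) (simp_all add: add_nonneg_nonneg)
  then show ?thesis by simp
qed

lemma pot_mono: "i \<in> V \<Longrightarrow> pot f (par i) \<le> pot f i"
  using pot_diff[of i] by (metis powr_ge_zero diff_ge_0_iff_ge)

lemma pot_flow:
  assumes i: "i \<in> V"
  shows "\<nu> i * (pot f i - pot f (par i)) powr (p - 1) = ss f i"
proof -
  have "0 < \<nu> i" using nu_pos i by simp
  then show ?thesis
    unfolding pot_diff[OF i] using p_gt_1 ss_nonneg[of f i]
    by (subst powr_inverse_exponent) auto
qed

lemma pot_strict:
  assumes "i \<in> V" "0 < SS f i"
  shows "pot f (par i) < pot f i"
proof -
  have "0 < (ss f i / \<nu> i) powr (1 / (p - 1))"
    using SS_ss[OF fin assms(1)] nu_pos[of i] assms by simp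
  then show ?thesis using pot_diff[OF assms(1)] by linarith
qed

lemma pot_pos:
  assumes "0 < SS f stem" "i \<in> V"
  shows "0 < pot f i"
proof -
  have "i \<in> pverts G" using assms by simp
  then have "i \<noteq> r \<longrightarrow> 0 < pot f i"
  proof (induction rule: tree_induct)
    case (parent i)
    show ?case
    proof (cases "i = stem")
      case True
      then show ?thesis using pot_strict[OF stem_in assms(1)] parent_stem pot_root by simp
    next
      case False
      then show ?thesis using parent parent_eq_root[of i] pot_mono[of i] by force
    qed
  qed simp
  then show ?thesis using assms by simp
qed

end

lemma ss_step:
  assumes fin: "SS f stem < \<infinity>" and i: "i \<in> V"
  shows "ss f i = \<mu> i * f i powr (p - 1) + (\<Sum>j\<in>children G r i. ss f j)"
proof -
  have mu: "0 < \<mu> i" using mu_pos i by simp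
  have "(\<Sum>j\<in>children G r i. SS f j) = (\<Sum>j\<in>children G r i. ennreal (ss f j))"
    using children_subset by (intro sum.cong refl SS_ss[OF fin]) blast
  also have "\<dots> = ennreal (\<Sum>j\<in>children G r i. ss f j)" by (simp add: ss_nonneg)
  finally have "ennreal (ss f i) = ennreal (\<mu> i * f i powr (p - 1) + (\<Sum>j\<in>children G r i. ss f j))"
    using SS_step[OF i, of f] SS_ss[OF fin i] mu ss_nonneg by (simp add: sum_nonneg)
  then show ?thesis
    using mu ss_nonneg by (subst (asm) ennreal_inj) (auto intro!: add_nonneg_nonneg sum_nonneg)
qed

lemma inverse_I: 
  "SS f i \<noteq> 0 \<Longrightarrow> inverse (I_op G r p \<nu> \<mu> f i) = ennreal (\<nu> i * (f i - f (par i)) powr (p - 1)) / SS f i"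
  unfolding I_op_def by (rule inverse_inverse_mult_ennreal)

lemma inverse_II_pot:
  assumes "SS f stem < \<infinity>" "0 < SS f stem" "i \<in> V" "0 \<le> f i"
  shows "inverse (II_op G r p \<nu> \<mu> f i) = ennreal ((f i / pot f i) powr (p - 1))"
proof -
  have g: "0 < pot f i" by (rule pot_pos[OF assms(1,2,3)])
  then have "ennpowr (PS f i) (p - 1) = ennreal (pot f i powr (p - 1))"
    using PS_pot[OF assms(1), of i] assms(3) by (simp add: ennpowr_ennreal)
  then show ?thesis
    unfolding II_op_def using g assms(4)
    by (subst inverse_inverse_mult_ennreal) (simp_all add: powr_divide divide_ennreal)
qed

subsection \<open>The Rayleigh quotient\<close>

lemma mu_p_V: "f r = 0 \<Longrightarrow> mu_p G p \<mu> f = (\<Sum>\<^sub>\<infinity>k\<in>V. ennreal (\<mu> k * \<bar>f k\<bar> powr p))"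
  unfolding mu_p_def by (intro infsum_cong_neutral) auto

text \<open>
  Both functionals are homogeneous of degree \<open>p\<close>, which removes the normalisation in \<open>lambda_p\<close>.
\<close>

lemma lambda_mult_le:
  assumes "f r = 0" "mu_p G p \<mu> f < \<infinity>"
  shows "lam * mu_p G p \<mu> f \<le> D_p G r p \<nu> f"
proof (cases "mu_p G p \<mu> f = 0")
  case False
  define M where "M = enn2real (mu_p G p \<mu> f)"
  have M: "mu_p G p \<mu> f = ennreal M" "0 < M"
    using assms(2) False by (auto simp: M_def enn2real_positive_iff less_top zero_less_iff_neq_zero)
  define g where "g i = f i / M powr (1 / p)" for i
  have c: "(M powr (1 / p)) powr p = M" using M p_gt_1 by (simp add: powr_powr)
  have scale: "\<bar>x / M powr (1 / p)\<bar> powr p = \<bar>x\<bar> powr p / M" for x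
    using c M by (simp add: abs_divide powr_divide)
  have "mu_p G p \<mu> g = (\<Sum>\<^sub>\<infinity>k\<in>pverts G. ennreal (1 / M) * ennreal (\<mu> k * \<bar>f k\<bar> powr p))"
    unfolding mu_p_def g_def scale using M mu_pos
    by (intro infsum_cong) (simp flip: ennreal_mult' add: less_imp_le)
  also have "\<dots> = ennreal (1 / M) * ennreal M"
    unfolding infsum_cmult_ennreal M(1)[symmetric] mu_p_def ..
  also have "\<dots> = 1" using M by (simp flip: ennreal_mult)
  finally have "lam \<le> D_p G r p \<nu> g"
    unfolding lambda_p_def using assms(1) by (intro Inf_lower) (auto simp: g_def)
  also have "D_p G r p \<nu> g = (\<Sum>\<^sub>\<infinity>i\<in>V. ennreal (1 / M) * ennreal (\<nu> i * \<bar>f i - f (par i)\<bar> powr p))"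
    unfolding D_p_def g_def diff_divide_distrib[symmetric] scale using M nu_pos
    by (intro infsum_cong) (simp flip: ennreal_mult' add: less_imp_le)
  also have "\<dots> = ennreal (1 / M) * D_p G r p \<nu> f"
    unfolding infsum_cmult_ennreal D_p_def ..
  finally have "lam * ennreal M \<le> ennreal (1 / M) * D_p G r p \<nu> f * ennreal M"
    by (rule mult_right_mono) simp
  also have "\<dots> = D_p G r p \<nu> f * (ennreal (1 / M) * ennreal M)"
    by (simp add: ac_simps)
  also have "\<dots> = D_p G r p \<nu> f" using M by (simp flip: ennreal_mult)
  finally show ?thesis using M by simp
qed simp

end

section \<open>Lower bounds\<close>

context weighted_tree
begin

lemma increasing_imp_pos:
  fixes f :: "'v \<Rightarrow> real"
  assumes "f r = 0" "\<And>i. i \<in> V \<Longrightarrow> f (par i) \<le> f i" "0 < f stem" "i \<in> V"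
  shows "0 < f i"
proof -
  have "i \<in> pverts G" using assms by simp
  then have "i \<noteq> r \<longrightarrow> 0 < f i"
  proof (induction rule: tree_induct)
    case (parent i)
    have le: "f (par i) \<le> f i" by (rule assms(2)[OF parent(1)])
    show ?case
    proof (cases "i = stem")
      case False
      then have "0 < f (par i)" using parent(2) parent_eq_root[OF parent(1)] by simp
      then show ?thesis using le by linarith
    qed (use assms(3) in simp)
  qed simp
  then show ?thesis using assms by simp
qed

lemma F_I_subset_F_II: "F_I G r \<subseteq> F_II G r"
proof
  fix f assume f: "f \<in> F_I G r"
  then have "f (par stem) < f stem" "f r = 0" using stem_in unfolding F_I_def by blast+
  then have "0 < f stem" using parent_stem by simp
  then show "f \<in> F_II G r" using increasing_imp_pos[of f] f by (auto simp: F_I_def F_II_def less_imp_le)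
qed

text \<open>
  Jensen's inequality along the path from \<open>j\<close> to the root, weighted by the increments of
  \<open>g = pot f\<close>, bounds \<open>\<bar>h j\<bar> powr p\<close> by \<open>g j powr (p - 1)\<close> times a sum over the path. After
  multiplying by \<open>\<mu> j * (f j / g j) powr (p - 1)\<close> and exchanging the order of summation, the sum over the
  subtree of \<open>k\<close> is the flow of \<open>g\<close> through \<open>k\<close>, and what remains is exactly the energy of \<open>h\<close>.
\<close>

lemma lower_bound_II:
  assumes f: "f \<in> F_II G r"
  shows "(INF i\<in>V. inverse (II_op G r p \<nu> \<mu> f i)) \<le> lam"
proof -
  define c where "c = (INF i\<in>V. inverse (II_op G r p \<nu> \<mu> f i))"
  have c_le: "c \<le> inverse (II_op G r p \<nu> \<mu> f i)" if "i \<in> V" for i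
    unfolding c_def by (rule INF_lower[OF that])
  have f_pos: "0 < f i" if "i \<in> V" for i using f that by (simp add: F_II_def)
  show ?thesis unfolding c_def[symmetric]
  proof (cases "c = 0")
    case False
    have "PS f stem < \<infinity>"
    proof (rule ccontr)
      assume "\<not> ?thesis"
      then have "ennpowr (PS f stem) (p - 1) = top" by (simp add: ennpowr_def less_top[symmetric])
      then have "II_op G r p \<nu> \<mu> f stem = top"
        by (simp add: II_op_def ennreal_mult_top)
      then show False using c_le[OF stem_in] False by simp
    qed
    then have fin: "SS f stem < \<infinity>" by (rule PS_finite_imp[OF stem_in])
    have SSp: "0 < SS f i" if "i \<in> V" for i using SS_pos_self[of i f] f_pos that by blast
    define g where "g = pot f"
    have g_pos: "0 < g i" if "i \<in> V" for i
      unfolding g_def by (rule pot_pos[OF fin SSp[OF stem_in] that])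
    have dg: "0 < g i - g (par i)" if "i \<in> V" for i
      using pot_strict[OF fin that SSp[OF that]] by (simp add: g_def)
    have cb: "c \<le> ennreal ((f i / g i) powr (p - 1))" if "i \<in> V" for i
      using c_le[OF that] inverse_II_pot[OF fin SSp[OF stem_in] that] f_pos[OF that]
      by (simp add: g_def)
    have "c \<le> D_p G r p \<nu> h" if h: "mu_p G p \<mu> h = 1" "h r = 0" for h
    proof -
      define b where "b k = \<bar>h k - h (par k)\<bar> powr p * (g k - g (par k)) powr (1 - p)" for k
      have b0: "0 \<le> b k" for k by (simp add: b_def)
      have "c = (\<Sum>\<^sub>\<infinity>j\<in>V. c * ennreal (\<mu> j * \<bar>h j\<bar> powr p))"
        unfolding infsum_cmult_ennreal mu_p_V[of h, OF h(2), symmetric] h(1) by simp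
      also have "\<dots> \<le> (\<Sum>\<^sub>\<infinity>j\<in>V. ennreal (\<mu> j * f j powr (p - 1)) * (\<Sum>k\<in>rpath j. ennreal (b k)))"
      proof (rule infsum_mono_ennreal)
        fix j assume j: "j \<in> V"
        then have jG: "j \<in> pverts G" by simp
        have "\<bar>h j\<bar> powr p \<le> g j powr (p - 1) * (\<Sum>k\<in>rpath j. b k)"
          using weighted_power_mean[OF finite_path, of j "\<lambda>k. g k - g (par k)" p "\<lambda>k. h k - h (par k)"]
            path_subset[OF jG] dg p_gt_1 path_telescope[OF jG, of h] path_telescope[OF jG, of g] h(2)
          by (auto simp: b_def g_def pot_root)
        then have "(f j / g j) powr (p - 1) * (\<mu> j * \<bar>h j\<bar> powr p)
            \<le> (f j / g j) powr (p - 1) * (\<mu> j * (g j powr (p - 1) * (\<Sum>k\<in>rpath j. b k)))"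
          using mu_pos[OF jG] by (intro mult_left_mono) auto
        also have "\<dots> = \<mu> j * f j powr (p - 1) * (\<Sum>k\<in>rpath j. b k)"
          using f_pos[OF j] g_pos[OF j] by (simp add: powr_divide)
        finally have *: "(f j / g j) powr (p - 1) * (\<mu> j * \<bar>h j\<bar> powr p) \<le> \<mu> j * f j powr (p - 1) * (\<Sum>k\<in>rpath j. b k)" .
        have "c * ennreal (\<mu> j * \<bar>h j\<bar> powr p) \<le> ennreal ((f j / g j) powr (p - 1)) * ennreal (\<mu> j * \<bar>h j\<bar> powr p)"
          by (rule mult_right_mono[OF cb[OF j]]) simp
        also have "\<dots> = ennreal ((f j / g j) powr (p - 1) * (\<mu> j * \<bar>h j\<bar> powr p))"
          by (simp add: ennreal_mult')
        also have "\<dots> \<le> ennreal (\<mu> j * f j powr (p - 1) * (\<Sum>k\<in>rpath j. b k))"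
          using * by (rule ennreal_leI)
        also have "\<dots> = ennreal (\<mu> j * f j powr (p - 1)) * (\<Sum>k\<in>rpath j. ennreal (b k))"
          using mu_pos[OF jG] b0 by (simp add: ennreal_mult sum_nonneg)
        finally show "c * ennreal (\<mu> j * \<bar>h j\<bar> powr p)
          \<le> ennreal (\<mu> j * f j powr (p - 1)) * (\<Sum>k\<in>rpath j. ennreal (b k))" .
      qed
      also have "\<dots> = (\<Sum>\<^sub>\<infinity>k\<in>V. ennreal (b k) * SS f k)"
        unfolding path_sub_swap subtree_sum_def ..
      also have "\<dots> = D_p G r p \<nu> h"
        unfolding D_p_def
      proof (rule infsum_cong)
        fix k assume k: "k \<in> V"
        have "SS f k = ennreal (\<nu> k * (g k - g (par k)) powr (p - 1))"
          unfolding g_def pot_flow[OF fin k] by (rule SS_ss[OF fin k])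
        moreover have "(g k - g (par k)) powr (1 - p) * (g k - g (par k)) powr (p - 1) = 1"
          using dg[OF k] by (simp flip: powr_add)
        then have "\<nu> k * \<bar>h k - h (par k)\<bar> powr p * ((g k - g (par k)) powr (1 - p) * (g k - g (par k)) powr (p - 1))
            = \<nu> k * \<bar>h k - h (par k)\<bar> powr p"
          by (simp only: mult_1_right)
        then have "b k * (\<nu> k * (g k - g (par k)) powr (p - 1)) = \<nu> k * \<bar>h k - h (par k)\<bar> powr p"
          unfolding b_def by (simp only: mult_ac)
        ultimately show "ennreal (b k) * SS f k = ennreal (\<nu> k * \<bar>h k - h (par k)\<bar> powr p)"
          using ennreal_mult'[OF b0, of k "\<nu> k * (g k - g (par k)) powr (p - 1)"] by (simp only:)
      qed
      finally show ?thesis .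
    qed
    then show "c \<le> lam" unfolding lambda_p_def by (intro Inf_greatest) auto
  qed simp
qed

text \<open>
  A pointwise bound for the flow of \<open>f\<close> by its subtree sums becomes, after taking roots and summing
  along a path, a bound for \<open>f\<close> by \<open>pot f\<close>.
\<close>

lemma pot_le:
  assumes c: "0 < c" and fin: "SS f stem < \<infinity>" and i: "i \<in> pverts G" and "f r = 0"
    and mono: "\<And>k. k \<in> V \<Longrightarrow> f (par k) \<le> f k"
    and le: "\<And>k. k \<in> V \<Longrightarrow> c * ss f k \<le> \<nu> k * (f k - f (par k)) powr (p - 1)"
  shows "c powr (1 / (p - 1)) * pot f i \<le> f i"
proof -
  have "c powr (1 / (p - 1)) * (pot f k - pot f (par k)) \<le> f k - f (par k)" if k: "k \<in> V" for k
  proof -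
    have nu: "0 < \<nu> k" using k nu_pos by simp
    have "c powr (1 / (p - 1)) * (pot f k - pot f (par k)) = (c * ss f k / \<nu> k) powr (1 / (p - 1))"
      unfolding pot_diff[OF fin k] times_divide_eq_right[symmetric]
      using nu c ss_nonneg[of f k] by (subst powr_mult) auto
    also have "\<dots> \<le> ((f k - f (par k)) powr (p - 1)) powr (1 / (p - 1))"
      using le[OF k] nu c ss_nonneg[of f k] p_gt_1 by (intro powr_mono2) (auto simp: field_simps)
    also have "\<dots> = f k - f (par k)" using mono[OF k] p_gt_1 by (intro powr_inverse_exponent) auto
    finally show ?thesis .
  qed
  then have "(\<Sum>k\<in>rpath i. c powr (1 / (p - 1)) * (pot f k - pot f (par k))) \<le> (\<Sum>k\<in>rpath i. f k - f (par k))"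
    using path_subset[OF i] by (intro sum_mono) auto
  then show ?thesis
    by (simp add: path_telescope[OF i] pot_root \<open>f r = 0\<close> flip: sum_distrib_left)
qed

lemma lower_I_le_II:
  assumes f: "f \<in> F_I G r"
  shows "(INF i\<in>V. inverse (I_op G r p \<nu> \<mu> f i)) \<le> (INF i\<in>V. inverse (II_op G r p \<nu> \<mu> f i))"
proof (rule INF_greatest)
  fix i assume i: "i \<in> V"
  define C where "C = (INF i\<in>V. inverse (I_op G r p \<nu> \<mu> f i))"
  have f_pos: "0 < f i" if "i \<in> V" for i
    using f F_I_subset_F_II that by (auto simp: F_II_def)
  have mono: "f (par k) \<le> f k" if "k \<in> V" for k
    using f that by (simp add: F_I_def less_imp_le)
  have SSp: "0 < SS f i" if "i \<in> V" for i using SS_pos_self[of i f] f_pos that by blast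
  have le: "C * SS f k \<le> ennreal (\<nu> k * (f k - f (par k)) powr (p - 1))" if k: "k \<in> V" for k
  proof (rule le_divide_imp_mult_le_ennreal)
    have "C \<le> inverse (I_op G r p \<nu> \<mu> f k)" unfolding C_def by (rule INF_lower[OF k])
    then show "C \<le> ennreal (\<nu> k * (f k - f (par k)) powr (p - 1)) / SS f k"
      using inverse_I[of f k] SSp[OF k] by simp
  qed
  show "C \<le> inverse (II_op G r p \<nu> \<mu> f i)"
  proof (cases "C = 0")
    case False
    have lt: "C * SS f stem < \<infinity>" using le[OF stem_in] by (rule order_le_less_trans) simp
    then have fin: "SS f stem < \<infinity>" "C < \<infinity>"
      using False SSp[OF stem_in] by (auto simp: ennreal_mult_less_top less_top[symmetric] ennreal_mult_eq_top_iff)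
    define c where "c = enn2real C"
    have c: "C = ennreal c" "0 < c" using fin(2) False
      by (auto simp: c_def enn2real_positive_iff less_top[symmetric] zero_less_iff_neq_zero)
    have le': "c * ss f k \<le> \<nu> k * (f k - f (par k)) powr (p - 1)" if k: "k \<in> V" for k
    proof -
      have "ennreal (c * ss f k) \<le> ennreal (\<nu> k * (f k - f (par k)) powr (p - 1))"
        using le[OF k] c ss_nonneg[of f k] by (simp add: SS_ss[OF fin(1) k] ennreal_mult)
      then show ?thesis using nu_pos[of k] k by (subst (asm) ennreal_le_iff) auto
    qed
    have g_pos: "0 < pot f i" by (rule pot_pos[OF fin(1) SSp[OF stem_in] i])
    have "c powr (1 / (p - 1)) * pot f i \<le> f i"
      using i f by (intro pot_le c fin le' mono) (auto simp: F_I_def)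
    then have "c powr (1 / (p - 1)) \<le> f i / pot f i" using g_pos by (simp add: field_simps)
    then have "(c powr (1 / (p - 1))) powr (p - 1) \<le> (f i / pot f i) powr (p - 1)"
      using p_gt_1 by (intro powr_mono2) auto
    then have "c \<le> (f i / pot f i) powr (p - 1)"
      using c p_gt_1 by (subst (asm) powr_inverse_exponent) auto
    then show ?thesis
      using inverse_II_pot[OF fin(1) SSp[OF stem_in] i] f_pos[OF i] c by (simp add: ennreal_leI)
  qed simp
qed

text \<open>
  The substitution \<open>w i = f i / f (par i)\<close> turns the difference form into the defect of the flow of \<open>f\<close>
  at \<open>i\<close>: what enters through the edge above \<open>i\<close> minus what leaves through the edges below.
\<close>

lemma ratio_flow:
  assumes f: "f r = 0" "\<And>i. i \<in> V \<Longrightarrow> 0 < f i" "\<And>i. i \<in> V \<Longrightarrow> f (par i) \<le> f i"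
    and w: "w stem = \<infinity>" "\<And>i. i \<in> V \<Longrightarrow> i \<noteq> stem \<Longrightarrow> w i = ereal (f i / f (par i))"
    and i: "i \<in> V"
  shows "own_term p \<nu> w i * f i powr (p - 1) = \<nu> i * (f i - f (par i)) powr (p - 1)"
    and "child_term G r p \<nu> w i * f i powr (p - 1) = (\<Sum>j\<in>children G r i. \<nu> j * (f j - f (par j)) powr (p - 1))"
proof -
  have *: "x powr (p - 1) * f i powr (p - 1) = (x * f i) powr (p - 1)" if "0 \<le> x" for x
    using that f(2)[OF i] by (simp add: powr_mult)
  have x: "1 - real_of_ereal (inverse (w i)) = (f i - f (par i)) / f i"
  proof (cases "i = stem")
    case True
    then show ?thesis using w(1) f(1) f(2)[OF i] parent_stem by simp
  next
    case False
    then have "par i \<in> V" using parent_in[OF i] parent_eq_root[OF i] by simp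
    then show ?thesis using w(2)[OF i False] f(2)[OF i] f(2)[of "par i"] by (simp add: field_simps)
  qed
  show "own_term p \<nu> w i * f i powr (p - 1) = \<nu> i * (f i - f (par i)) powr (p - 1)"
    unfolding own_term_def x mult.assoc using f(2,3)[OF i] by (subst *) auto
  have "\<nu> j * (real_of_ereal (w j) - 1) powr (p - 1) * f i powr (p - 1) = \<nu> j * (f j - f (par j)) powr (p - 1)"
    if "j \<in> children G r i" for j
  proof -
    have j: "j \<in> V" "par j = i" using that i by (auto simp: children_eq)
    then have "j \<noteq> stem" using i parent_stem by auto
    then have "real_of_ereal (w j) - 1 = (f j - f (par j)) / f i"
      using w(2)[OF j(1)] j f(2)[OF i] by (simp add: field_simps)
    then show ?thesis unfolding mult.assoc using f(2)[OF i] f(3)[OF j(1)] j by (subst *) auto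
  qed
  then show "child_term G r p \<nu> w i * f i powr (p - 1) = (\<Sum>j\<in>children G r i. \<nu> j * (f j - f (par j)) powr (p - 1))"
    unfolding child_term_def sum_distrib_right by (rule sum.cong[OF refl])
qed

text \<open>
  The subtree sums form the smallest nonnegative flow with the given sources; finitely many levels
  at a time, by induction on their number.
\<close>

lemma SS_le_superflow:
  fixes u :: "'v \<Rightarrow> ennreal"
  assumes u: "\<And>i. i \<in> V \<Longrightarrow> c * ennreal (\<mu> i * f i powr (p - 1)) + (\<Sum>j\<in>children G r i. u j) \<le> u i"
    and i: "i \<in> V"
  shows "c * SS f i \<le> u i"
proof -
  define t where "t j = c * ennreal (\<mu> j * f j powr (p - 1))" for j
  define E where "E n i = {j \<in> desc i. lev j \<le> lev i + n}" for n i
  have finE: "finite (E n i)" if "i \<in> V" for n i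
    using finite_V_level by (rule finite_subset[rotated]) (use sub_subset[OF that] in \<open>auto simp: E_def\<close>)
  have lev_sub: "lev i \<le> lev j" if "j \<in> desc i" "i \<in> V" for i j
    using that level_in_path by (auto simp: sub_eq)
  have "(\<Sum>j\<in>E n i. t j) \<le> u i" if "i \<in> V" for n i
    using that
  proof (induction n arbitrary: i)
    case (Suc n)
    have iG: "i \<in> pverts G" using Suc by simp
    have ch: "j \<in> V" "lev j = Suc (lev i)" if "j \<in> children G r i" for j
      using that iG level_parent[of j] by (auto simp: children_eq)
    have "E (Suc n) i \<subseteq> insert i (\<Union>j\<in>children G r i. E n j)"
      using sub_step[OF Suc.prems] ch by (auto simp: E_def)
    then have "(\<Sum>j\<in>E (Suc n) i. t j) \<le> (\<Sum>j\<in>insert i (\<Union>j\<in>children G r i. E n j). t j)"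
      using finite_children[OF iG] finE ch by (intro sum_mono2) auto
    also have "\<dots> \<le> t i + (\<Sum>j\<in>(\<Union>j\<in>children G r i. E n j). t j)"
      using finite_children[OF iG] finE ch by (subst sum.insert_if) (auto simp: add_increasing)
    also have "(\<Sum>j\<in>(\<Union>j\<in>children G r i. E n j). t j) = (\<Sum>j\<in>children G r i. \<Sum>k\<in>E n j. t k)"
    proof (rule sum.UNION_disjoint)
      show "\<forall>j\<in>children G r i. \<forall>k\<in>children G r i. j \<noteq> k \<longrightarrow> E n j \<inter> E n k = {}"
        using disjoint_children_subs[OF iG] by (auto simp: disjoint_family_on_def E_def)
    qed (use finite_children[OF iG] finE ch in auto)
    also have "\<dots> \<le> (\<Sum>j\<in>children G r i. u j)" using Suc.IH ch by (intro sum_mono) auto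
    also have "t i + (\<Sum>j\<in>children G r i. u j) \<le> u i" using u[OF Suc.prems] by (simp add: t_def)
    finally show ?case by (simp add: add_left_mono)
  next
    case 0
    have "E 0 i = {i}"
    proof -
      have "j = i" if "j \<in> desc i" "lev j \<le> lev i" for j
      proof (rule ccontr)
        assume "j \<noteq> i"
        have "j \<in> insert i (\<Union>k\<in>children G r i. desc k)"
          unfolding sub_step[OF 0, symmetric] by (rule that(1))
        then obtain k where "k \<in> children G r i" "j \<in> desc k" using \<open>j \<noteq> i\<close> by auto
        moreover from this have "k \<in> V" "par k = i" using 0 by (simp_all add: children_eq)
        ultimately have "lev k = Suc (lev i)" "lev k \<le> lev j"
          using level_parent[of k] lev_sub[of j k] by simp_all
        then show False using that(2) by simp
      qed
      then show ?thesis using self_in_sub[OF 0] by (auto simp: E_def)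
    qed
    moreover have "t i \<le> u i"
    proof -
      have "t i \<le> t i + (\<Sum>j\<in>children G r i. u j)" by simp
      also have "\<dots> \<le> u i" using u[OF 0] by (simp add: t_def)
      finally show ?thesis .
    qed
    ultimately show ?case by simp
  qed
  then have E: "(\<Sum>j\<in>E n i. t j) \<le> u i" for n using i by blast
  have "(\<Sum>\<^sub>\<infinity>j\<in>desc i. t j) \<le> u i"
  proof (rule infsum_le_ennreal)
    fix F assume F: "finite F" "F \<subseteq> desc i"
    define n where "n = Max (insert 0 (lev ` F))"
    have "F \<subseteq> E n i" using F by (auto simp: E_def n_def intro!: trans_le_add2 Max_ge)
    then have "sum t F \<le> sum t (E n i)" using finE[OF i] by (intro sum_mono2) auto
    then show "sum t F \<le> u i" using E order_trans by blast
  qed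
  then show ?thesis unfolding subtree_sum_def t_def infsum_cmult_ennreal .
qed

text \<open>
  The inverse of the substitution \<open>w i = f i / f (par i)\<close>. Skipping the factor at \<open>stem\<close>, where \<open>w\<close> is infinite,
  normalises the function to \<open>1\<close> there.
\<close>

definition ratio_prod :: "('v \<Rightarrow> ereal) \<Rightarrow> 'v \<Rightarrow> real" where
  "ratio_prod w i = (if i = r then 0 else \<Prod>k\<in>rpath i. if k = stem then 1 else real_of_ereal (w k))"

lemma ratio_prod_root: "ratio_prod w r = 0"
  by (simp add: ratio_prod_def)

lemma ratio_prod_stem: "ratio_prod w stem = 1"
  using stem_in path_step[OF stem_in] by (simp add: ratio_prod_def parent_stem path_root)

lemma ratio_prod_step:
  "i \<in> V \<Longrightarrow> i \<noteq> stem \<Longrightarrow> ratio_prod w i = real_of_ereal (w i) * ratio_prod w (par i)"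
  using parent_eq_root[of i]
  by (simp add: ratio_prod_def path_step notin_path_parent finite_path)

lemma ratio_prod_mono:
  assumes w: "\<And>i. i \<in> V \<Longrightarrow> i \<noteq> stem \<Longrightarrow> 1 \<le> real_of_ereal (w i)" and i: "i \<in> V"
  shows "0 < ratio_prod w i \<and> ratio_prod w (par i) \<le> ratio_prod w i
    \<and> (i \<noteq> stem \<longrightarrow> real_of_ereal (w i) = ratio_prod w i / ratio_prod w (par i))"
proof -
  have "i \<in> pverts G" using i by simp
  then have "i \<noteq> r \<longrightarrow> 0 < ratio_prod w i \<and> ratio_prod w (par i) \<le> ratio_prod w i
    \<and> (i \<noteq> stem \<longrightarrow> real_of_ereal (w i) = ratio_prod w i / ratio_prod w (par i))"
  proof (induction rule: tree_induct)
    case (parent i)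
    show ?case
    proof (cases "i = stem")
      case True
      then show ?thesis by (simp add: ratio_prod_stem parent_stem ratio_prod_root)
    next
      case False
      then have "0 < ratio_prod w (par i)" using parent parent_eq_root by auto
      then show ?thesis
        using w[OF parent(1) False] ratio_prod_step[OF parent(1) False, of w] by simp
    qed
  qed simp
  then show ?thesis using i by simp
qed

text \<open>
  A lower bound \<open>c\<close> for \<open>R\<close> says that the flow of \<open>ratio_prod w\<close> loses at least \<open>c * \<mu> i * f i powr (p - 1)\<close> at \<open>i\<close>;
  accumulated over a subtree, the flow is at least \<open>c\<close> times the subtree sum. A bound \<open>c \<le> 0\<close> is trivial,
  since \<open>1 / I\<close> is nonnegative.
\<close>

lemma lower_R_le_I:
  assumes w: "w \<in> W_set G r"
  shows "\<exists>f\<in>F_I G r. (INF i\<in>V. ereal (R_op G r p \<nu> \<mu> w i))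
    \<le> enn2ereal (INF i\<in>V. inverse (I_op G r p \<nu> \<mu> f i))"
proof -
  define f where "f = ratio_prod w"
  have wstem: "w stem = \<infinity>" and w1: "\<forall>i\<in>V - {stem}. \<bar>w i\<bar> \<noteq> \<infinity>" and w2: "\<forall>i\<in>V. 1 < w i"
    using w by (simp_all add: W_set_def W_base_def children_root)
  have wi: "w i = ereal (real_of_ereal (w i)) \<and> 1 < real_of_ereal (w i)" if "i \<in> V" "i \<noteq> stem" for i
  proof -
    have "\<bar>w i\<bar> \<noteq> \<infinity>" "1 < w i" using bspec[OF w1, of i] bspec[OF w2, of i] that by simp_all
    then show ?thesis by (cases "w i") auto
  qed
  have f: "f r = 0" "\<And>i. i \<in> V \<Longrightarrow> 0 < f i" "\<And>i. i \<in> V \<Longrightarrow> f (par i) \<le> f i"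
      "\<And>i. i \<in> V \<Longrightarrow> i \<noteq> stem \<Longrightarrow> real_of_ereal (w i) = f i / f (par i)"
    using ratio_prod_mono[of w] wi ratio_prod_root unfolding f_def by (auto simp: less_imp_le)
  have FI: "f \<in> F_I G r"
  proof -
    have "f (par i) < f i" if i: "i \<in> V" for i
    proof (cases "i = stem")
      case True
      then show ?thesis using f(1) f(2)[OF i] parent_stem by simp
    next
      case False
      then have "0 < f (par i)" using f(2)[of "par i"] parent_in[OF i] parent_eq_root[OF i] by simp
      then show ?thesis using f(4)[OF i False] wi[OF i False] by simp
    qed
    then show ?thesis using f(1) by (simp add: F_I_def)
  qed
  define C where "C = (INF i\<in>V. ereal (R_op G r p \<nu> \<mu> w i))"
  have CR: "C \<le> ereal (R_op G r p \<nu> \<mu> w i)" if "i \<in> V" for i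
    unfolding C_def by (rule INF_lower[OF that])
  have "C \<le> enn2ereal (INF i\<in>V. inverse (I_op G r p \<nu> \<mu> f i))"
  proof (cases "C \<le> 0")
    case True
    then show ?thesis using enn2ereal_nonneg order_trans by blast
  next
    case False
    then obtain c where c: "C = ereal c" "0 < c" using CR[OF stem_in] by (cases C) auto
    have wf: "w i = ereal (f i / f (par i))" if "i \<in> V" "i \<noteq> stem" for i
      using conjunct1[OF wi[OF that]] unfolding f(4)[OF that] .
    have rf: "own_term p \<nu> w i * f i powr (p - 1) = \<nu> i * (f i - f (par i)) powr (p - 1)"
        "child_term G r p \<nu> w i * f i powr (p - 1) = (\<Sum>j\<in>children G r i. \<nu> j * (f j - f (par j)) powr (p - 1))"
      if "i \<in> V" for i
      using f(2,3) wf by (auto intro!: ratio_flow[of f w i] f(1) wstem that)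
    define u where "u i = \<nu> i * (f i - f (par i)) powr (p - 1)" for i
    have u0: "0 \<le> u i" if "i \<in> V" for i using nu_pos[of i] that by (simp add: u_def)
    have step: "c * (\<mu> i * f i powr (p - 1)) + (\<Sum>j\<in>children G r i. u j) \<le> u i" if i: "i \<in> V" for i
    proof -
      have mu: "0 < \<mu> i" using mu_pos i by simp
      have "c \<le> R_op G r p \<nu> \<mu> w i" using CR[OF i] c by simp
      then have "c * \<mu> i \<le> own_term p \<nu> w i - child_term G r p \<nu> w i"
        using mu by (simp add: R_op_def field_simps)
      then have "c * \<mu> i * f i powr (p - 1) \<le> (own_term p \<nu> w i - child_term G r p \<nu> w i) * f i powr (p - 1)"
        by (rule mult_right_mono) simp
      also have "\<dots> = u i - (\<Sum>j\<in>children G r i. u j)"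
        unfolding left_diff_distrib u_def by (simp only: rf[OF i])
      finally show ?thesis by (simp add: mult.assoc)
    qed
    have flow_le: "ennreal c * SS f i \<le> ennreal (u i)" if "i \<in> V" for i
    proof (rule SS_le_superflow[OF _ that])
      fix i assume i: "i \<in> V"
      have "(\<Sum>j\<in>children G r i. ennreal (u j)) = ennreal (\<Sum>j\<in>children G r i. u j)"
        using u0 children_subset by (intro sum_ennreal) blast
      then have "ennreal c * ennreal (\<mu> i * f i powr (p - 1)) + (\<Sum>j\<in>children G r i. ennreal (u j))
          = ennreal (c * (\<mu> i * f i powr (p - 1)) + (\<Sum>j\<in>children G r i. u j))"
        using c mu_pos[of i] i u0 children_subset by (simp add: ennreal_mult sum_nonneg subset_eq)
      also have "\<dots> \<le> ennreal (u i)" using step[OF i] by (rule ennreal_leI)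
      finally show "ennreal c * ennreal (\<mu> i * f i powr (p - 1)) + (\<Sum>j\<in>children G r i. ennreal (u j)) \<le> ennreal (u i)" .
    qed
    have "ennreal c \<le> ennreal (u i) / SS f i \<and> SS f i \<noteq> 0" if i: "i \<in> V" for i
    proof -
      have "0 < SS f i" using SS_pos_self[of i f] f(2) i by blast
      moreover have le: "ennreal c * SS f i \<le> ennreal (u i)" by (rule flow_le[OF i])
      moreover have "SS f i \<noteq> Orderings.top"
      proof
        assume "SS f i = Orderings.top"
        then show False using le c(2) by (simp add: ennreal_mult_top top_unique)
      qed
      ultimately show ?thesis using mult_le_imp_le_divide_ennreal by auto
    qed
    then have "ennreal c \<le> (INF i\<in>V. inverse (I_op G r p \<nu> \<mu> f i))"
      by (intro INF_greatest) (auto simp: inverse_I u_def)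
    then have "enn2ereal (ennreal c) \<le> enn2ereal (INF i\<in>V. inverse (I_op G r p \<nu> \<mu> f i))"
      by (simp add: less_eq_ennreal.rep_eq)
    then show ?thesis using c by (simp add: enn2ereal_ennreal)
  qed
  then show ?thesis using FI unfolding C_def by blast
qed

text \<open>
  With \<open>w\<close> formed from \<open>pot f\<close>, the flow defect at \<open>i\<close> is the source \<open>\<mu> i * f i powr (p - 1)\<close>.
\<close>

lemma ratio_of_pot:
  assumes f: "\<And>i. i \<in> V \<Longrightarrow> 0 < f i" and fin: "SS f stem < \<infinity>"
  obtains w where "w \<in> W_set G r" "\<And>i. i \<in> V \<Longrightarrow> R_op G r p \<nu> \<mu> w i = (f i / pot f i) powr (p - 1)"
proof -
  define g where "g = pot f"
  have SSp: "0 < SS f i" if "i \<in> V" for i using SS_pos_self[of i f] f that by blast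
  have g: "g r = 0" "\<And>i. i \<in> V \<Longrightarrow> 0 < g i" "\<And>i. i \<in> V \<Longrightarrow> g (par i) < g i"
    unfolding g_def using pot_root pot_pos[OF fin] pot_strict[OF fin] SSp stem_in by auto
  define w where "w i = (if i = stem then \<infinity> else ereal (g i / g (par i)))" for i
  have W: "w \<in> W_set G r"
  proof -
    have "1 < w i" if i: "i \<in> V" "i \<noteq> stem" for i
    proof -
      have "0 < g (par i)" using g(2)[of "par i"] parent_in[OF i(1)] parent_eq_root[OF i(1)] i by simp
      then show ?thesis using g(3)[OF i(1)] i(2) by (simp add: w_def one_ereal_def)
    qed
    then show ?thesis unfolding W_set_def W_base_def children_root by (auto simp: w_def)
  qed
  have "R_op G r p \<nu> \<mu> w i = (f i / g i) powr (p - 1)" if i: "i \<in> V" for i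
  proof -
    have iG: "i \<in> pverts G" using i by simp
    have wg: "w stem = \<infinity>" "\<And>k. k \<in> V \<Longrightarrow> k \<noteq> stem \<Longrightarrow> w k = ereal (g k / g (par k))"
      by (simp_all add: w_def)
    have rf: "own_term p \<nu> w i * g i powr (p - 1) = \<nu> i * (g i - g (par i)) powr (p - 1)"
        "child_term G r p \<nu> w i * g i powr (p - 1) = (\<Sum>j\<in>children G r i. \<nu> j * (g j - g (par j)) powr (p - 1))"
      by (rule ratio_flow[of g w i, OF g(1) g(2) less_imp_le[OF g(3)] wg i]; assumption)+
    have flow: "\<nu> j * (g j - g (par j)) powr (p - 1) = ss f j" if "j \<in> V" for j
      unfolding g_def by (rule pot_flow[OF fin that])
    have "(\<Sum>j\<in>children G r i. \<nu> j * (g j - g (par j)) powr (p - 1)) = (\<Sum>j\<in>children G r i. ss f j)"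
      by (rule sum.cong[OF refl flow]) (use children_subset in blast)
    then have "(own_term p \<nu> w i - child_term G r p \<nu> w i) * g i powr (p - 1) = ss f i - (\<Sum>j\<in>children G r i. ss f j)"
      by (simp only: left_diff_distrib rf flow[OF i])
    also have "\<dots> = \<mu> i * f i powr (p - 1)"
      by (simp add: ss_step[OF fin i])
    finally have "own_term p \<nu> w i - child_term G r p \<nu> w i = \<mu> i * (f i / g i) powr (p - 1)"
      using g(2)[OF i] f[OF i] by (simp add: powr_divide field_simps)
    then show ?thesis using mu_pos[OF iG] by (simp add: R_op_def)
  qed
  then show ?thesis using that W by (simp add: g_def)
qed

end

section \<open>Truncation at a level\<close>

context weighted_tree
begin

text \<open>
  The ancestor of \<open>i\<close> at level \<open>n\<close>, or \<open>i\<close> itself if it is not deeper. Composition with \<open>anc n\<close> truncates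
  a function at level \<open>n\<close>: it becomes constant along all paths beyond.
\<close>

definition anc :: "nat \<Rightarrow> 'v \<Rightarrow> 'v" where "anc n i = (par ^^ (lev i - n)) i"

definition layers :: "nat \<Rightarrow> 'v set" where "layers n = {i \<in> V. lev i \<le> n}"

text \<open>
  The masses of the truncated tree: the image of \<open>\<mu>\<close> under \<open>anc n\<close>.
\<close>

definition tmass :: "nat \<Rightarrow> 'v \<Rightarrow> real" where "tmass n k = (\<Sum>\<^sub>\<infinity>j\<in>{j \<in> V. anc n j = k}. \<mu> j)"

text \<open>
  The levels at which the tree may be truncated.
\<close>

definition depths :: "nat set" where "depths = {n. 1 \<le> n \<and> enat n < max_level G r + 1}"

lemma finite_layers: "finite (layers n)"
  unfolding layers_def by (rule finite_V_level)

lemma layers_V: "k \<in> layers n \<Longrightarrow> k \<in> V"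
  by (simp add: layers_def)

lemma stem_in_layers: "1 \<le> n \<Longrightarrow> stem \<in> layers n"
  using stem_in by (simp add: layers_def level_stem)

lemma anc_low: "lev i \<le> n \<Longrightarrow> anc n i = i"
  by (simp add: anc_def)

lemma anc_high:
  assumes "i \<in> V" "n < lev i"
  shows "anc n i = anc n (par i)"
proof -
  have "lev i - n = Suc (lev (par i) - n)" using level_parent[OF assms(1)] assms(2) by simp
  then show ?thesis by (simp add: anc_def funpow_Suc_right del: funpow.simps)
qed

lemma anc_root: "anc n r = r"
  by (simp add: anc_low)

lemma anc_props:
  assumes n: "1 \<le> n" and i: "i \<in> V"
  shows "anc n i \<in> layers n \<and> lev (anc n i) = min n (lev i) \<and> (\<forall>k. lev k \<le> n \<longrightarrow> k \<in> rpath (anc n i) \<longleftrightarrow> k \<in> rpath i)"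
proof -
  have "i \<in> pverts G" using i by simp
  then have "i \<noteq> r \<longrightarrow> anc n i \<in> layers n \<and> lev (anc n i) = min n (lev i)
      \<and> (\<forall>k. lev k \<le> n \<longrightarrow> k \<in> rpath (anc n i) \<longleftrightarrow> k \<in> rpath i)"
  proof (induction rule: tree_induct)
    case (parent i)
    show ?case
    proof (cases "lev i \<le> n")
      case True
      then show ?thesis using parent(1) by (simp add: anc_low layers_def)
    next
      case False
      have "par i \<noteq> r"
        using False level_parent[OF parent(1)] n by auto
      then show ?thesis
        using False parent level_parent[OF parent(1)] by (auto simp: anc_high path_step)
    qed
  qed simp
  then show ?thesis using i by simp
qed

lemma anc_in_layers: "1 \<le> n \<Longrightarrow> i \<in> V \<Longrightarrow> anc n i \<in> layers n"
  and level_anc: "1 \<le> n \<Longrightarrow> i \<in> V \<Longrightarrow> lev (anc n i) = min n (lev i)"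
  and path_anc: "1 \<le> n \<Longrightarrow> i \<in> V \<Longrightarrow> lev k \<le> n \<Longrightarrow> k \<in> rpath (anc n i) \<longleftrightarrow> k \<in> rpath i"
  using anc_props[of n i] by auto

lemma anc_parent:
  assumes "i \<in> V"
  shows "anc n (par i) = (if lev i \<le> n then par i else anc n i)"
  using assms level_parent[OF assms] by (simp add: anc_low anc_high)

lemma constant_beyond:
  assumes "\<And>i. i \<in> pverts G \<Longrightarrow> n + 1 \<le> lev i \<Longrightarrow> f i = f (par i)" and "i \<in> pverts G"
  shows "f (anc n i) = f i"
  using assms(2)
proof (induction rule: tree_induct)
  case (parent i)
  show ?case
  proof (cases "lev i \<le> n")
    case False
    then show ?thesis using parent assms(1)[of i] by (simp add: anc_high)
  qed (simp add: anc_low)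
qed (simp add: anc_root)

lemma tmass_ge:
  assumes "k \<in> layers n"
  shows "\<mu> k \<le> tmass n k"
proof -
  have "sum \<mu> {k} \<le> (\<Sum>\<^sub>\<infinity>j\<in>{j \<in> V. anc n j = k}. \<mu> j)"
  proof (rule finite_sum_le_infsum)
    show "\<mu> summable_on {j \<in> V. anc n j = k}"
      by (rule summable_on_subset_banach[OF mu_summable]) auto
    show "{k} \<subseteq> {j \<in> V. anc n j = k}" using assms by (auto simp: layers_def anc_low)
  qed (auto simp: less_imp_le mu_pos)
  then show ?thesis by (simp add: tmass_def)
qed

lemma tmass_pos: "k \<in> layers n \<Longrightarrow> 0 < tmass n k"
  using tmass_ge[of k n] mu_pos[of k] layers_V[of k n] by simp

lemma infsum_anc:
  assumes T: "T \<subseteq> layers n" and \<phi>: "\<And>k. 0 \<le> \<phi> k"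
  shows "(\<Sum>\<^sub>\<infinity>j\<in>{j \<in> V. anc n j \<in> T}. ennreal (\<mu> j * \<phi> (anc n j))) = ennreal (\<Sum>k\<in>T. tmass n k * \<phi> k)"
proof -
  have fT: "finite T" using T finite_layers finite_subset by blast
  have "{j \<in> V. anc n j \<in> T} = (\<Union>k\<in>T. {j \<in> V. anc n j = k})" by auto
  moreover have "disjoint_family_on (\<lambda>k. {j \<in> V. anc n j = k}) T" by (auto simp: disjoint_family_on_def)
  ultimately have "(\<Sum>\<^sub>\<infinity>j\<in>{j \<in> V. anc n j \<in> T}. ennreal (\<mu> j * \<phi> (anc n j)))
      = (\<Sum>k\<in>T. \<Sum>\<^sub>\<infinity>j\<in>{j \<in> V. anc n j = k}. ennreal (\<mu> j * \<phi> (anc n j)))"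
    using fT by (simp add: infsum_UN_disjoint_ennreal)
  also have "\<dots> = (\<Sum>k\<in>T. ennreal (tmass n k * \<phi> k))"
  proof (rule sum.cong[OF refl])
    fix k assume "k \<in> T"
    have "(\<Sum>\<^sub>\<infinity>j\<in>{j \<in> V. anc n j = k}. ennreal (\<mu> j * \<phi> (anc n j)))
        = (\<Sum>\<^sub>\<infinity>j\<in>{j \<in> V. anc n j = k}. ennreal (\<phi> k) * ennreal (\<mu> j))"
      using mu_pos \<phi> by (intro infsum_cong) (auto simp: mult.commute less_imp_le simp flip: ennreal_mult)
    also have "\<dots> = ennreal (\<phi> k) * ennreal (tmass n k)"
      unfolding infsum_cmult_ennreal tmass_def
    proof (subst infsum_ennreal_of_real)
      show "\<mu> summable_on {j \<in> V. anc n j = k}"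
        by (rule summable_on_subset_banach[OF mu_summable]) auto
    qed (auto simp: less_imp_le mu_pos)
    also have "\<dots> = ennreal (tmass n k * \<phi> k)" using \<phi> by (simp add: mult.commute flip: ennreal_mult')
    finally show "(\<Sum>\<^sub>\<infinity>j\<in>{j \<in> V. anc n j = k}. ennreal (\<mu> j * \<phi> (anc n j))) = ennreal (tmass n k * \<phi> k)" .
  qed
  also have "\<dots> = ennreal (\<Sum>k\<in>T. tmass n k * \<phi> k)"
    using T tmass_pos \<phi> by (intro sum_ennreal) (auto simp: less_imp_le intro!: mult_nonneg_nonneg)
  finally show ?thesis .
qed

lemma SS_anc:
  assumes n: "1 \<le> n" and i: "i \<in> layers n"
  shows "SS (\<lambda>j. f (anc n j)) i = ennreal (\<Sum>k\<in>{k \<in> layers n. i \<in> rpath k}. tmass n k * f k powr (p - 1))"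
proof -
  have "desc i = {j \<in> V. anc n j \<in> {k \<in> layers n. i \<in> rpath k}}"
    using i path_anc[OF n] anc_in_layers[OF n] by (auto simp: sub_eq layers_def)
  then show ?thesis
    unfolding subtree_sum_def
    using infsum_anc[of "{k \<in> layers n. i \<in> rpath k}" n "\<lambda>k. f k powr (p - 1)"] by auto
qed

lemma mu_p_anc:
  assumes n: "1 \<le> n" and "f r = 0"
  shows "mu_p G p \<mu> (\<lambda>j. f (anc n j)) = ennreal (\<Sum>k\<in>layers n. tmass n k * \<bar>f k\<bar> powr p)"
proof -
  have "{j \<in> V. anc n j \<in> layers n} = V" using anc_in_layers[OF n] by auto
  then show ?thesis
    using infsum_anc[of "layers n" n "\<lambda>k. \<bar>f k\<bar> powr p"] mu_p_V[of "\<lambda>j. f (anc n j)"] assms(2)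
    by (simp add: anc_root)
qed

lemma depths_level:
  assumes "i \<in> V"
  shows "lev i \<in> depths"
proof -
  have "enat (lev i) \<le> max_level G r"
    unfolding max_level_def using assms by (intro SUP_upper) auto
  then have "enat (lev i) < max_level G r + 1"
    by (cases "max_level G r") (auto simp: one_enat_def)
  then show ?thesis using level_ge_1[OF assms] by (simp add: depths_def)
qed

lemma depths_Max:
  assumes "finite F" "F \<subseteq> V"
  obtains n where "n \<in> depths" "\<And>j. j \<in> F \<Longrightarrow> lev j \<le> n"
proof -
  define n where "n = Max (lev ` insert stem F)"
  have "n \<in> lev ` insert stem F" unfolding n_def using assms by (intro Max_in) auto
  then have "n \<in> depths" using depths_level assms stem_in by auto
  moreover have "lev j \<le> n" if "j \<in> F" for j unfolding n_def using that assms by (intro Max_ge) auto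
  ultimately show ?thesis using that by blast
qed

text \<open>
  Deep truncations of a function have at least almost its mass: each finite set of vertices lies in
  the first few levels, where a truncation changes nothing.
\<close>

lemma mu_p_le_SUP_anc:
  assumes "g r = 0"
  shows "mu_p G p \<mu> g \<le> (SUP n\<in>depths. mu_p G p \<mu> (\<lambda>j. g (anc n j)))"
  unfolding mu_p_V[of g, OF assms]
proof (rule infsum_le_ennreal)
  fix F assume F: "finite F" "F \<subseteq> V"
  obtain n where n: "n \<in> depths" "\<And>j. j \<in> F \<Longrightarrow> lev j \<le> n" using depths_Max[OF F] by blast
  have "(\<Sum>k\<in>F. ennreal (\<mu> k * \<bar>g k\<bar> powr p)) = (\<Sum>k\<in>F. ennreal (\<mu> k * \<bar>g (anc n k)\<bar> powr p))"
    using n(2) by (intro sum.cong) (auto simp: anc_low)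
  also have "\<dots> \<le> mu_p G p \<mu> (\<lambda>j. g (anc n j))"
    unfolding mu_p_def using F by (intro sum_le_infsum_ennreal) auto
  also have "\<dots> \<le> (SUP n\<in>depths. mu_p G p \<mu> (\<lambda>j. g (anc n j)))"
    using n(1) by (rule SUP_upper)
  finally show "(\<Sum>k\<in>F. ennreal (\<mu> k * \<bar>g k\<bar> powr p)) \<le> (SUP n\<in>depths. mu_p G p \<mu> (\<lambda>j. g (anc n j)))" .
qed

lemma layers_energy_le: "ennreal (\<Sum>k\<in>layers n. \<nu> k * \<bar>g k - g (par k)\<bar> powr p) \<le> D_p G r p \<nu> g"
proof -
  have "ennreal (\<Sum>k\<in>layers n. \<nu> k * \<bar>g k - g (par k)\<bar> powr p) = (\<Sum>k\<in>layers n. ennreal (\<nu> k * \<bar>g k - g (par k)\<bar> powr p))"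
    using nu_pos layers_V by (intro sum_ennreal[symmetric]) (auto simp: less_imp_le)
  also have "\<dots> \<le> D_p G r p \<nu> g"
    unfolding D_p_def using finite_layers layers_V by (intro sum_le_infsum_ennreal) auto
  finally show ?thesis .
qed

lemma SS_scale:
  assumes "0 \<le> a" "\<And>j. j \<in> V \<Longrightarrow> 0 \<le> f j" "i \<in> V"
  shows "SS (\<lambda>j. a * f j) i = ennreal (a powr (p - 1)) * SS f i"
proof -
  have "SS (\<lambda>j. a * f j) i = (\<Sum>\<^sub>\<infinity>j\<in>desc i. ennreal (a powr (p - 1)) * ennreal (\<mu> j * f j powr (p - 1)))"
    unfolding subtree_sum_def
  proof (rule infsum_cong)
    fix j assume "j \<in> desc i"
    then have "j \<in> V" using sub_subset[OF assms(3)] by blast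
    then show "ennreal (\<mu> j * (a * f j) powr (p - 1)) = ennreal (a powr (p - 1)) * ennreal (\<mu> j * f j powr (p - 1))"
      using assms(1,2) by (simp add: powr_mult mult_ac flip: ennreal_mult')
  qed
  then show ?thesis by (simp add: infsum_cmult_ennreal subtree_sum_def)
qed

text \<open>
  An eigenpair of the tree truncated at level \<open>n\<close>, where the vertices at level \<open>n\<close> carry the mass of
  their whole subtree. The eigenfunction is extended to be constant beyond level \<open>n\<close>, so that it
  satisfies the summed eigenvalue equation on the original tree, and it is normalised at the child
  of the root. The last clause is the minimality of the eigenvalue.
\<close>

definition truncated_eigenpair :: "nat \<Rightarrow> real \<Rightarrow> ('v \<Rightarrow> real) \<Rightarrow> bool" where
  "truncated_eigenpair n l f \<longleftrightarrow> 0 < l \<and> f stem = 1 \<and> (\<forall>i. i \<notin> V \<longrightarrow> f i = 0) \<and> (\<forall>i\<in>V. 0 < f i)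
    \<and> (\<forall>i\<in>V. f (par i) \<le> f i) \<and> (\<forall>i\<in>layers n. f (par i) < f i)
    \<and> (\<forall>i\<in>pverts G. n + 1 \<le> lev i \<longrightarrow> f i = f (par i))
    \<and> (\<forall>i\<in>layers n. ennreal (\<nu> i * (f i - f (par i)) powr (p - 1)) = ennreal l * SS f i)
    \<and> (\<forall>g. g r = 0 \<longrightarrow> ennreal l * mu_p G p \<mu> (\<lambda>j. g (anc n j)) \<le> D_p G r p \<nu> g)"

lemma truncated_eigenpair_exists:
  assumes n: "1 \<le> n"
  shows "\<exists>l f. truncated_eigenpair n l f"
proof -
  define B where "B i = {k \<in> layers n. i \<in> rpath k}" for i
  have V: "k \<in> V" "k \<in> pverts G" if "k \<in> layers n" for k using that by (auto simp: layers_def)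
  have lpar: "par k \<in> layers n \<or> par k = r" if "k \<in> layers n" for k
    using parent_in[OF V(1)[OF that]] level_parent[OF V(1)[OF that]] that by (auto simp: layers_def)
  have B1: "B i \<subseteq> layers n" for i by (auto simp: B_def)
  have B2: "i \<in> B i" if "i \<in> layers n" for i using that self_in_path[OF V(1)[OF that]] by (simp add: B_def)
  have B3: "par i \<notin> B i" if "i \<in> layers n" for i
    using notin_path_parent[OF V(1)[OF that]] by (simp add: B_def)
  have B4: "j \<in> B i \<longleftrightarrow> par j \<in> B i" if "i \<in> layers n" "j \<in> layers n" "j \<noteq> i" for i j
    using that lpar[OF that(2)] path_step[OF V(1)[OF that(2)]] by (auto simp: B_def path_root)
  obtain f l where f: "\<And>i. 0 \<le> f i" "\<And>i. i \<notin> layers n \<Longrightarrow> f i = 0" "0 \<le> l"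
    "(\<Sum>k\<in>layers n. tmass n k * f k powr p) = 1"
    and ray: "\<And>g. \<forall>i. i \<notin> layers n \<longrightarrow> g i = 0 \<Longrightarrow>
       l * (\<Sum>k\<in>layers n. tmass n k * \<bar>g k\<bar> powr p) \<le> (\<Sum>k\<in>layers n. \<nu> k * \<bar>g k - g (par k)\<bar> powr p)"
    and mono: "\<And>i. i \<in> layers n \<Longrightarrow> f (par i) \<le> f i"
    and EL: "\<And>i. i \<in> layers n \<Longrightarrow> \<nu> i * (f i - f (par i)) powr (p - 1) = l * (\<Sum>k\<in>B i. tmass n k * f k powr (p - 1))"
  proof (rule finite_eigenfunction[of "layers n" p \<nu> "tmass n" B par])
    show "layers n \<noteq> {}" using stem_in_layers[OF n] by auto
    show "0 < \<nu> i" if "i \<in> layers n" for i using nu_pos[OF V(2)[OF that]] .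
    show "0 < tmass n i" if "i \<in> layers n" for i using tmass_pos[OF that] .
    show "B i \<subseteq> layers n" for i by (rule B1)
    show "i \<in> B i" if "i \<in> layers n" for i by (rule B2[OF that])
    show "par i \<notin> B i" if "i \<in> layers n" for i by (rule B3[OF that])
    show "j \<in> B i \<longleftrightarrow> par j \<in> B i" if "i \<in> layers n" "j \<in> layers n" "j \<noteq> i" for i j
      by (rule B4[OF that])
  qed (rule finite_layers p_gt_1 that; assumption?)+
  define F where "F j = f (anc n j)" for j
  have fr: "f r = 0" by (rule f(2)) (simp add: layers_def)
  have Fr: "F r = 0" by (simp add: F_def anc_root fr)
  have F_low: "F i = f i" "F (par i) = f (par i)" if "i \<in> layers n" for i
    using that by (simp_all add: F_def layers_def anc_low anc_parent)
  have F_high: "F i = F (par i)" if "i \<in> V" "i \<notin> layers n" for i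
    using that by (simp add: F_def layers_def anc_high)
  have Fmono: "F (par i) \<le> F i" if "i \<in> V" for i
    using F_low mono F_high[OF that] by (cases "i \<in> layers n") auto
  have EF: "ennreal (\<nu> i * (F i - F (par i)) powr (p - 1)) = ennreal l * SS F i" if i: "i \<in> layers n" for i
  proof -
    have "SS F i = ennreal (\<Sum>k\<in>B i. tmass n k * f k powr (p - 1))"
      unfolding F_def B_def by (rule SS_anc[OF n i])
    then show ?thesis
      using F_low[OF i] EL[OF i] f(3) by (simp add: ennreal_mult')
  qed
  obtain k where k: "k \<in> layers n" "0 < f k"
  proof (rule ccontr)
    assume "\<not> thesis"
    then have "f k = 0" if "k \<in> layers n" for k using that f(1)[of k] \<open>\<And>k. k \<in> layers n \<Longrightarrow> 0 < f k \<Longrightarrow> thesis\<close> by force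
    then show False using f(4) by simp
  qed
  \<comment> \<open>With eigenvalue \<open>0\<close> all increments would vanish, and with them the function.\<close>
  have l: "0 < l"
  proof (rule ccontr)
    assume "\<not> 0 < l"
    then have "l = 0" using f(3) by simp
    then have "F i - F (par i) = 0" if "i \<in> V" for i
      using EL[of i] F_low[of i] F_high[OF that] nu_pos[of i] that by (cases "i \<in> layers n") auto
    then have "(\<Sum>i\<in>rpath k. F i - F (par i)) = 0"
      using path_subset[OF V(2)[OF k(1)]] by (intro sum.neutral) blast
    then have "F k = 0" using path_telescope[OF V(2)[OF k(1)], of F] Fr by simp
    then show False using k F_low by simp
  qed
  have "0 < SS F stem"
    using k V[OF k(1)] F_low[OF k(1)] by (intro SS_pos[OF stem_in, of k]) (auto simp: sub_stem)
  then have "ennreal (\<nu> stem * (F stem - F (par stem)) powr (p - 1)) \<noteq> 0"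
    using EF[OF stem_in_layers[OF n]] l by simp
  then have "F stem \<noteq> 0" using Fr parent_stem by auto
  then have Fstem: "0 < F stem" using Fmono[OF stem_in] Fr parent_stem by simp
  have Fpos: "0 < F i" if "i \<in> V" for i
  proof -
    have "i \<in> pverts G" using that by simp
    then have "i \<noteq> r \<longrightarrow> F stem \<le> F i"
    proof (induction rule: tree_induct)
      case (parent i)
      then show ?case using Fmono[of i] parent_eq_root[of i] by (cases "i = stem") auto
    qed simp
    then show ?thesis using Fstem that by auto
  qed
  \<comment> \<open>The minimiser comes with mass \<open>1\<close>; it is rescaled to have the value \<open>1\<close> at \<open>stem\<close>.\<close>
  define a where "a = 1 / F stem"
  have a: "0 < a" using Fstem by (simp add: a_def)
  define h where "h i = (if i \<in> V then a * F i else 0)" for i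
  have hF: "h i = a * F i" if "i \<in> pverts G" for i using that Fr by (auto simp: h_def)
  have hS: "SS h i = ennreal (a powr (p - 1)) * SS F i" if i: "i \<in> V" for i
  proof -
    have "SS h i = SS (\<lambda>j. a * F j) i" using i by (intro SS_cong) (auto simp: h_def)
    then show ?thesis using SS_scale[of a F i] a Fpos i by (simp add: less_imp_le)
  qed
  have strict: "F (par i) < F i" if i: "i \<in> layers n" for i
  proof -
    have "0 < SS F i" using Fpos V[OF i] by (intro SS_pos_self) auto
    then have "ennreal (\<nu> i * (F i - F (par i)) powr (p - 1)) \<noteq> 0" using EF[OF i] l by simp
    then have "F i \<noteq> F (par i)" by auto
    then show ?thesis using Fmono[OF V(1)[OF i]] by simp
  qed
  have "truncated_eigenpair n l h"
    unfolding truncated_eigenpair_def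
  proof (intro conjI ballI allI impI)
    show "h stem = 1" using Fstem stem_in by (simp add: h_def a_def)
    show "h (par i) < h i" if i: "i \<in> layers n" for i
      using strict[OF i] a hF[OF V(2)[OF i]] hF[OF parent_in[OF V(1)[OF i]]] by simp
    show "h (par i) \<le> h i" if i: "i \<in> V" for i
      using Fmono[OF i] a hF[of i] hF[OF parent_in[OF i]] i by simp
    show "h i = h (par i)" if "i \<in> pverts G" "n + 1 \<le> lev i" for i
    proof -
      have i: "i \<in> V" "i \<notin> layers n" using that level_eq_0[of i] by (auto simp: layers_def)
      then show ?thesis using F_high[OF i] hF[of i] hF[OF parent_in[OF i(1)]] by simp
    qed
    show "ennreal (\<nu> i * (h i - h (par i)) powr (p - 1)) = ennreal l * SS h i" if i: "i \<in> layers n" for i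
    proof -
      have "h i - h (par i) = a * (F i - F (par i))"
        using hF[OF V(2)[OF i]] hF[OF parent_in[OF V(1)[OF i]]] by (simp add: right_diff_distrib)
      then have eq: "\<nu> i * (h i - h (par i)) powr (p - 1) = a powr (p - 1) * (\<nu> i * (F i - F (par i)) powr (p - 1))"
        using a strict[OF i] by (simp add: powr_mult mult_ac)
      have "ennreal (\<nu> i * (h i - h (par i)) powr (p - 1)) = ennreal (a powr (p - 1)) * (ennreal l * SS F i)"
        unfolding EF[OF i, symmetric] eq by (rule ennreal_mult') simp
      then show ?thesis unfolding hS[OF V(1)[OF i]] by (simp only: mult_ac)
    qed
    show "ennreal l * mu_p G p \<mu> (\<lambda>j. g (anc n j)) \<le> D_p G r p \<nu> g" if g: "g r = 0" for g
    proof -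
      define g' where "g' i = (if i \<in> layers n then g i else 0)" for i
      have g': "g' k = g k" "g' (par k) = g (par k)" if "k \<in> layers n" for k
        using that lpar[OF that] g by (auto simp: g'_def)
      have "l * (\<Sum>k\<in>layers n. tmass n k * \<bar>g k\<bar> powr p) = l * (\<Sum>k\<in>layers n. tmass n k * \<bar>g' k\<bar> powr p)"
        using g' by simp
      also have "\<dots> \<le> (\<Sum>k\<in>layers n. \<nu> k * \<bar>g' k - g' (par k)\<bar> powr p)"
        by (rule ray) (simp add: g'_def)
      also have "\<dots> = (\<Sum>k\<in>layers n. \<nu> k * \<bar>g k - g (par k)\<bar> powr p)" using g' by simp
      finally have "ennreal (l * (\<Sum>k\<in>layers n. tmass n k * \<bar>g k\<bar> powr p)) \<le> D_p G r p \<nu> g"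
        using layers_energy_le order_trans ennreal_leI by blast
      then show ?thesis unfolding mu_p_anc[of n g, OF n g] using l by (simp add: ennreal_mult')
    qed
  qed (use l a Fpos in \<open>auto simp: h_def\<close>)
  then show ?thesis by blast
qed

end

section \<open>Upper bounds\<close>

context weighted_tree
begin

text \<open>
  If the flow of the test function \<open>H\<close> is at most the subtree sums of \<open>f\<close>, summation by parts bounds its
  energy by the sum of \<open>\<mu> j * f j powr (p - 1) * H j\<close>.
\<close>

lemma upper_bound_test:
  fixes f H :: "'v \<Rightarrow> real"
  assumes H: "H r = 0" "\<And>i. i \<in> V \<Longrightarrow> 0 \<le> H i" "\<And>i. i \<in> V \<Longrightarrow> H (par i) \<le> H i"
    and flow: "\<And>i. i \<in> V \<Longrightarrow> ennreal (\<nu> i * (H i - H (par i)) powr p) \<le> ennreal (H i - H (par i)) * SS f i"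
    and S: "\<And>j. j \<in> V \<Longrightarrow> ennreal (f j powr (p - 1)) \<le> S * ennreal (H j powr (p - 1))"
    and mu: "0 < mu_p G p \<mu> H" "mu_p G p \<mu> H < \<infinity>"
  shows "lam \<le> S"
proof -
  have "lam * mu_p G p \<mu> H \<le> D_p G r p \<nu> H" by (rule lambda_mult_le[of H, OF H(1) mu(2)])
  also have "\<dots> \<le> (\<Sum>\<^sub>\<infinity>i\<in>V. ennreal (H i - H (par i)) * SS f i)"
    unfolding D_p_def
  proof (rule infsum_mono_ennreal)
    fix i assume i: "i \<in> V"
    show "ennreal (\<nu> i * \<bar>H i - H (par i)\<bar> powr p) \<le> ennreal (H i - H (par i)) * SS f i"
      using flow[OF i] H(3)[OF i] by simp
  qed
  also have "\<dots> = (\<Sum>\<^sub>\<infinity>j\<in>V. ennreal (\<mu> j * f j powr (p - 1)) * (\<Sum>k\<in>rpath j. ennreal (H k - H (par k))))"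
    unfolding path_sub_swap subtree_sum_def ..
  also have "\<dots> \<le> (\<Sum>\<^sub>\<infinity>j\<in>V. S * ennreal (\<mu> j * \<bar>H j\<bar> powr p))"
  proof (rule infsum_mono_ennreal)
    fix j assume j: "j \<in> V"
    then have jG: "j \<in> pverts G" by simp
    have mu: "0 \<le> \<mu> j" using mu_pos[OF jG] by simp
    have "(\<Sum>k\<in>rpath j. ennreal (H k - H (par k))) = ennreal (\<Sum>k\<in>rpath j. H k - H (par k))"
      using path_subset[OF jG] H(3) by (intro sum_ennreal) (simp add: subset_eq)
    also have "\<dots> = ennreal (H j)" using path_telescope[OF jG, of H] H(1) by simp
    finally have s: "(\<Sum>k\<in>rpath j. ennreal (H k - H (par k))) = ennreal (H j)" .
    have "ennreal (\<mu> j * f j powr (p - 1)) * ennreal (H j) = ennreal (f j powr (p - 1)) * ennreal (\<mu> j * H j)"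
      using mu H(2)[OF j] by (simp add: mult_ac flip: ennreal_mult)
    also have "\<dots> \<le> S * ennreal (H j powr (p - 1)) * ennreal (\<mu> j * H j)"
      by (rule mult_right_mono[OF S[OF j]]) simp
    also have "\<dots> = S * (ennreal (H j powr (p - 1)) * ennreal (\<mu> j * H j))" by (simp only: mult_ac)
    also have "ennreal (H j powr (p - 1)) * ennreal (\<mu> j * H j) = ennreal (\<mu> j * (H j * H j powr (p - 1)))"
      using mu H(2)[OF j] by (simp add: mult_ac flip: ennreal_mult)
    also have "H j * H j powr (p - 1) = \<bar>H j\<bar> powr p"
      using H(2)[OF j] powr_mult_powr_minus_1[of "H j" p] by simp
    finally show "ennreal (\<mu> j * f j powr (p - 1)) * (\<Sum>k\<in>rpath j. ennreal (H k - H (par k)))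
        \<le> S * ennreal (\<mu> j * \<bar>H j\<bar> powr p)" unfolding s .
  qed
  also have "\<dots> = S * mu_p G p \<mu> H" unfolding infsum_cmult_ennreal mu_p_V[of H, OF H(1)] ..
  finally have "lam \<le> S * mu_p G p \<mu> H / mu_p G p \<mu> H"
    using mu by (intro mult_le_imp_le_divide_ennreal) auto
  also have "\<dots> = S" using mu by (intro ennreal_mult_divide_eq) auto
  finally show ?thesis .
qed

lemma finite_range_bound:
  assumes "\<And>i. i \<in> pverts G \<Longrightarrow> n + 1 \<le> lev i \<Longrightarrow> f i = f (par i)"
  obtains C :: real where "\<And>j. j \<in> V \<Longrightarrow> f j \<le> C"
proof -
  define A where "A = {i \<in> pverts G. lev i \<le> n}"
  have A: "finite A" unfolding A_def by (rule finite_level_le)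
  have "f j \<le> Max (f ` A)" if j: "j \<in> pverts G" for j
  proof -
    have "\<exists>i\<in>A. f j = f i"
      using j
    proof (induction rule: tree_induct)
      case root
      then show ?case using root_in_verts by (auto simp: A_def)
    next
      case (parent i)
      then show ?case using assms[of i] by (cases "lev i \<le> n") (auto simp: A_def)
    qed
    then show ?thesis using A by (auto intro!: Max_ge)
  qed
  then show ?thesis by (intro that[of "Max (f ` A)"]) simp
qed

text \<open>
  The test function is \<open>pot f\<close>, whose flow is the subtree sum of \<open>f\<close>. In the case of \<open>F_II_tilde'\<close> it has finite mass by
  assumption. Otherwise it is truncated at the level beyond which \<open>f\<close> is constant; then its flow vanishes
  beyond that level, and the bound for \<open>f\<close> at a deep vertex is the bound at its ancestor.
\<close>

lemma upper_bound_II: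
  assumes f: "f \<in> F_II_tilde' G r p \<nu> \<mu> \<union> F_II_tilde G r"
  shows "lam \<le> (SUP i\<in>V. inverse (II_op G r p \<nu> \<mu> f i))"
proof -
  define S where "S = (SUP i\<in>V. inverse (II_op G r p \<nu> \<mu> f i))"
  have f0: "0 \<le> f i" if "i \<in> V" for i using f that by (auto simp: F_II_tilde'_def F_II_tilde_def)
  obtain j where j: "j \<in> V" "0 < f j"
  proof -
    obtain j where "j \<in> pverts G" "f j \<noteq> 0" "f r = 0" using f by (auto simp: F_II_tilde'_def F_II_tilde_def)
    then have "j \<in> V" by auto
    then show ?thesis using f0[of j] \<open>f j \<noteq> 0\<close> that by simp
  qed
  have SSp: "0 < SS f stem" using j by (intro SS_pos[OF stem_in, of j]) (auto simp: sub_stem)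
  have S: "ennreal (f i powr (p - 1)) \<le> S * ennreal (pot f i powr (p - 1))" if fin: "SS f stem < \<infinity>" and i: "i \<in> V" for i
  proof -
    have g: "0 < pot f i" by (rule pot_pos[OF fin SSp i])
    have "ennreal ((f i / pot f i) powr (p - 1)) \<le> S"
      unfolding S_def inverse_II_pot[OF fin SSp i f0[OF i], symmetric] by (rule SUP_upper[OF i])
    then have "ennreal ((f i / pot f i) powr (p - 1)) * ennreal (pot f i powr (p - 1)) \<le> S * ennreal (pot f i powr (p - 1))"
      by (rule mult_right_mono) simp
    moreover have "(f i / pot f i) powr (p - 1) * pot f i powr (p - 1) = f i powr (p - 1)"
      using g f0[OF i] by (simp add: powr_divide)
    ultimately show ?thesis by (simp flip: ennreal_mult)
  qed
  have flow: "ennreal (\<nu> i * (pot f i - pot f (par i)) powr p) = ennreal (pot f i - pot f (par i)) * SS f i"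
    if fin: "SS f stem < \<infinity>" and i: "i \<in> V" for i
  proof -
    have d: "0 \<le> pot f i - pot f (par i)" using pot_mono[OF fin i] by simp
    have "\<nu> i * (pot f i - pot f (par i)) powr p = (pot f i - pot f (par i)) * (\<nu> i * (pot f i - pot f (par i)) powr (p - 1))"
      using powr_mult_powr_minus_1[OF d, of p] by (simp add: mult_ac)
    then show ?thesis
      unfolding pot_flow[OF fin i] SS_ss[OF fin i] using d ss_nonneg by (simp add: ennreal_mult)
  qed
  have mass: "0 < mu_p G p \<mu> H" if "0 < H stem" for H
  proof -
    have "0 < ennreal (\<mu> stem * \<bar>H stem\<bar> powr p)" using that mu_pos[of stem] stem_in by simp
    also have "\<dots> \<le> mu_p G p \<mu> H"
      unfolding mu_p_def
      using sum_le_infsum_ennreal[of "{stem}" "pverts G" "\<lambda>k. ennreal (\<mu> k * \<bar>H k\<bar> powr p)"] stem_in by simp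
    finally show ?thesis .
  qed
  show ?thesis unfolding S_def[symmetric]
  proof (cases "f \<in> F_II_tilde' G r p \<nu> \<mu>")
    case True
    then have L: "(\<Sum>\<^sub>\<infinity>i\<in>pverts G. ennreal (\<mu> i) * ennpowr (PS f i) p) < \<infinity>" by (simp add: F_II_tilde'_def)
    have "ennreal (\<mu> stem) * ennpowr (PS f stem) p \<le> (\<Sum>\<^sub>\<infinity>i\<in>pverts G. ennreal (\<mu> i) * ennpowr (PS f i) p)"
      using sum_le_infsum_ennreal[of "{stem}" "pverts G" "\<lambda>i. ennreal (\<mu> i) * ennpowr (PS f i) p"] stem_in by simp
    also note L
    finally have "ennpowr (PS f stem) p < \<infinity>"
      using mu_pos[of stem] stem_in by (auto simp: ennreal_mult_less_top)
    then have "PS f stem < \<infinity>" by (auto simp: ennpowr_def less_top[symmetric] split: if_splits)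
    then have fin: "SS f stem < \<infinity>" by (rule PS_finite_imp[OF stem_in])
    have "mu_p G p \<mu> (pot f) = (\<Sum>\<^sub>\<infinity>i\<in>pverts G. ennreal (\<mu> i) * ennpowr (PS f i) p)"
      unfolding mu_p_def
      using PS_pot[OF fin] pot_nonneg[OF fin] mu_pos by (intro infsum_cong) (simp add: ennpowr_ennreal ennreal_mult less_imp_le)
    then have "mu_p G p \<mu> (pot f) < \<infinity>" using L by simp
    then show "lam \<le> S"
      using pot_root pot_nonneg[OF fin] pot_mono[OF fin] flow[OF fin] S[OF fin] mass[of "pot f"] pot_pos[OF fin SSp stem_in]
      by (intro upper_bound_test[of "pot f" f S]) auto
  next
    case False
    then have "f \<in> F_II_tilde G r" using f by simp
    then obtain n where n: "1 \<le> n" "\<And>i. i \<in> pverts G \<Longrightarrow> n + 1 \<le> lev i \<Longrightarrow> f i = f (par i)"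
      by (auto simp: F_II_tilde_def)
    obtain C where C: "\<And>j. j \<in> V \<Longrightarrow> f j \<le> C" using finite_range_bound[of n f] n(2) by blast
    have fin: "SS f stem < \<infinity>" by (rule SS_finite[of f C]) (use f0 C in auto)
    define H where "H i = pot f (anc n i)" for i
    have Hs: "H stem = pot f stem" using n(1) by (simp add: H_def anc_low level_stem)
    have Hr: "H r = 0" by (simp add: H_def anc_root pot_root)
    have H_low: "H i = pot f i" "H (par i) = pot f (par i)" if "i \<in> layers n" for i
      using that by (simp_all add: H_def layers_def anc_low anc_parent)
    have H_high: "H i = H (par i)" if "i \<in> V" "i \<notin> layers n" for i
      using that by (simp add: H_def layers_def anc_high)
    show "lam \<le> S"
    proof (rule upper_bound_test[of H f S])
      fix i assume i: "i \<in> V"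
      show "0 \<le> H i" using pot_nonneg[OF fin] by (simp add: H_def)
      show "H (par i) \<le> H i"
        using pot_mono[OF fin i] H_low[of i] H_high[OF i] by (cases "i \<in> layers n") simp_all
      show "ennreal (\<nu> i * (H i - H (par i)) powr p) \<le> ennreal (H i - H (par i)) * SS f i"
        using flow[OF fin i] H_low[of i] H_high[OF i] by (cases "i \<in> layers n") simp_all
      have "f (anc n i) = f i" using n(2) i by (intro constant_beyond[of n f]) auto
      then show "ennreal (f i powr (p - 1)) \<le> S * ennreal (H i powr (p - 1))"
        using S[OF fin, of "anc n i"] anc_in_layers[OF n(1) i] layers_V by (auto simp: H_def)
    next
      show "mu_p G p \<mu> H < \<infinity>"
        unfolding H_def mu_p_anc[of n "pot f", OF n(1) pot_root] by simp
      show "0 < mu_p G p \<mu> H" using pot_pos[OF fin SSp stem_in] Hs by (intro mass) simp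
    qed (rule Hr)
  qed
qed

lemma F_I_tilde_subset: "F_I_tilde G r \<subseteq> F_II_tilde G r"
proof
  fix f assume f: "f \<in> F_I_tilde G r"
  then obtain n where n: "1 \<le> n" "\<forall>i\<in>pverts G. 1 \<le> lev i \<and> lev i \<le> n \<longrightarrow> f (par i) < f i"
    by (auto simp: F_I_tilde_def)
  have "f r = 0" using f by (simp add: F_I_tilde_def)
  then have "0 < f stem" using n stem_in level_stem parent_stem by auto
  then have "\<exists>i\<in>pverts G. f i \<noteq> 0" using stem_in by force
  then show "f \<in> F_II_tilde G r" using f by (auto simp: F_I_tilde_def F_II_tilde_def)
qed

lemma F_I_tildeD:
  assumes "f \<in> F_I_tilde G r"
  obtains n where "1 \<le> n" "f r = 0" "0 < f stem" "\<And>i. i \<in> V \<Longrightarrow> f (par i) \<le> f i" "\<And>i. i \<in> V \<Longrightarrow> 0 < f i"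
    "\<And>i. i \<in> pverts G \<Longrightarrow> n + 1 \<le> lev i \<Longrightarrow> f i = f (par i)" "SS f stem < \<infinity>"
proof -
  obtain n where n: "1 \<le> n" "\<forall>i\<in>pverts G. 1 \<le> lev i \<and> lev i \<le> n \<longrightarrow> f (par i) < f i"
    "\<forall>i\<in>pverts G. n + 1 \<le> lev i \<longrightarrow> f i = f (par i)"
    using assms by (auto simp: F_I_tilde_def)
  have r: "f r = 0" using assms by (simp add: F_I_tilde_def)
  have s: "0 < f stem" using n stem_in level_stem parent_stem r by auto
  have m: "f (par i) \<le> f i" if "i \<in> V" for i
    using n(2,3) that level_ge_1[OF that] by (cases "lev i \<le> n") (auto simp: less_imp_le)
  have pos: "0 < f i" if "i \<in> V" for i using increasing_imp_pos[of f i] r m s that by blast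
  obtain C where C: "\<And>j. j \<in> V \<Longrightarrow> f j \<le> C" using finite_range_bound[of n f] n(3) by blast
  have "SS f stem < \<infinity>" using pos C by (intro SS_finite[of f C]) (auto simp: less_imp_le)
  then show ?thesis using n r s m pos by (intro that[of n]) auto
qed

text \<open>
  The counterpart of \<open>pot_le\<close>, with both inequalities reversed.
\<close>

lemma pot_ge:
  assumes c: "0 \<le> c" and fin: "SS f stem < \<infinity>" and i: "i \<in> pverts G" and "f r = 0"
    and mono: "\<And>k. k \<in> V \<Longrightarrow> f (par k) \<le> f k"
    and le: "\<And>k. k \<in> V \<Longrightarrow> \<nu> k * (f k - f (par k)) powr (p - 1) \<le> c * ss f k"
  shows "f i \<le> c powr (1 / (p - 1)) * pot f i"
proof -
  have "f k - f (par k) \<le> c powr (1 / (p - 1)) * (pot f k - pot f (par k))" if k: "k \<in> V" for k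
  proof -
    have nu: "0 < \<nu> k" using k nu_pos by simp
    have "f k - f (par k) = ((f k - f (par k)) powr (p - 1)) powr (1 / (p - 1))"
      using mono[OF k] p_gt_1 by (intro powr_inverse_exponent[symmetric]) auto
    also have "\<dots> \<le> (c * (ss f k / \<nu> k)) powr (1 / (p - 1))"
      using le[OF k] nu p_gt_1 by (intro powr_mono2) (auto simp: field_simps)
    also have "\<dots> = c powr (1 / (p - 1)) * (pot f k - pot f (par k))"
      unfolding pot_diff[OF fin k] using nu c ss_nonneg[of f k] by (subst powr_mult) auto
    finally show ?thesis .
  qed
  then have "(\<Sum>k\<in>rpath i. f k - f (par k)) \<le> (\<Sum>k\<in>rpath i. c powr (1 / (p - 1)) * (pot f k - pot f (par k)))"
    using path_subset[OF i] by (intro sum_mono) auto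
  then show ?thesis
    by (simp add: path_telescope[OF i] pot_root \<open>f r = 0\<close> flip: sum_distrib_left)
qed

lemma upper_II_le_I:
  assumes f: "f \<in> F_I_tilde G r"
  shows "(SUP i\<in>V. inverse (II_op G r p \<nu> \<mu> f i)) \<le> (SUP i\<in>V. inverse (I_op G r p \<nu> \<mu> f i))"
proof (rule SUP_least)
  fix i assume i: "i \<in> V"
  define S where "S = (SUP i\<in>V. inverse (I_op G r p \<nu> \<mu> f i))"
  obtain n where fr: "f r = 0" and mono: "\<And>i. i \<in> V \<Longrightarrow> f (par i) \<le> f i" and pos: "\<And>i. i \<in> V \<Longrightarrow> 0 < f i"
    and fin: "SS f stem < \<infinity>"
    using F_I_tildeD[OF f] by metis
  have SSp: "0 < SS f i" if "i \<in> V" for i using SS_pos_self[of i f] pos that by blast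
  show "inverse (II_op G r p \<nu> \<mu> f i) \<le> S"
  proof (cases "S = \<infinity>")
    case False
    define s where "s = enn2real S"
    have s: "S = ennreal s" "0 \<le> s" using False by (simp_all add: s_def less_top[symmetric])
    have le: "\<nu> k * (f k - f (par k)) powr (p - 1) \<le> s * ss f k" if k: "k \<in> V" for k
    proof -
      have ss: "0 < ss f k" using SSp[OF k] SS_ss[OF fin k] by simp
      have nu: "0 < \<nu> k" using k nu_pos by simp
      have "ennreal (\<nu> k * (f k - f (par k)) powr (p - 1)) / ennreal (ss f k) \<le> ennreal s"
        unfolding s(1)[symmetric] S_def SS_ss[OF fin k, symmetric]
        using inverse_I[of f k] SSp[OF k] SUP_upper[OF k, of "\<lambda>i. inverse (I_op G r p \<nu> \<mu> f i)"] by simp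
      then have "\<nu> k * (f k - f (par k)) powr (p - 1) / ss f k \<le> s"
        using ss s(2) nu by (simp add: divide_ennreal)
      then show ?thesis using ss by (simp add: field_simps)
    qed
    have g: "0 < pot f i" by (rule pot_pos[OF fin SSp[OF stem_in] i])
    have "f i \<le> s powr (1 / (p - 1)) * pot f i"
      using i by (intro pot_ge s(2) fin fr mono le) auto
    then have "f i / pot f i \<le> s powr (1 / (p - 1))" using g by (simp add: field_simps)
    then have "(f i / pot f i) powr (p - 1) \<le> (s powr (1 / (p - 1))) powr (p - 1)"
      using p_gt_1 pos[OF i] g by (intro powr_mono2) auto
    also have "\<dots> = s" using s(2) p_gt_1 by (intro powr_inverse_exponent) auto
    finally show ?thesis
      using inverse_II_pot[OF fin SSp[OF stem_in] i] pos[OF i] s by (simp add: ennreal_leI)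
  qed simp
qed

subsection \<open>The difference form on a truncated tree\<close>

text \<open>
  The factors in \<open>R_tilde\<close> are the masses of the truncated tree.
\<close>

lemma R_tilde_mass:
  assumes m: "1 \<le> m" and i: "i \<in> layers m"
  shows "(if lev i = m then \<Sum>\<^sub>\<infinity>j\<in>desc i. \<mu> j else \<mu> i) = tmass m i"
proof (cases "lev i = m")
  case True
  have "{j \<in> V. anc m j = i} = desc i"
  proof (intro set_eqI iffI)
    fix j assume j: "j \<in> {j \<in> V. anc m j = i}"
    then have "i \<in> rpath j" using path_anc[OF m, of j i] self_in_path[of i] layers_V[OF i] True by auto
    then show "j \<in> desc i" using j layers_V[OF i] by (simp add: sub_eq)
  next
    fix j assume "j \<in> desc i"
    then have j: "j \<in> V" "i \<in> rpath j" using layers_V[OF i] by (auto simp: sub_eq)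
    then have p: "i \<in> rpath (anc m j)" using path_anc[OF m j(1), of i] True by simp
    have a: "anc m j \<in> V" using anc_in_layers[OF m j(1)] layers_V by blast
    have "lev (anc m j) \<le> lev i" using anc_in_layers[OF m j(1)] True by (simp add: layers_def)
    then have "i = anc m j"
      using p path_step[OF a] level_in_path[OF parent_in[OF a], of i] level_parent[OF a] by auto
    then show "j \<in> {j \<in> V. anc m j = i}" using j by simp
  qed
  then show ?thesis using True by (simp add: tmass_def)
next
  case False
  then have "lev i < m" using i by (simp add: layers_def)
  then have "anc m j = i \<longleftrightarrow> j = i" if "j \<in> V" for j
    using level_anc[OF m that] anc_low[of j m] by (cases "lev j \<le> m") auto
  then have "{j \<in> V. anc m j = i} = {i}" using layers_V[OF i] by auto
  then show ?thesis using False by (simp add: tmass_def)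
qed

lemma ss_layers_step:
  assumes m: "1 \<le> m" and i: "i \<in> layers m" and fin: "SS f stem < \<infinity>"
    and const: "\<And>j. j \<in> pverts G \<Longrightarrow> m + 1 \<le> lev j \<Longrightarrow> f j = f (par j)"
  shows "ss f i = tmass m i * f i powr (p - 1) + (if lev i < m then \<Sum>j\<in>children G r i. ss f j else 0)"
proof (cases "lev i < m")
  case True
  then show ?thesis using R_tilde_mass[OF m i] ss_step[OF fin layers_V[OF i]] by simp
next
  case False
  then have l: "lev i = m" using i by (simp add: layers_def)
  have "SS f i = SS (\<lambda>j. f (anc m j)) i"
    using constant_beyond[of m f] const layers_V[OF i] by (intro SS_cong) auto
  also have "\<dots> = ennreal (\<Sum>k\<in>{k \<in> layers m. i \<in> rpath k}. tmass m k * f k powr (p - 1))"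
    by (rule SS_anc[OF m i])
  also have "{k \<in> layers m. i \<in> rpath k} = {i}"
  proof -
    have "k = i" if "k \<in> layers m" "i \<in> rpath k" for k
    proof -
      have k: "k \<in> V" "lev k \<le> lev i" using that l by (auto simp: layers_def)
      then show ?thesis
        using that(2) path_step[OF k(1)] level_in_path[OF parent_in[OF k(1)], of i] level_parent[OF k(1)] by auto
    qed
    then show ?thesis using i self_in_path[OF layers_V[OF i]] by auto
  qed
  finally have "ss f i = tmass m i * f i powr (p - 1)"
    using tmass_pos[OF i] by (simp add: ss_def)
  then show ?thesis using False by simp
qed

lemma level_children: "i \<in> V \<Longrightarrow> j \<in> children G r i \<Longrightarrow> j \<in> V \<and> par j = i \<and> lev j = Suc (lev i)"
  using level_parent[of j] by (auto simp: children_eq)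

text \<open>
  On a tree truncated at level \<open>m\<close>, an upper bound for the flow defect at each vertex adds up, from
  level \<open>m\<close> towards the root, to a bound of the flow by the subtree sums.
\<close>

lemma upper_I_le_R_tilde:
  assumes mw: "(m, w) \<in> W_tilde_pairs G r p \<nu>"
  shows "\<exists>f\<in>F_I_tilde G r. enn2ereal (SUP i\<in>V. inverse (I_op G r p \<nu> \<mu> f i))
    \<le> (SUP i\<in>V. ereal (R_tilde G r p \<nu> \<mu> m w i))"
proof -
  have m: "1 \<le> m" "enat m < max_level G r + 1" and w: "w \<in> W_tilde G r p \<nu> m"
    using mw by (auto simp: W_tilde_pairs_def)
  have wstem: "w stem = \<infinity>" and w1: "\<forall>i\<in>V - {stem}. \<bar>w i\<bar> \<noteq> \<infinity>"
    and w2: "\<forall>i\<in>pverts G. 1 \<le> lev i \<and> lev i \<le> m \<longrightarrow> 1 < w i \<and> child_term G r p \<nu> w i < own_term p \<nu> w i"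
    and w3: "\<forall>i\<in>pverts G. m + 1 \<le> lev i \<longrightarrow> w i = 1"
    using w by (simp_all add: W_tilde_def W_base_def children_root)
  have wl: "w i = ereal (real_of_ereal (w i)) \<and> 1 < real_of_ereal (w i)" if "i \<in> layers m" "i \<noteq> stem" for i
  proof -
    have "\<bar>w i\<bar> \<noteq> \<infinity>" "1 < w i"
      using bspec[OF w1, of i] bspec[OF w2, of i] that level_ge_1[of i] by (simp_all add: layers_def)
    then show ?thesis by (cases "w i") auto
  qed
  have wh: "w i = 1" if "i \<in> V" "i \<notin> layers m" for i
    using bspec[OF w3, of i] that by (simp add: layers_def)
  have w_real: "w i = ereal (real_of_ereal (w i)) \<and> 1 \<le> real_of_ereal (w i)" if "i \<in> V" "i \<noteq> stem" for i
    using wl[of i] wh[of i] that by (cases "i \<in> layers m") (auto simp: one_ereal_def)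
  define f where "f = ratio_prod w"
  have fr: "f r = 0" by (simp add: f_def ratio_prod_root)
  have f: "0 < f i \<and> f (par i) \<le> f i \<and> (i \<noteq> stem \<longrightarrow> real_of_ereal (w i) = f i / f (par i))" if "i \<in> V" for i
    unfolding f_def by (rule ratio_prod_mono[OF _ that]) (use w_real in blast)
  have f_par: "0 < f (par i)" if "i \<in> V" "i \<noteq> stem" for i
    using f[of "par i"] parent_in[OF that(1)] parent_eq_root[OF that(1)] that by simp
  have const: "f i = f (par i)" if "i \<in> pverts G" "m + 1 \<le> lev i" for i
  proof -
    have i: "i \<in> V" "i \<notin> layers m" "i \<noteq> stem"
      using that m level_eq_0[of i] level_stem by (auto simp: layers_def)
    then show ?thesis using f[OF i(1)] wh[OF i(1,2)] f_par[OF i(1,3)] by (simp add: field_simps)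
  qed
  have strict: "f (par i) < f i" if i: "i \<in> layers m" for i
  proof (cases "i = stem")
    case True
    then show ?thesis using f[OF stem_in] fr parent_stem by simp
  next
    case False
    then show ?thesis using f[OF layers_V[OF i]] wl[OF i False] f_par[OF layers_V[OF i] False] by simp
  qed
  have FI: "f \<in> F_I_tilde G r"
  proof -
    have "\<forall>i\<in>pverts G. 0 \<le> f i" using f fr by (metis DiffI less_imp_le order_refl singletonD)
    moreover have "i \<in> layers m" if "i \<in> pverts G" "1 \<le> lev i" "lev i \<le> m" for i
      using that level_root by (auto simp: layers_def)
    ultimately show ?thesis
      unfolding F_I_tilde_def using fr m strict const by (intro CollectI conjI exI[of _ m]) auto
  qed
  define S where "S = (SUP i\<in>V. ereal (R_tilde G r p \<nu> \<mu> m w i))"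
  have RS: "ereal (R_tilde G r p \<nu> \<mu> m w i) \<le> S" if "i \<in> V" for i
    unfolding S_def by (rule SUP_upper[OF that])
  obtain n where fin: "SS f stem < \<infinity>" using F_I_tildeD[OF FI] by metis
  have "enn2ereal (SUP i\<in>V. inverse (I_op G r p \<nu> \<mu> f i)) \<le> S"
  proof (cases "S = \<infinity>")
    case False
    have mass: "(if lev i = m then \<Sum>\<^sub>\<infinity>j\<in>desc i. \<mu> j else \<mu> i) = tmass m i" if "i \<in> layers m" for i
      by (rule R_tilde_mass[OF m(1) that])
    have "0 < R_tilde G r p \<nu> \<mu> m w stem"
      unfolding R_tilde_def mass[OF stem_in_layers[OF m(1)]]
      using tmass_pos[OF stem_in_layers[OF m(1)]] bspec[OF w2, of stem] stem_in level_stem m(1) by simp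
    then obtain s where s: "S = ereal s" "0 < s" using RS[OF stem_in] False by (cases S) auto
    define u where "u i = \<nu> i * (f i - f (par i)) powr (p - 1)" for i
    have wf: "w i = ereal (f i / f (par i))" if "i \<in> V" "i \<noteq> stem" for i
      using w_real[OF that] f[OF that(1)] that(2) by metis
    have f_pos: "0 < f i" and f_mono: "f (par i) \<le> f i" if "i \<in> V" for i using f[OF that] by simp_all
    have rf: "own_term p \<nu> w i * f i powr (p - 1) = u i"
        "child_term G r p \<nu> w i * f i powr (p - 1) = (\<Sum>j\<in>children G r i. u j)"
      if i: "i \<in> V" for i
      unfolding u_def
      by (rule ratio_flow[of f w i, OF fr f_pos f_mono wstem wf i]; assumption)+
    have step: "u i \<le> s * (tmass m i * f i powr (p - 1)) + (\<Sum>j\<in>children G r i. u j)" if i: "i \<in> layers m" for i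
    proof -
      have "R_tilde G r p \<nu> \<mu> m w i \<le> s" using RS[OF layers_V[OF i]] s by simp
      then have "own_term p \<nu> w i - child_term G r p \<nu> w i \<le> s * tmass m i"
        unfolding R_tilde_def mass[OF i] using tmass_pos[OF i] by (simp add: field_simps)
      then have "(own_term p \<nu> w i - child_term G r p \<nu> w i) * f i powr (p - 1) \<le> s * tmass m i * f i powr (p - 1)"
        by (rule mult_right_mono) simp
      then show ?thesis unfolding left_diff_distrib rf[OF layers_V[OF i]] by simp
    qed
    have u_high: "u j = 0" if "j \<in> V" "m < lev j" for j using const[of j] that by (simp add: u_def)
    have us: "u i \<le> s * ss f i" if "i \<in> layers m" for i
      using that
    proof (induction "m - lev i" arbitrary: i rule: less_induct)
      case less
      note i = less.prems
      have ssl: "ss f i = tmass m i * f i powr (p - 1) + (if lev i < m then \<Sum>j\<in>children G r i. ss f j else 0)"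
        using const by (intro ss_layers_step[OF m(1) i fin]) auto
      show ?case
      proof (cases "lev i < m")
        case True
        have "u j \<le> s * ss f j" if j: "j \<in> children G r i" for j
        proof (rule less.hyps)
          show "m - lev j < m - lev i" "j \<in> layers m"
            using level_children[OF layers_V[OF i] j] True by (auto simp: layers_def)
        qed
        then have "(\<Sum>j\<in>children G r i. u j) \<le> s * (\<Sum>j\<in>children G r i. ss f j)"
          unfolding sum_distrib_left by (rule sum_mono)
        then show ?thesis using step[OF i] ssl True by (simp add: distrib_left)
      next
        case False
        have "(\<Sum>j\<in>children G r i. u j) = 0"
          using level_children[OF layers_V[OF i]] i False by (intro sum.neutral ballI u_high) (auto simp: layers_def)
        then show ?thesis using step[OF i] ssl False by simp
      qed
    qed
    have "(SUP i\<in>V. inverse (I_op G r p \<nu> \<mu> f i)) \<le> ennreal s"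
    proof (rule SUP_least)
      fix i assume i: "i \<in> V"
      have SSp: "0 < SS f i" using f[OF i] i by (intro SS_pos_self) auto
      then have ss: "0 < ss f i" using SS_ss[OF fin i] by simp
      have u0: "0 \<le> u i" using nu_pos[of i] i by (simp add: u_def)
      have "u i \<le> s * ss f i"
        using us[of i] u_high[OF i] i s(2) ss by (cases "i \<in> layers m") (auto simp: layers_def)
      then have "u i / ss f i \<le> s" using ss by (simp add: field_simps)
      then have "ennreal (u i) / ennreal (ss f i) \<le> ennreal s"
        using ss u0 by (simp add: divide_ennreal ennreal_leI)
      then show "inverse (I_op G r p \<nu> \<mu> f i) \<le> ennreal s"
        using inverse_I[of f i] SSp SS_ss[OF fin i] by (simp add: u_def)
    qed
    then have "enn2ereal (SUP i\<in>V. inverse (I_op G r p \<nu> \<mu> f i)) \<le> enn2ereal (ennreal s)"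
      by (simp add: less_eq_ennreal.rep_eq)
    then show ?thesis using s by (simp add: enn2ereal_ennreal)
  qed simp
  then show ?thesis using FI unfolding S_def by blast
qed

text \<open>
  For an eigenfunction of the truncated tree, the flow defect at \<open>i\<close> is \<open>l\<close> times the difference of the
  subtree sums at \<open>i\<close> and at its children, which is the mass at \<open>i\<close> times \<open>f i powr (p - 1)\<close>. So the
  difference form is \<open>l\<close> up to level \<open>n\<close>, and \<open>0\<close> beyond.
\<close>

lemma R_tilde_eigenfunction:
  assumes n: "n \<in> depths" and pair: "truncated_eigenpair n l f"
  shows "\<exists>w. (n, w) \<in> W_tilde_pairs G r p \<nu> \<and> (SUP i\<in>V. ereal (R_tilde G r p \<nu> \<mu> n w i)) \<le> ereal l"
proof -
  have l: "0 < l" and f: "f r = 0" "\<And>i. i \<in> V \<Longrightarrow> 0 < f i" "\<And>i. i \<in> layers n \<Longrightarrow> f (par i) < f i"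
    "\<And>i. i \<in> pverts G \<Longrightarrow> n + 1 \<le> lev i \<Longrightarrow> f i = f (par i)"
    "\<And>i. i \<in> layers n \<Longrightarrow> ennreal (\<nu> i * (f i - f (par i)) powr (p - 1)) = ennreal l * SS f i"
    using pair by (simp_all add: truncated_eigenpair_def)
  have n1: "1 \<le> n" "enat n < max_level G r + 1" using n by (auto simp: depths_def)
  have f_par: "0 < f (par i)" if "i \<in> V" "i \<noteq> stem" for i
    using f(2)[of "par i"] parent_in[OF that(1)] parent_eq_root[OF that(1)] that by simp
  have mono: "f (par i) \<le> f i" if "i \<in> V" for i
    using f(3)[of i] f(4)[of i] that by (cases "i \<in> layers n") (auto simp: layers_def)
  obtain C where "\<And>j. j \<in> V \<Longrightarrow> f j \<le> C" using finite_range_bound[of n f] f(4) by blast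
  then have fin: "SS f stem < \<infinity>" using f(2) by (intro SS_finite[of f C]) (auto simp: less_imp_le)
  define w where "w i = (if i = stem then \<infinity> else ereal (f i / f (par i)))" for i
  define u where "u i = \<nu> i * (f i - f (par i)) powr (p - 1)" for i
  have wf: "w stem = \<infinity>" "\<And>k. k \<in> V \<Longrightarrow> k \<noteq> stem \<Longrightarrow> w k = ereal (f k / f (par k))"
    by (simp_all add: w_def)
  have rf: "own_term p \<nu> w i * f i powr (p - 1) = u i"
      "child_term G r p \<nu> w i * f i powr (p - 1) = (\<Sum>j\<in>children G r i. u j)" if i: "i \<in> V" for i
    unfolding u_def by (rule ratio_flow[of f w i, OF f(1) f(2) mono wf i]; assumption)+
  have u_low: "u i = l * ss f i" if i: "i \<in> layers n" for i
  proof -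
    have "ennreal (u i) = ennreal (l * ss f i)"
      using f(5)[OF i] SS_ss[OF fin layers_V[OF i]] l ss_nonneg by (simp add: u_def ennreal_mult)
    moreover have "0 \<le> u i" using nu_pos[of i] layers_V[OF i] by (simp add: u_def)
    ultimately show ?thesis using l ss_nonneg by simp
  qed
  have u_high: "u j = 0" if "j \<in> V" "n < lev j" for j using f(4)[of j] that by (simp add: u_def)
  have defect: "own_term p \<nu> w i - child_term G r p \<nu> w i = l * tmass n i" if i: "i \<in> layers n" for i
  proof -
    have ssl: "ss f i = tmass n i * f i powr (p - 1) + (if lev i < n then \<Sum>j\<in>children G r i. ss f j else 0)"
      using f(4) by (intro ss_layers_step[OF n1(1) i fin]) auto
    have "(\<Sum>j\<in>children G r i. u j) = (if lev i < n then l * (\<Sum>j\<in>children G r i. ss f j) else 0)"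
    proof (cases "lev i < n")
      case True
      have "(\<Sum>j\<in>children G r i. u j) = (\<Sum>j\<in>children G r i. l * ss f j)"
        using level_children[OF layers_V[OF i]] True by (intro sum.cong refl u_low) (auto simp: layers_def)
      then show ?thesis using True by (simp add: sum_distrib_left)
    next
      case False
      have "(\<Sum>j\<in>children G r i. u j) = 0"
        using level_children[OF layers_V[OF i]] i False by (intro sum.neutral ballI u_high) (auto simp: layers_def)
      then show ?thesis using False by simp
    qed
    then have "(own_term p \<nu> w i - child_term G r p \<nu> w i) * f i powr (p - 1) = l * tmass n i * f i powr (p - 1)"
      unfolding left_diff_distrib rf[OF layers_V[OF i]] u_low[OF i] ssl by (simp add: distrib_left)
    then show ?thesis using f(2)[OF layers_V[OF i]] by simp
  qed
  have w_high: "w i = 1" if "i \<in> V" "n < lev i" for i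
  proof -
    have "i \<noteq> stem" using that n1(1) level_stem by auto
    then show ?thesis using f(4)[of i] f_par[of i] that by (simp add: w_def one_ereal_def)
  qed
  have W: "(n, w) \<in> W_tilde_pairs G r p \<nu>"
  proof -
    have "1 < w i \<and> child_term G r p \<nu> w i < own_term p \<nu> w i" if "i \<in> pverts G" "1 \<le> lev i" "lev i \<le> n" for i
    proof
      have i: "i \<in> layers n" using that level_root by (auto simp: layers_def)
      show "1 < w i" using f(3)[OF i] f_par[of i] layers_V[OF i] by (simp add: w_def one_ereal_def)
      have "0 < l * tmass n i" using l tmass_pos[OF i] by simp
      then show "child_term G r p \<nu> w i < own_term p \<nu> w i" using defect[OF i] by linarith
    qed
    moreover have "w i = 1" if "i \<in> pverts G" "n + 1 \<le> lev i" for i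
      using w_high[of i] that by (cases "i = r") auto
    moreover have "w \<in> W_base G r"
      unfolding W_base_def children_root by (simp add: w_def)
    ultimately show ?thesis
      unfolding W_tilde_pairs_def W_tilde_def using n1 by auto
  qed
  have "R_tilde G r p \<nu> \<mu> n w i \<le> l" if i: "i \<in> V" for i
  proof (cases "i \<in> layers n")
    case True
    have eq: "inverse (tmass n i) * (l * tmass n i) = l" using tmass_pos[OF True] by simp
    show ?thesis
      unfolding R_tilde_def R_tilde_mass[OF n1(1) True] defect[OF True] eq by (rule order_refl)
  next
    case False
    then have "n < lev i" using i by (simp add: layers_def)
    then have "own_term p \<nu> w i = 0" "child_term G r p \<nu> w i = 0"
      using w_high level_children[OF i] i p_gt_1
      by (auto simp: own_term_def child_term_def intro!: sum.neutral)
    then show ?thesis using l by (simp add: R_tilde_def)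
  qed
  then have "(SUP i\<in>V. ereal (R_tilde G r p \<nu> \<mu> n w i)) \<le> ereal l" by (intro SUP_least) simp
  then show ?thesis using W by blast
qed

end

section \<open>Sharpness\<close>

context weighted_tree
begin

lemma upper_bound_R:
  assumes "(m, w) \<in> W_tilde_pairs G r p \<nu>"
  shows "enn2ereal lam \<le> (SUP i\<in>V. ereal (R_tilde G r p \<nu> \<mu> m w i))"
proof -
  obtain f where f: "f \<in> F_I_tilde G r"
    "enn2ereal (SUP i\<in>V. inverse (I_op G r p \<nu> \<mu> f i)) \<le> (SUP i\<in>V. ereal (R_tilde G r p \<nu> \<mu> m w i))"
    using upper_I_le_R_tilde[OF assms] by blast
  have "lam \<le> (SUP i\<in>V. inverse (II_op G r p \<nu> \<mu> f i))"
    using f(1) F_I_tilde_subset by (intro upper_bound_II) blast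
  also have "\<dots> \<le> (SUP i\<in>V. inverse (I_op G r p \<nu> \<mu> f i))" by (rule upper_II_le_I[OF f(1)])
  finally show ?thesis using f(2) by (meson less_eq_ennreal.rep_eq order_trans)
qed

text \<open>
  The truncated eigenvalues come down to \<open>lambda_p\<close>: a competitor for \<open>lambda_p\<close> is, after truncation, a competitor
  for every truncated problem, with no more energy and, for deep truncations, at least almost its mass.
\<close>

lemma upper_bounds_sharp:
  "(INF (m, w)\<in>W_tilde_pairs G r p \<nu>. SUP i\<in>V. ereal (R_tilde G r p \<nu> \<mu> m w i)) \<le> enn2ereal lam"
proof -
  define X where "X = (INF (m, w)\<in>W_tilde_pairs G r p \<nu>. SUP i\<in>V. ereal (R_tilde G r p \<nu> \<mu> m w i))"
  have "enn2ereal lam \<le> X"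
    unfolding X_def by (intro INF_greatest) (auto intro: upper_bound_R)
  then have "0 \<le> X" using enn2ereal_nonneg order_trans by blast
  then have x: "enn2ereal (e2ennreal X) = X" by (rule enn2ereal_e2ennreal)
  have trunc: "e2ennreal X * mu_p G p \<mu> (\<lambda>j. g (anc n j)) \<le> D_p G r p \<nu> g" if n: "n \<in> depths" and g: "g r = 0" for n g
  proof -
    have n1: "1 \<le> n" using n by (simp add: depths_def)
    obtain l f where pair: "truncated_eigenpair n l f" using truncated_eigenpair_exists[OF n1] by blast
    then have ray: "ennreal l * mu_p G p \<mu> (\<lambda>j. g (anc n j)) \<le> D_p G r p \<nu> g"
      using g by (simp add: truncated_eigenpair_def)
    obtain w where w: "(n, w) \<in> W_tilde_pairs G r p \<nu>" "(SUP i\<in>V. ereal (R_tilde G r p \<nu> \<mu> n w i)) \<le> ereal l"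
      using R_tilde_eigenfunction[OF n pair] by blast
    have "X \<le> (SUP i\<in>V. ereal (R_tilde G r p \<nu> \<mu> n w i))"
      unfolding X_def using INF_lower[OF w(1), of "\<lambda>(m, w). SUP i\<in>V. ereal (R_tilde G r p \<nu> \<mu> m w i)"] by simp
    also note w(2)
    finally have "e2ennreal X \<le> ennreal l" using e2ennreal_mono by fastforce
    then have "e2ennreal X * mu_p G p \<mu> (\<lambda>j. g (anc n j)) \<le> ennreal l * mu_p G p \<mu> (\<lambda>j. g (anc n j))"
      by (rule mult_right_mono) simp
    then show ?thesis using ray by (rule order_trans)
  qed
  have "e2ennreal X \<le> D_p G r p \<nu> g" if g: "mu_p G p \<mu> g = 1" "g r = 0" for g
  proof -
    have "e2ennreal X * 1 \<le> e2ennreal X * (SUP n\<in>depths. mu_p G p \<mu> (\<lambda>j. g (anc n j)))"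
      using mu_p_le_SUP_anc[of g, OF g(2)] g(1) by (intro mult_left_mono) simp_all
    also have "\<dots> = (SUP n\<in>depths. e2ennreal X * mu_p G p \<mu> (\<lambda>j. g (anc n j)))"
      by (rule SUP_mult_left_ennreal)
    also have "\<dots> \<le> D_p G r p \<nu> g" using trunc[of _ g, OF _ g(2)] by (intro SUP_least) simp
    finally show ?thesis by simp
  qed
  then have "e2ennreal X \<le> lam" unfolding lambda_p_def by (intro Inf_greatest) auto
  then have "enn2ereal (e2ennreal X) \<le> enn2ereal lam" by (simp add: less_eq_ennreal.rep_eq)
  then have "X \<le> enn2ereal lam" unfolding x .
  then show ?thesis unfolding X_def .
qed

text \<open>
  The truncated eigenfunctions, normalised at the child of the root, are bounded vertex by vertex, so they lie in a
  compact product. There the inequalities between \<open>lambda_p\<close> times finite subtree sums and the flow are closed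
  conditions, any finitely many of which hold for a deep enough truncation.
\<close>

lemma limit_of_eigenfunctions:
  assumes "lam \<noteq> 0"
  obtains f where "f \<in> F_I G r" "\<And>i. i \<in> V \<Longrightarrow> lam * SS f i \<le> ennreal (\<nu> i * (f i - f (par i)) powr (p - 1))"
proof -
  have eig: "\<exists>l f. lam \<le> ennreal l \<and> truncated_eigenpair n l f" if n: "n \<in> depths" for n
  proof -
    have n1: "1 \<le> n" using n by (simp add: depths_def)
    obtain l f where pair: "truncated_eigenpair n l f" using truncated_eigenpair_exists[OF n1] by blast
    then have l: "0 < l" by (simp add: truncated_eigenpair_def)
    obtain w where w: "(n, w) \<in> W_tilde_pairs G r p \<nu>" "(SUP i\<in>V. ereal (R_tilde G r p \<nu> \<mu> n w i)) \<le> ereal l"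
      using R_tilde_eigenfunction[OF n pair] by blast
    have "enn2ereal lam \<le> ereal l" using upper_bound_R[OF w(1)] w(2) by (rule order_trans)
    then have "lam \<le> ennreal l" using l by (simp add: less_eq_ennreal.rep_eq enn2ereal_ennreal)
    then show ?thesis using pair by blast
  qed
  have "1 \<in> depths" using depths_level[OF stem_in] level_stem by simp
  then have "lam < \<infinity>" using eig[of 1] by (auto intro: order_le_less_trans)
  define c where "c = enn2real lam"
  have c: "lam = ennreal c" "0 < c"
    using \<open>lam < \<infinity>\<close> assms by (auto simp: c_def enn2real_positive_iff zero_less_iff_neq_zero)
  \<comment> \<open>The flow through \<open>stem\<close> is \<open>\<nu> stem\<close>, which bounds \<open>c * \<mu> i * f i powr (p - 1)\<close> for every \<open>i\<close>.\<close>
  define S where "S i = (if i \<in> V then {0..(\<nu> stem / (c * \<mu> i)) powr (1 / (p - 1))} else {0 :: real})" for i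
  \<comment> \<open>The positive part makes the right-hand side continuous in \<open>f\<close>; as \<open>f (par i) \<le> f i\<close>, it changes no value.\<close>
  define Q where "Q = (\<lambda>(i, F). {f :: 'v \<Rightarrow> real. f stem = 1} \<inter> {f. f (par i) \<le> f i} \<inter>
    {f. c * (\<Sum>j\<in>F. \<mu> j * f j powr (p - 1)) \<le> \<nu> i * (max 0 (f i - f (par i))) powr (p - 1)} \<inter> {f. \<forall>j. 0 \<le> f j})"
  define N where "N = {(i, F). i \<in> V \<and> finite F \<and> F \<subseteq> desc i}"
  have "{f. \<forall>i. f i \<in> S i} \<inter> \<Inter> (Q ` N) \<noteq> {}"
  proof (rule compact_imp_fip_image)
    show "compact {f. \<forall>i. f i \<in> S i}" by (rule compact_box) (simp add: S_def)
    show "closed (Q x)" if "x \<in> N" for x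
    proof -
      obtain i F where x: "x = (i, F)" by (cases x)
      have "closed ({f :: 'v \<Rightarrow> real. \<forall>j. 0 \<le> f j} \<inter>
          {f. c * (\<Sum>j\<in>F. \<mu> j * (max 0 (f j)) powr (p - 1)) \<le> \<nu> i * (max 0 (f i - f (par i))) powr (p - 1)})"
        using p_gt_1
        by (intro closed_Int closed_Collect_all closed_Collect_le continuous_on_sum continuous_on_mult
            continuous_on_powr' continuous_on_max continuous_on_diff continuous_on_const continuous_on_coordinate) auto
      moreover have "closed {f :: 'v \<Rightarrow> real. f stem = 1}" "closed {f :: 'v \<Rightarrow> real. f (par i) \<le> f i}"
        by (intro closed_Collect_eq closed_Collect_le continuous_on_const continuous_on_coordinate)+
      moreover have "Q x = {f. f stem = 1} \<inter> {f. f (par i) \<le> f i} \<inter> ({f. \<forall>j. 0 \<le> f j} \<inter>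
          {f. c * (\<Sum>j\<in>F. \<mu> j * (max 0 (f j)) powr (p - 1)) \<le> \<nu> i * (max 0 (f i - f (par i))) powr (p - 1)})"
        unfolding x Q_def by (auto simp: max_absorb2)
      ultimately show ?thesis by (simp add: closed_Int)
    qed
    fix I assume I: "finite I" "I \<subseteq> N"
    have "finite (fst ` I)" "fst ` I \<subseteq> V" using I by (auto simp: N_def)
    then obtain n where n: "n \<in> depths" "\<And>i. i \<in> fst ` I \<Longrightarrow> lev i \<le> n"
      using depths_Max by blast
    obtain l f where l: "lam \<le> ennreal l" and pair: "truncated_eigenpair n l f"
      using eig[OF n(1)] by blast
    from pair have f: "f stem = 1" "\<forall>i. i \<notin> V \<longrightarrow> f i = 0" "\<forall>i\<in>V. 0 < f i" "\<forall>i\<in>V. f (par i) \<le> f i"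
      and EL: "\<forall>i\<in>layers n. ennreal (\<nu> i * (f i - f (par i)) powr (p - 1)) = ennreal l * SS f i"
      by (simp_all add: truncated_eigenpair_def)
    have f0: "0 \<le> f j" for j using f by (cases "j \<in> V") (auto simp: less_imp_le)
    have key: "c * (\<Sum>j\<in>F. \<mu> j * f j powr (p - 1)) \<le> \<nu> i * (f i - f (par i)) powr (p - 1)"
      if i: "i \<in> layers n" and F: "finite F" "F \<subseteq> desc i" for i F
    proof -
      have FV: "F \<subseteq> V" using F sub_subset[OF layers_V[OF i]] by blast
      have mu: "0 \<le> \<mu> j" if "j \<in> F" for j using mu_pos[of j] that FV by auto
      have "ennreal (c * (\<Sum>j\<in>F. \<mu> j * f j powr (p - 1))) = lam * ennreal (\<Sum>j\<in>F. \<mu> j * f j powr (p - 1))"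
        using c mu by (simp add: ennreal_mult sum_nonneg)
      also have "ennreal (\<Sum>j\<in>F. \<mu> j * f j powr (p - 1)) = (\<Sum>j\<in>F. ennreal (\<mu> j * f j powr (p - 1)))"
        using mu by (intro sum_ennreal[symmetric]) simp
      also have "lam * (\<Sum>j\<in>F. ennreal (\<mu> j * f j powr (p - 1))) \<le> ennreal l * SS f i"
        unfolding subtree_sum_def by (intro mult_mono l sum_le_infsum_ennreal F) simp_all
      also have "\<dots> = ennreal (\<nu> i * (f i - f (par i)) powr (p - 1))" using EL i by simp
      finally show ?thesis
        using nu_pos[of i] layers_V[OF i] by (subst (asm) ennreal_le_iff) simp_all
    qed
    have "f i \<in> S i" for i
    proof (cases "i \<in> V")
      case True
      have st: "stem \<in> layers n" using n(1) by (intro stem_in_layers) (simp add: depths_def)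
      have mu: "0 < \<mu> i" using mu_pos[of i] True by simp
      have "c * (\<Sum>j\<in>{i}. \<mu> j * f j powr (p - 1)) \<le> \<nu> stem * (f stem - f (par stem)) powr (p - 1)"
        using True by (intro key[OF st]) (simp_all add: sub_stem)
      then have "f i powr (p - 1) \<le> \<nu> stem / (c * \<mu> i)"
        using c mu f by (simp add: parent_stem field_simps)
      then have "(f i powr (p - 1)) powr (1 / (p - 1)) \<le> (\<nu> stem / (c * \<mu> i)) powr (1 / (p - 1))"
        using p_gt_1 by (intro powr_mono2) auto
      then have "f i \<le> (\<nu> stem / (c * \<mu> i)) powr (1 / (p - 1))"
        using p_gt_1 f0[of i] by (subst (asm) powr_inverse_exponent) auto
      then show ?thesis using True f0 by (simp add: S_def)
    qed (use f in \<open>simp add: S_def\<close>)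
    moreover have "f \<in> Q x" if x: "x \<in> I" for x
    proof -
      obtain i F where xi: "x = (i, F)" by (cases x)
      have i: "i \<in> V" "finite F" "F \<subseteq> desc i" using x I xi by (auto simp: N_def)
      have "i \<in> layers n" using n(2)[of i] x xi i by (force simp: layers_def)
      then show ?thesis
        unfolding xi Q_def using key[of i F] i f f0 by (simp add: max_absorb2)
    qed
    ultimately show "{f. \<forall>i. f i \<in> S i} \<inter> \<Inter> (Q ` I) \<noteq> {}" by blast
  qed
  then obtain f where f: "\<And>i. f i \<in> S i" "\<And>x. x \<in> N \<Longrightarrow> f \<in> Q x" by blast
  have fs: "f stem = 1"
    using f(2)[of "(stem, {})"] stem_in by (simp add: N_def Q_def)
  have fr: "f r = 0" using f(1)[of r] by (simp add: S_def)
  have mono: "f (par i) \<le> f i" if "i \<in> V" for i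
    using f(2)[of "(i, {})"] that by (simp add: N_def Q_def)
  have pos: "0 < f i" if "i \<in> V" for i using increasing_imp_pos[of f i] fr mono fs that by simp
  have key: "c * (\<Sum>j\<in>F. \<mu> j * f j powr (p - 1)) \<le> \<nu> i * (f i - f (par i)) powr (p - 1)"
    if "i \<in> V" "finite F" "F \<subseteq> desc i" for i F
    using f(2)[of "(i, F)"] mono[of i] that by (simp add: N_def Q_def max_absorb2)
  have strict: "f (par i) < f i" if i: "i \<in> V" for i
  proof -
    have "0 < c * (\<mu> i * f i powr (p - 1))" using c mu_pos[of i] pos[OF i] i by simp
    also have "\<dots> \<le> \<nu> i * (f i - f (par i)) powr (p - 1)"
      using key[of i "{i}"] i self_in_sub[OF i] by simp
    finally have "f i \<noteq> f (par i)" by auto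
    then show ?thesis using mono[OF i] by simp
  qed
  have "lam * SS f i \<le> ennreal (\<nu> i * (f i - f (par i)) powr (p - 1))" if i: "i \<in> V" for i
    unfolding subtree_sum_def infsum_cmult_ennreal[symmetric]
  proof (rule infsum_le_ennreal)
    fix F assume F: "finite F" "F \<subseteq> desc i"
    have mu: "0 \<le> \<mu> j" if "j \<in> F" for j
      using mu_pos[of j] that F sub_subset[OF i] by (auto simp: less_imp_le)
    have "(\<Sum>j\<in>F. lam * ennreal (\<mu> j * f j powr (p - 1))) = (\<Sum>j\<in>F. ennreal (c * (\<mu> j * f j powr (p - 1))))"
      using c mu by (intro sum.cong) (simp_all add: ennreal_mult)
    also have "\<dots> = ennreal (\<Sum>j\<in>F. c * (\<mu> j * f j powr (p - 1)))"
      using c mu by (intro sum_ennreal) simp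
    also have "\<dots> \<le> ennreal (\<nu> i * (f i - f (par i)) powr (p - 1))"
      using key[OF i F] by (intro ennreal_leI) (simp add: sum_distrib_left)
    finally show "(\<Sum>j\<in>F. lam * ennreal (\<mu> j * f j powr (p - 1))) \<le> ennreal (\<nu> i * (f i - f (par i)) powr (p - 1))" .
  qed
  then show ?thesis using that[of f] fr strict by (simp add: F_I_def)
qed

lemma lower_bounds_sharp:
  "enn2ereal lam \<le> (SUP w\<in>W_set G r. INF i\<in>V. ereal (R_op G r p \<nu> \<mu> w i))"
proof -
  have sharp: "enn2ereal lam \<le> (SUP w\<in>W_set G r. INF i\<in>V. ereal (R_op G r p \<nu> \<mu> w i))"
    if pos: "\<And>i. i \<in> V \<Longrightarrow> 0 < f i" and fin: "SS f stem < \<infinity>"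
      and le: "\<And>i. i \<in> V \<Longrightarrow> lam \<le> inverse (II_op G r p \<nu> \<mu> f i)" for f
  proof -
    obtain w where w: "w \<in> W_set G r" "\<And>i. i \<in> V \<Longrightarrow> R_op G r p \<nu> \<mu> w i = (f i / pot f i) powr (p - 1)"
      using ratio_of_pot[of f] pos fin by blast
    have SSp: "0 < SS f stem" using SS_pos_self[of stem f] pos stem_in by blast
    have "enn2ereal lam \<le> ereal (R_op G r p \<nu> \<mu> w i)" if i: "i \<in> V" for i
    proof -
      have "lam \<le> ennreal (R_op G r p \<nu> \<mu> w i)"
        using le[OF i] inverse_II_pot[OF fin SSp i] pos[OF i] w(2)[OF i] by simp
      then have "enn2ereal lam \<le> enn2ereal (ennreal (R_op G r p \<nu> \<mu> w i))"
        by (simp add: less_eq_ennreal.rep_eq)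
      then show ?thesis using w(2)[OF i] by (simp add: enn2ereal_ennreal)
    qed
    then have "enn2ereal lam \<le> (INF i\<in>V. ereal (R_op G r p \<nu> \<mu> w i))" by (intro INF_greatest)
    also have "\<dots> \<le> (SUP w\<in>W_set G r. INF i\<in>V. ereal (R_op G r p \<nu> \<mu> w i))" by (rule SUP_upper[OF w(1)])
    finally show ?thesis .
  qed
  show ?thesis
  proof (cases "lam = 0")
    case True
    \<comment> \<open>\<open>R\<close> may be negative, so a witness is needed here too; any bounded positive \<open>f\<close> gives positive values.\<close>
    have "SS (\<lambda>_. 1) stem < \<infinity>" by (rule SS_finite[of _ 1]) simp_all
    then show ?thesis using sharp[of "\<lambda>_. 1"] True by simp
  next
    case False
    obtain f where f: "f \<in> F_I G r" "\<And>i. i \<in> V \<Longrightarrow> lam * SS f i \<le> ennreal (\<nu> i * (f i - f (par i)) powr (p - 1))"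
      using limit_of_eigenfunctions[OF False] by blast
    have pos: "0 < f i" if "i \<in> V" for i using f(1) F_I_subset_F_II that by (auto simp: F_II_def)
    have SS: "SS f i \<noteq> 0" "SS f i \<noteq> top" if i: "i \<in> V" for i
    proof -
      show "SS f i \<noteq> 0" using SS_pos_self[of i f] pos i by fastforce
      have "lam * SS f i < top" using f(2)[OF i] by (rule order_le_less_trans) simp
      then show "SS f i \<noteq> top" using False by (auto simp: ennreal_mult_top)
    qed
    have "lam \<le> inverse (I_op G r p \<nu> \<mu> f i)" if i: "i \<in> V" for i
      unfolding inverse_I[of f i, OF SS(1)[OF i]]
      by (rule mult_le_imp_le_divide_ennreal[OF f(2)[OF i] SS[OF i]])
    then have "lam \<le> (INF i\<in>V. inverse (I_op G r p \<nu> \<mu> f i))" by (intro INF_greatest)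
    also have "\<dots> \<le> (INF i\<in>V. inverse (II_op G r p \<nu> \<mu> f i))" by (rule lower_I_le_II[OF f(1)])
    finally have "lam \<le> inverse (II_op G r p \<nu> \<mu> f i)" if "i \<in> V" for i
      using that by (meson INF_lower order_trans)
    then show ?thesis using SS(2)[OF stem_in] pos by (intro sharp[of f]) (auto simp: less_top[symmetric])
  qed
qed

text \<open>
  Both chains of inequalities start and end at \<open>lambda_p\<close>, so every member equals it.
\<close>

lemma lower_chain:
  "(SUP f\<in>F_I G r. INF i\<in>V. inverse (I_op G r p \<nu> \<mu> f i)) = lam"
  "(SUP f\<in>F_I G r. INF i\<in>V. inverse (II_op G r p \<nu> \<mu> f i)) = lam"
  "(SUP f\<in>F_II G r. INF i\<in>V. inverse (II_op G r p \<nu> \<mu> f i)) = lam"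
  "(SUP w\<in>W_set G r. INF i\<in>V. ereal (R_op G r p \<nu> \<mu> w i)) = enn2ereal lam"
proof -
  define I where "I = (SUP f\<in>F_I G r. INF i\<in>V. inverse (I_op G r p \<nu> \<mu> f i))"
  define II where "II = (SUP f\<in>F_I G r. INF i\<in>V. inverse (II_op G r p \<nu> \<mu> f i))"
  define II' where "II' = (SUP f\<in>F_II G r. INF i\<in>V. inverse (II_op G r p \<nu> \<mu> f i))"
  define R where "R = (SUP w\<in>W_set G r. INF i\<in>V. ereal (R_op G r p \<nu> \<mu> w i))"
  have 1: "I \<le> II" unfolding I_def II_def by (intro SUP_mono) (use lower_I_le_II in blast)
  have 2: "II \<le> II'" unfolding II_def II'_def by (intro SUP_subset_mono F_I_subset_F_II) simp
  have 3: "II' \<le> lam" unfolding II'_def by (intro SUP_least lower_bound_II)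
  have 4: "R \<le> enn2ereal I"
    unfolding R_def
  proof (rule SUP_least)
    fix w assume "w \<in> W_set G r"
    then obtain f where f: "f \<in> F_I G r"
      "(INF i\<in>V. ereal (R_op G r p \<nu> \<mu> w i)) \<le> enn2ereal (INF i\<in>V. inverse (I_op G r p \<nu> \<mu> f i))"
      using lower_R_le_I by blast
    have "(INF i\<in>V. inverse (I_op G r p \<nu> \<mu> f i)) \<le> I" unfolding I_def by (rule SUP_upper[OF f(1)])
    then have "enn2ereal (INF i\<in>V. inverse (I_op G r p \<nu> \<mu> f i)) \<le> enn2ereal I"
      by (simp add: less_eq_ennreal.rep_eq)
    with f(2) show "(INF i\<in>V. ereal (R_op G r p \<nu> \<mu> w i)) \<le> enn2ereal I" by (rule order_trans)
  qed
  have 5: "enn2ereal lam \<le> R" unfolding R_def by (rule lower_bounds_sharp)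
  have "lam \<le> I" using order_trans[OF 5 4] by (simp add: less_eq_ennreal.rep_eq)
  then have eq: "I = lam" "II = lam" "II' = lam" using 1 2 3 by simp_all
  show "I = lam" "II = lam" "II' = lam" by (fact eq)+
  show "R = enn2ereal lam" using 4 5 eq by simp
qed

lemma upper_chain:
  "(INF f\<in>F_I_tilde G r. SUP i\<in>V. inverse (I_op G r p \<nu> \<mu> f i)) = lam"
  "(INF f\<in>F_I_tilde G r. SUP i\<in>V. inverse (II_op G r p \<nu> \<mu> f i)) = lam"
  "(INF f\<in>F_II_tilde G r. SUP i\<in>V. inverse (II_op G r p \<nu> \<mu> f i)) = lam"
  "(INF f\<in>F_II_tilde' G r p \<nu> \<mu> \<union> F_II_tilde G r. SUP i\<in>V. inverse (II_op G r p \<nu> \<mu> f i)) = lam"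
  "(INF (m, w)\<in>W_tilde_pairs G r p \<nu>. SUP i\<in>V. ereal (R_tilde G r p \<nu> \<mu> m w i)) = enn2ereal lam"
proof -
  define I where "I = (INF f\<in>F_I_tilde G r. SUP i\<in>V. inverse (I_op G r p \<nu> \<mu> f i))"
  define II where "II = (INF f\<in>F_I_tilde G r. SUP i\<in>V. inverse (II_op G r p \<nu> \<mu> f i))"
  define II' where "II' = (INF f\<in>F_II_tilde G r. SUP i\<in>V. inverse (II_op G r p \<nu> \<mu> f i))"
  define II'' where "II'' = (INF f\<in>F_II_tilde' G r p \<nu> \<mu> \<union> F_II_tilde G r. SUP i\<in>V. inverse (II_op G r p \<nu> \<mu> f i))"
  define R where "R = (INF (m, w)\<in>W_tilde_pairs G r p \<nu>. SUP i\<in>V. ereal (R_tilde G r p \<nu> \<mu> m w i))"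
  have 1: "II \<le> I" unfolding I_def II_def by (intro INF_mono) (use upper_II_le_I in blast)
  have 2: "II' \<le> II" unfolding II_def II'_def by (intro INF_superset_mono F_I_tilde_subset) simp
  have 3: "II'' \<le> II'" unfolding II'_def II''_def by (intro INF_superset_mono) simp_all
  have 4: "lam \<le> II''" unfolding II''_def by (intro INF_greatest upper_bound_II)
  have 5: "enn2ereal I \<le> R"
    unfolding R_def
  proof (rule INF_greatest)
    fix x assume x: "x \<in> W_tilde_pairs G r p \<nu>"
    obtain m w where mw: "x = (m, w)" by (cases x)
    obtain f where f: "f \<in> F_I_tilde G r"
      "enn2ereal (SUP i\<in>V. inverse (I_op G r p \<nu> \<mu> f i)) \<le> (SUP i\<in>V. ereal (R_tilde G r p \<nu> \<mu> m w i))"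
      using upper_I_le_R_tilde x unfolding mw by blast
    have "I \<le> (SUP i\<in>V. inverse (I_op G r p \<nu> \<mu> f i))" unfolding I_def by (rule INF_lower[OF f(1)])
    then have "enn2ereal I \<le> enn2ereal (SUP i\<in>V. inverse (I_op G r p \<nu> \<mu> f i))"
      by (simp add: less_eq_ennreal.rep_eq)
    then show "enn2ereal I \<le> (case x of (m, w) \<Rightarrow> SUP i\<in>V. ereal (R_tilde G r p \<nu> \<mu> m w i))"
      using f(2) unfolding mw by simp
  qed
  have 6: "R \<le> enn2ereal lam" unfolding R_def by (rule upper_bounds_sharp)
  have "I \<le> lam" using order_trans[OF 5 6] by (simp add: less_eq_ennreal.rep_eq)
  then have eq: "I = lam" "II = lam" "II' = lam" "II'' = lam" using 1 2 3 4 by simp_all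
  show "I = lam" "II = lam" "II' = lam" "II'' = lam" by (fact eq)+
  show "R = enn2ereal lam" using 5 6 eq by simp
qed

end

theorem theorem2p2:
  fixes G :: "'v pair_pre_digraph" and r :: 'v and p :: real and \<nu> \<mu> :: "'v \<Rightarrow> real"
  assumes tree: "rooted_tree G r"
    and one_child: "card (children G r r) = 1"
    and nu_pos: "\<forall>i\<in>pverts G. \<nu> i > 0"
    and mu_pos: "\<forall>i\<in>pverts G. \<mu> i > 0"
    and mu_summable: "\<mu> summable_on pverts G"
    and p_gt_1: "p > 1"
  shows
    "((SUP f\<in>F_I G r. INF i\<in>pverts G - {r}. inverse (I_op G r p \<nu> \<mu> f i)) \<le> lambda_p G r p \<nu> \<mu> \<and>
      lambda_p G r p \<nu> \<mu> \<le> (INF f\<in>F_I_tilde G r. SUP i\<in>pverts G - {r}. inverse (I_op G r p \<nu> \<mu> f i)))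
     \<and>
     ((\<forall>S\<in>{F_II G r, F_I G r}.
        (SUP f\<in>S. INF i\<in>pverts G - {r}. inverse (II_op G r p \<nu> \<mu> f i)) \<le> lambda_p G r p \<nu> \<mu>) \<and>
      (\<forall>S\<in>{F_II_tilde G r, F_I_tilde G r, F_II_tilde' G r p \<nu> \<mu> \<union> F_II_tilde G r}.
        lambda_p G r p \<nu> \<mu> \<le> (INF f\<in>S. SUP i\<in>pverts G - {r}. inverse (II_op G r p \<nu> \<mu> f i))))
     \<and>
     ((SUP w\<in>W_set G r. INF i\<in>pverts G - {r}. ereal (R_op G r p \<nu> \<mu> w i))
        \<le> enn2ereal (lambda_p G r p \<nu> \<mu>) \<and>
      enn2ereal (lambda_p G r p \<nu> \<mu>)
        \<le> (INF (m, w)\<in>W_tilde_pairs G r p \<nu>. SUP i\<in>pverts G - {r}. ereal (R_tilde G r p \<nu> \<mu> m w i)))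
     \<and>
     (p \<ge> 2 \<longrightarrow>
      ((SUP f\<in>F_I G r. INF i\<in>pverts G - {r}. inverse (I_op G r p \<nu> \<mu> f i)) = lambda_p G r p \<nu> \<mu> \<and>
       lambda_p G r p \<nu> \<mu> = (INF f\<in>F_I_tilde G r. SUP i\<in>pverts G - {r}. inverse (I_op G r p \<nu> \<mu> f i)))
      \<and>
      ((\<forall>S\<in>{F_II G r, F_I G r}.
         (SUP f\<in>S. INF i\<in>pverts G - {r}. inverse (II_op G r p \<nu> \<mu> f i)) = lambda_p G r p \<nu> \<mu>) \<and>
       (\<forall>S\<in>{F_II_tilde G r, F_I_tilde G r, F_II_tilde' G r p \<nu> \<mu> \<union> F_II_tilde G r}.
         lambda_p G r p \<nu> \<mu> = (INF f\<in>S. SUP i\<in>pverts G - {r}. inverse (II_op G r p \<nu> \<mu> f i))))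
      \<and>
      ((SUP w\<in>W_set G r. INF i\<in>pverts G - {r}. ereal (R_op G r p \<nu> \<mu> w i))
         = enn2ereal (lambda_p G r p \<nu> \<mu>) \<and>
       enn2ereal (lambda_p G r p \<nu> \<mu>)
         = (INF (m, w)\<in>W_tilde_pairs G r p \<nu>. SUP i\<in>pverts G - {r}. ereal (R_tilde G r p \<nu> \<mu> m w i))))"
proof -
  interpret weighted_tree G r p \<nu> \<mu>
    by (intro weighted_tree.intro weighted_tree_axioms.intro tree) (use assms in auto)
  show ?thesis
    by (simp only: lower_chain upper_chain ball_simps order_refl simp_thms)
qed

end
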